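(* There is an induced ring structure on the space of quantum dimensions of $\mathcal{M}(p)$-modules. For $\operatorname{Re}(\epsilon)<B^p_\epsilon$, this ring is isomorphic to the fusion ring of $A_1^{(1)}$ at level $p-2$.
   Context: Let $p\ge2$ be an integer, $\alpha_0=\sqrt{2p}-\sqrt{2/p}$, $q=e^{2\pi i\tau}$ (with $q^x:=e^{2\pi i\tau x}$), $\eta$ the Dedekind eta function. The singlet vertex operator algebra $\mathcal{M}(p)$ is the kernel of a screening operator on the rank one Heisenberg vertex algebra; $\mathcal{F}_\lambda$ ($\lambda\in\mathbb{C}$) are its Fock (standard) modules and $M_{r,s}$ ($r\in\mathbb{Z}$, $1\le s\le p$) its irreducible modules labelled by a discrete set, with $M_{1,1}=\mathcal{M}(p)$ the vacuum module. Their $\epsilon$-regularised characters ($\epsilon\in\mathbb{C}$) are $$\mathrm{ch}[\mathcal{F}^\epsilon_\lambda](\tau)=e^{2\pi\epsilon(\lambda-\alpha_0/2)}\frac{q^{(\lambda-\alpha_0/2)^2/2}}{\eta(\tau)},$$ $$\mathrm{ch}[M^\epsilon_{r,s}](\tau)=\frac1{\eta(\tau)}\sum_{k\ge0}\left(e^{-2\pi\epsilon\sqrt{2p}\,u_k^-}q^{p(u_k^-)^2}-e^{-2\pi\epsilon\sqrt{2p}\,u_k^+}q^{p(u_k^+)^2}\right),\qquad u_k^{\pm}=k+\tfrac{2-r}{2}\pm\tfrac{s}{2p}.$$ The regularised quantum dimension is $\operatorname{qdim}[M^\epsilon]=\lim_{y\to0^+}\mathrm{ch}[M^\epsilon](iy)/\mathrm{ch}[M_{1,1}^\epsilon](iy)$.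 The space of quantum dimensions is the additive span of the functions $\epsilon\mapsto\operatorname{qdim}[X^\epsilon]$, $X$ an $\mathcal{M}(p)$-module; its product is multiplication of these functions. Further, $B^p_\epsilon=-\min\{|\frac{m}{\sqrt{2p}}-\operatorname{Im}(\epsilon)| : m\in\mathbb{Z}\setminus p\mathbb{Z}\}$. The fusion ring of $A_1^{(1)}$ at level $\ell\ge0$ is the fusion ring of the affine vertex operator algebra of $\mathfrak{sl}_2$ at level $\ell$: the free abelian group on $\varphi_0,\dots,\varphi_\ell$ with structure constants given by the Verlinde formula for $S_{a,b}=\sqrt{\frac{2}{\ell+2}}\sin\left(\pi\frac{(a+1)(b+1)}{\ell+2}\right)$, i.e. $\varphi_a\varphi_b=\sum_{c}\varphi_c$, the sum over $c\in\{|a-b|,|a-b|+2,\dots,\min(a+b,2\ell-a-b)\}$. *)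

theory Defs
  imports
    "HOL-Analysis.Analysis"
    "HOL-Algebra.Generated_Groups"
    "HOL-Algebra.QuotRing"
    "HOL-Library.Poly_Mapping"
begin

section \<open>Regularised characters of the singlet algebra\<close>

text \<open>\<open>q\<^sup>x = exp (2\<pi>i\<tau>x)\<close>: complex powers of \<open>q\<close> are defined through \<open>\<tau>\<close>, so that no branch of
  the logarithm is involved.\<close>

definition qpow :: "complex \<Rightarrow> complex \<Rightarrow> complex"
  where "qpow \<tau> x = exp (2 * of_real pi * \<i> * \<tau> * x)"

definition dedekind_eta :: "complex \<Rightarrow> complex"
  where "dedekind_eta \<tau> = qpow \<tau> (1 / 24) * prodinf (\<lambda>n. 1 - qpow \<tau> (of_nat (Suc n)))"

definition alpha0 :: "nat \<Rightarrow> real"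
  where "alpha0 p = sqrt (2 * real p) - sqrt (2 / real p)"

datatype singlet_module = Fock complex | Irr int nat

text \<open>The labels in use are \<open>Fock \<nu>\<close> for every complex \<open>\<nu>\<close>, and \<open>Irr r s\<close> with \<open>1 \<le> s \<le> p\<close>.
  They include all irreducible modules. A character is additive on short exact sequences, so these
  labels already give the additive span of the characters of all modules of finite length.\<close>

definition singlet_modules :: "nat \<Rightarrow> singlet_module set"
  where "singlet_modules p = range Fock \<union> {Irr r s | r s. 1 \<le> s \<and> s \<le> p}"

abbreviation vacuum :: singlet_module
  where "vacuum \<equiv> Irr 1 1"

definition u_minus :: "nat \<Rightarrow> int \<Rightarrow> nat \<Rightarrow> nat \<Rightarrow> real"
  where "u_minus p r s k = real k + (2 - of_int r) / 2 - real s / (2 * real p)"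

definition u_plus :: "nat \<Rightarrow> int \<Rightarrow> nat \<Rightarrow> nat \<Rightarrow> real"
  where "u_plus p r s k = real k + (2 - of_int r) / 2 + real s / (2 * real p)"

definition false_theta_term :: "nat \<Rightarrow> complex \<Rightarrow> complex \<Rightarrow> real \<Rightarrow> complex"
  where "false_theta_term p \<epsilon> \<tau> u =
    exp (- 2 * of_real pi * \<epsilon> * of_real (sqrt (2 * real p) * u)) * qpow \<tau> (of_real (real p * u\<^sup>2))"

fun reg_character :: "nat \<Rightarrow> complex \<Rightarrow> singlet_module \<Rightarrow> complex \<Rightarrow> complex"
  where
    "reg_character p \<epsilon> (Fock \<nu>) \<tau> =
      exp (2 * of_real pi * \<epsilon> * (\<nu> - of_real (alpha0 p / 2)))
        * qpow \<tau> ((\<nu> - of_real (alpha0 p / 2))\<^sup>2 / 2) / dedekind_eta \<tau>"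
  | "reg_character p \<epsilon> (Irr r s) \<tau> =
      1 / dedekind_eta \<tau> *
        suminf (\<lambda>k. false_theta_term p \<epsilon> \<tau> (u_minus p r s k) - false_theta_term p \<epsilon> \<tau> (u_plus p r s k))"


section \<open>Regularised quantum dimensions\<close>

definition character_quotient :: "nat \<Rightarrow> singlet_module \<Rightarrow> complex \<Rightarrow> real \<Rightarrow> complex"
  where "character_quotient p X \<epsilon> y =
    reg_character p \<epsilon> X (\<i> * of_real y) / reg_character p \<epsilon> vacuum (\<i> * of_real y)"

definition qdim :: "nat \<Rightarrow> singlet_module \<Rightarrow> complex \<Rightarrow> complex"
  where "qdim p X \<epsilon> = Lim (at_right 0) (character_quotient p X \<epsilon>)"

text \<open>The common natural domain of the functions \<open>\<epsilon> \<mapsto> qdim[X\<^sup>\<epsilon>]\<close>: the defining limits have to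
  exist. They do not exist everywhere. For \<open>Re \<epsilon> < B\<close>, if two integers not divisible by \<open>p\<close> both
  attain the minimum in the definition of \<open>B\<close>, then two terms of equal exponential growth
  oscillate against each other as \<open>y\<close> tends to \<open>0\<close>. The condition on the vacuum character
  excludes limits that would rest on the convention \<open>x / 0 = 0\<close>.\<close>

definition qdim_domain :: "nat \<Rightarrow> complex set"
  where "qdim_domain p = {\<epsilon>.
    (\<forall>\<^sub>F y in at_right 0. reg_character p \<epsilon> vacuum (\<i> * of_real y) \<noteq> 0) \<and>
    (\<forall>X\<in>singlet_modules p. \<exists>l. (character_quotient p X \<epsilon> \<longlongrightarrow> l) (at_right 0))}"

text \<open>The infimum is attained, so it is the minimum.\<close>

definition B_bound :: "nat \<Rightarrow> complex \<Rightarrow> real"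
  where "B_bound p \<epsilon> =
    - (INF m\<in>{m::int. \<not> int p dvd m}. \<bar>of_int m / sqrt (2 * real p) - Im \<epsilon>\<bar>)"


section \<open>The ring of quantum dimensions\<close>

definition function_ring :: "complex set \<Rightarrow> (complex \<Rightarrow> complex) ring"
  where "function_ring S = \<lparr>
    carrier = S \<rightarrow>\<^sub>E UNIV,
    mult = (\<lambda>f g. \<lambda>\<epsilon>\<in>S. f \<epsilon> * g \<epsilon>),
    one = (\<lambda>\<epsilon>\<in>S. 1),
    zero = (\<lambda>\<epsilon>\<in>S. 0),
    add = (\<lambda>f g. \<lambda>\<epsilon>\<in>S. f \<epsilon> + g \<epsilon>)\<rparr>"

definition qdim_space :: "nat \<Rightarrow> complex set \<Rightarrow> (complex \<Rightarrow> complex) set"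
  where "qdim_space p S =
    generate (add_monoid (function_ring S)) ((\<lambda>X. restrict (qdim p X) S) ` singlet_modules p)"

definition qdim_ring :: "nat \<Rightarrow> complex set \<Rightarrow> (complex \<Rightarrow> complex) ring"
  where "qdim_ring p S = (function_ring S)\<lparr>carrier := qdim_space p S\<rparr>"


section \<open>The fusion ring of affine sl(2) at level l\<close>

definition fusion_set :: "nat \<Rightarrow> nat \<Rightarrow> nat \<Rightarrow> nat set"
  where "fusion_set l a b =
    {c. \<exists>j::nat. int c = \<bar>int a - int b\<bar> + 2 * int j} \<inter> {..min (a + b) (2 * l - a - b)}"

text \<open>The underlying group is the free abelian group on \<open>0, \<dots>, l\<close>. Here \<open>frag_of a\<close> is the basis
  element \<open>\<phi>\<^sub>a\<close>, and \<open>frag_extend\<close> is additive extension from the basis, so the product is biadditive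
  with \<open>\<phi>\<^sub>a \<phi>\<^sub>b\<close> the sum of the \<open>\<phi>\<^sub>c\<close> over \<open>fusion_set l a b\<close>.\<close>

definition sl2_fusion_ring :: "nat \<Rightarrow> (nat \<Rightarrow>\<^sub>0 int) ring"
  where "sl2_fusion_ring l = \<lparr>
    carrier = {x. Poly_Mapping.keys x \<subseteq> {..l}},
    mult = (\<lambda>x y. frag_extend (\<lambda>a. frag_extend (\<lambda>b. \<Sum>c\<in>fusion_set l a b. frag_of c) y) x),
    one = frag_of 0,
    zero = 0,
    add = (+)\<rparr>"

end

theory Submission
  imports Defs "HOL-Probability.Characteristic_Functions" "HOL-Algebra.Subrings" "HOL-Real_Asymp.Real_Asymp"
begin

text \<open>
  After the eta function is cancelled, and with \<open>c = \<epsilon> \<surd>(2p)\<close> and \<open>Y = 2 p y\<close>, the character of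
  \<open>M\<^bsub>r,s\<^esub>\<close> at \<open>\<tau> = i y\<close> is a difference \<open>T b\<^sub>- - T b\<^sub>+\<close> of two half theta series, where
  \<open>T b = \<Sum>\<^bsub>k\<ge>0\<^esub> exp (- 2\<pi>c (k + b) - \<pi>Y (k + b)\<^sup>2)\<close> and the shifts \<open>b\<^sub>\<plusminus>\<close> are \<open>(2 - r) / 2 \<plusminus> s / 2p\<close>. The
  question is the behaviour for \<open>Y\<close> tending to \<open>0\<close>.

  The key statement is that at every point \<open>\<epsilon>\<close> of the domain there is a single number \<open>z\<close> such that
  the quantum dimension of \<open>M\<^bsub>r,s\<^esub>\<close> is \<open>z\<^sup>p\<^sup>(\<^sup>r\<^sup>-\<^sup>1\<^sup>) [s]\<close> with the quantum integer
  \<open>[s] = (z\<^sup>s - z\<^sup>-\<^sup>s) / (z - z\<^sup>-\<^sup>1)\<close> (\<open>exists_fusion_point\<close>).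

  For \<open>Re c \<ge> 0\<close> the Gaussian factor sums the geometric series of ratio \<open>exp (- 2\<pi>c)\<close>, which gives
  \<open>z = exp (2\<pi>\<epsilon> / \<surd>(2p))\<close>, and a Fock module has the value of its weight times \<open>[p]\<close>
  (\<open>half_theta_limit\<close>; ratio one is treated in \<open>half_theta_resonant\<close>). For \<open>Re c < 0\<close> Poisson
  summation (\<open>poisson_summation\<close>) rewrites the sum over all integers \<open>k\<close> in terms of the numbers
  \<open>exp (\<pi> (c - i m)\<^sup>2 / Y)\<close> for integers \<open>m\<close>. Their coefficients in \<open>T b\<^sub>- - T b\<^sub>+\<close> vanish if \<open>p\<close> divides
  \<open>m\<close>. Let \<open>d\<close> be the distance of \<open>Im c\<close> from the remaining integers. If \<open>- Re c < d\<close>, the dual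
  sum tends to zero and the formula for \<open>Re c \<ge> 0\<close> persists. If \<open>- Re c \<ge> d\<close>, the nearest \<open>m\<close>
  wins, division by \<open>exp (\<pi> (c - i m)\<^sup>2 / Y) / \<surd>Y\<close> makes all characters of the \<open>M\<^bsub>r,s\<^esub>\<close> converge,
  and \<open>z\<close> is the root of unity \<open>exp (i\<pi>m / p)\<close>; the characters of Fock modules stay bounded and their quantum
  dimensions vanish. If two integers are equally near, two oscillating terms compete, and
  the existence of the limits forces both of them to predict the same value
  (\<open>qdim_of_dominant\<close>).

  The rest is algebra of quantum integers. The Clebsch-Gordan rule for \<open>[s] [t]\<close> and the recurrence
  \<open>[t] = (z\<^sup>p + z\<^sup>-\<^sup>p) [t - p] - [t - 2p]\<close> show that the additive span is closed under products, on
  every subset of the domain (\<open>cring_qdim_ring\<close>). In the region \<open>Re \<epsilon> < B\<close> only the roots of unity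
  occur. There \<open>[2p - t] = - [t]\<close>, so the span is generated by \<open>[1], \<dots>, [p - 1]\<close> and
  Clebsch-Gordan is truncated to the fusion rules at level \<open>p - 2\<close> (\<open>qnum_fusion\<close>). These generators
  are linearly independent, since a relation would be a polynomial of degree less than \<open>2p\<close>
  vanishing at all roots of unity of order \<open>2p\<close> (\<open>qnum_independent\<close>).
\<close>

section \<open>Gaussian terms and half theta series\<close>

text \<open>With \<open>c = \<epsilon> \<surd>(2p)\<close> and \<open>Y = 2 p y\<close> this is the term of a character of \<open>M\<^bsub>r,s\<^esub>\<close> at
  \<open>\<tau> = i y\<close>, in a variable scaled so that the summation runs over a shifted copy of the integers.\<close>

definition gauss :: "complex \<Rightarrow> real \<Rightarrow> real \<Rightarrow> complex"
  where "gauss c Y x = exp (- (2 * of_real pi * c * of_real x) - of_real (pi * Y * x\<^sup>2))"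

text \<open>Completing the square: the modulus is a bell curve centred at \<open>- Re c / Y\<close>.\<close>

lemma norm_gauss:
  assumes "Y > 0"
  shows "norm (gauss c Y x) = exp (pi * (Re c)\<^sup>2 / Y) * exp (- (pi * Y) * (x - (- Re c / Y))\<^sup>2)"
proof -
  have "norm (gauss c Y x) = exp (- (2 * pi * Re c * x) - pi * Y * x\<^sup>2)"
    by (simp add: gauss_def norm_exp_eq_Re)
  also have "- (2 * pi * Re c * x) - pi * Y * x\<^sup>2 = pi * (Re c)\<^sup>2 / Y - pi * Y * (x + Re c / Y)\<^sup>2"
    using assms by (simp add: power2_eq_square field_simps)
  finally show ?thesis by (simp add: exp_add[symmetric])
qed

lemma shifted_square_bound:
  fixes A H h x :: real
  assumes "A > 0" "\<bar>h\<bar> \<le> H"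
  shows "exp (- A * (x - h)\<^sup>2) \<le> exp (A * H\<^sup>2) * exp (- (A / 2) * x\<^sup>2)"
proof -
  have "h\<^sup>2 \<le> H\<^sup>2" using assms(2) by (simp add: abs_le_square_iff[symmetric])
  moreover have "0 \<le> (x / 2 - h)\<^sup>2 * 2" by simp
  ultimately have "x\<^sup>2 / 2 - H\<^sup>2 \<le> (x - h)\<^sup>2"
    by (simp add: power2_eq_square algebra_simps)
  then have "- A * (x - h)\<^sup>2 \<le> A * H\<^sup>2 + - (A / 2) * x\<^sup>2"
    using mult_left_mono[of "x\<^sup>2 / 2 - H\<^sup>2" "(x - h)\<^sup>2" A] assms(1) by (simp add: algebra_simps)
  then show ?thesis by (simp add: exp_add[symmetric])
qed

lemma summable_exp_neg_square:
  fixes A :: real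
  assumes "A > 0"
  shows "summable (\<lambda>n. exp (- A * (real n)\<^sup>2))"
proof (rule summable_comparison_test)
  show "summable (\<lambda>n. (exp (- A)) ^ n)"
    using assms by (intro summable_geometric) simp
  have "norm (exp (- A * (real n)\<^sup>2)) \<le> exp (- A) ^ n" for n
  proof -
    have "real n \<le> (real n)\<^sup>2" by (cases n) (auto simp: power2_eq_square)
    then show ?thesis using assms by (simp add: exp_of_nat_mult[symmetric] mult.commute)
  qed
  then show "\<exists>N. \<forall>n\<ge>N. norm (exp (- A * (real n)\<^sup>2)) \<le> exp (- A) ^ n" by blast
qed

text \<open>Sums over the integers are written as series over the natural numbers through the bijection
  \<open>int_decode\<close>, so that the theorems on series apply to them.\<close>

lemma int_decode_lower: "real n / 2 \<le> \<bar>real_of_int (int_decode n)\<bar>"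
proof -
  have "int n \<le> 2 * \<bar>int_decode n\<bar>"
  proof -
    have "n = int_encode (int_decode n)" by simp
    then have "int n = int (int_encode (int_decode n))" by simp
    also have "\<dots> \<le> 2 * \<bar>int_decode n\<bar>"
      by (auto simp: int_encode_def sum_encode_def)
    finally show ?thesis .
  qed
  then show ?thesis by linarith
qed

lemma gauss_minus: "gauss (- c) Y (- x) = gauss c Y x"
  by (simp add: gauss_def)

text \<open>The bound is uniform in the shift \<open>b\<close>; this is what makes the theta series converge uniformly
  on the unit interval.\<close>

lemma gauss_bound:
  assumes "Y > 0" "\<bar>b\<bar> \<le> B"
  shows "norm (gauss c Y (x + b)) \<le>
    exp (pi * (Re c)\<^sup>2 / Y) * exp (pi * Y * (B + \<bar>Re c\<bar> / Y)\<^sup>2) * exp (- (pi * Y / 2) * x\<^sup>2)"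
proof -
  have "norm (gauss c Y (x + b)) = exp (pi * (Re c)\<^sup>2 / Y) * exp (- (pi * Y) * (x - (- Re c / Y - b))\<^sup>2)"
    by (simp add: norm_gauss[OF assms(1)] algebra_simps)
  also have "\<dots> \<le> exp (pi * (Re c)\<^sup>2 / Y) * (exp (pi * Y * (B + \<bar>Re c\<bar> / Y)\<^sup>2) * exp (- (pi * Y / 2) * x\<^sup>2))"
  proof (rule mult_left_mono[OF shifted_square_bound])
    have "\<bar>- Re c / Y - b\<bar> \<le> \<bar>Re c / Y\<bar> + \<bar>b\<bar>" by linarith
    then show "\<bar>- Re c / Y - b\<bar> \<le> B + \<bar>Re c\<bar> / Y" using assms by simp
  qed (use assms in auto)
  finally show ?thesis by (simp add: mult.assoc)
qed

definition half_theta :: "complex \<Rightarrow> real \<Rightarrow> real \<Rightarrow> complex"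
  where "half_theta c Y b = suminf (\<lambda>k. gauss c Y (real k + b))"

lemma summable_gauss:
  assumes "Y > 0"
  shows "summable (\<lambda>k. gauss c Y (real k + b))"
proof (rule summable_norm_cancel, rule summable_comparison_test[rotated])
  show "summable (\<lambda>k. exp (pi * (Re c)\<^sup>2 / Y) * exp (pi * Y * (\<bar>b\<bar> + \<bar>Re c\<bar> / Y)\<^sup>2) * exp (- (pi * Y / 2) * (real k)\<^sup>2))"
    using assms by (intro summable_mult summable_exp_neg_square) simp
  show "\<exists>N. \<forall>n\<ge>N. norm (norm (gauss c Y (real n + b))) \<le> exp (pi * (Re c)\<^sup>2 / Y) * exp (pi * Y * (\<bar>b\<bar> + \<bar>Re c\<bar> / Y)\<^sup>2) * exp (- (pi * Y / 2) * (real n)\<^sup>2)"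
    using gauss_bound[OF assms, of b "\<bar>b\<bar>" c] by auto
qed

lemma half_theta_rec:
  assumes "Y > 0"
  shows "half_theta c Y b = gauss c Y b + half_theta c Y (b + 1)"
  using suminf_split_head[OF summable_gauss[OF assms, of c b]]
  by (simp add: half_theta_def add_ac)

section \<open>The Gaussian integral\<close>

text \<open>A real shift of the variable removes the real part of \<open>c\<close>; what is left is the characteristic
  function of the standard normal distribution.\<close>

lemma has_bochner_integral_gauss:
  assumes "Y > 0"
  shows "has_bochner_integral lborel (gauss c Y) (exp (of_real pi * c\<^sup>2 / of_real Y) / of_real (sqrt Y))"
proof -
  define s where "s = sqrt (2 * pi * Y)"
  have s: "s > 0" "s\<^sup>2 = 2 * pi * Y" using assms by (auto simp: s_def)
  define t where "t = - Re c / Y"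
  define K where "K = exp (of_real pi * (of_real (Re c))\<^sup>2 / of_real Y + 2 * of_real pi * \<i> * of_real (Re c * Im c / Y))"
  have eq: "gauss c Y (t + (1 / s) * u) = K * of_real (sqrt (2 * pi)) * 
      (of_real (std_normal_density u) * iexp ((- 2 * pi * Im c / s) * u))" for u
  proof -
    have e: "sqrt (2 * pi) * std_normal_density u = exp (- u\<^sup>2 / 2)"
      by (simp add: std_normal_density_def)
    have "- (2 * of_real pi * c * of_real (t + 1 / s * u)) - of_real (pi * Y * (t + 1 / s * u)\<^sup>2)
       = (of_real pi * (of_real (Re c))\<^sup>2 / of_real Y + 2 * of_real pi * \<i> * of_real (Re c * Im c / Y))
       + (of_real (- u\<^sup>2 / 2) + \<i> * of_real (- 2 * pi * Im c / s * u))" (is "?l = ?r")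
    proof (rule complex_eqI)
      have 1: "pi * Y * (u / s)\<^sup>2 = u\<^sup>2 / 2" using s assms by (simp add: power_divide)
      have "Re ?l = - (2 * pi * Re c * (t + u / s)) - pi * Y * (t + u / s)\<^sup>2" by simp
      also have "\<dots> = pi * (Re c)\<^sup>2 / Y - pi * Y * (u / s)\<^sup>2"
        using assms s(1) by (simp add: t_def power2_eq_square field_simps)
      finally show "Re ?l = Re ?r" using 1 by (simp add: power2_eq_square)
      show "Im ?l = Im ?r" using assms s(1) by (simp add: t_def power2_eq_square field_simps)
    qed
    then have "gauss c Y (t + (1 / s) * u) = K * (of_real (exp (- u\<^sup>2 / 2)) * iexp ((- 2 * pi * Im c / s) * u))"
      by (simp only: gauss_def K_def exp_of_real[symmetric] exp_add[symmetric])
    then show ?thesis unfolding e[symmetric] by (simp add: mult_ac)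
  qed
  have int: "integrable std_normal_distribution (\<lambda>u. iexp ((- 2 * pi * Im c / s) * u))"
    by (intro prob_space.integrable_iexp[OF prob_space_normal_density]) auto
  have "integrable lborel (\<lambda>u. std_normal_density u *\<^sub>R iexp ((- 2 * pi * Im c / s) * u))"
    using int by (subst (asm) integrable_density) (auto simp: normal_density_nonneg)
  then have int': "integrable lborel (\<lambda>u. of_real (std_normal_density u) * iexp ((- 2 * pi * Im c / s) * u))"
    by (simp add: scaleR_conv_of_real)
  have "(CLINT u|lborel. of_real (std_normal_density u) * iexp ((- 2 * pi * Im c / s) * u))
      = char std_normal_distribution (- 2 * pi * Im c / s)"
    unfolding char_def
    by (subst integral_density) (auto simp: normal_density_nonneg scaleR_conv_of_real)
  also have "\<dots> = of_real (exp (- ((- 2 * pi * Im c / s)\<^sup>2) / 2))"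
    unfolding char_std_normal_distribution ..
  also have "- ((- 2 * pi * Im c / s)\<^sup>2) / 2 = - pi * (Im c)\<^sup>2 / Y"
    using s assms by (simp add: power_divide power_mult_distrib) (simp add: power2_eq_square field_simps)
  finally have "has_bochner_integral lborel (\<lambda>u. of_real (std_normal_density u) * iexp ((- 2 * pi * Im c / s) * u))
      (of_real (exp (- pi * (Im c)\<^sup>2 / Y)))"
    using int' by (simp add: has_bochner_integral_iff)
  then have "has_bochner_integral lborel (\<lambda>u. gauss c Y (t + (1 / s) * u))
     (K * of_real (sqrt (2 * pi)) * of_real (exp (- pi * (Im c)\<^sup>2 / Y)))"
    unfolding eq by (intro has_bochner_integral_mult_right) auto
  also have "K * of_real (sqrt (2 * pi)) * of_real (exp (- pi * (Im c)\<^sup>2 / Y)) =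
     (exp (of_real pi * c\<^sup>2 / of_real Y) / of_real (sqrt Y)) /\<^sub>R \<bar>1 / s\<bar>"
  proof -
    have "of_real pi * c\<^sup>2 / of_real Y = (of_real pi * (of_real (Re c))\<^sup>2 / of_real Y + 2 * of_real pi * \<i> * of_real (Re c * Im c / Y)) + of_real (- pi * (Im c)\<^sup>2 / Y)"
      using assms by (simp add: complex_eq_iff power2_eq_square field_simps)
    then have "exp (of_real pi * c\<^sup>2 / of_real Y) = K * of_real (exp (- pi * (Im c)\<^sup>2 / Y))"
      unfolding K_def exp_of_real[symmetric] exp_add[symmetric] by simp
    moreover have "s = sqrt (2 * pi) * sqrt Y" by (simp add: s_def real_sqrt_mult)
    ultimately show ?thesis using s(1) assms by (simp add: scaleR_conv_of_real field_simps)
  qed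
  finally show ?thesis
    using s(1) by (subst lborel_has_bochner_integral_real_affine_iff[where c = "1 / s" and t = t]) auto
qed


section \<open>Uniqueness of Fourier coefficients\<close>

inductive trig_poly :: "(real \<Rightarrow> complex) \<Rightarrow> bool" where
  harmonic: "trig_poly (\<lambda>t. c * cis (2 * pi * of_int m * t))"
| add: "trig_poly h \<Longrightarrow> trig_poly k \<Longrightarrow> trig_poly (\<lambda>t. h t + k t)"

lemma trig_poly_mult:
  assumes "trig_poly h" "trig_poly k"
  shows "trig_poly (\<lambda>t. h t * k t)"
  using assms(1)
proof induction
  case (harmonic c m)
  show ?case using assms(2)
  proof induction
    case h: (harmonic d n)
    have "(\<lambda>t. c * cis (2 * pi * of_int m * t) * (d * cis (2 * pi * of_int n * t))) =
      (\<lambda>t. (c * d) * cis (2 * pi * of_int (m + n) * t))"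
      by (simp add: cis_mult[symmetric] algebra_simps)
    then show ?case using trig_poly.harmonic[of "c * d" "m + n"] by metis
  next
    case (add h' k')
    then show ?case using trig_poly.add by (simp add: algebra_simps)
  qed
next
  case (add h' k')
  then show ?case using trig_poly.add by (simp add: algebra_simps)
qed

lemma trig_poly_const: "trig_poly (\<lambda>t. c)"
  using trig_poly.harmonic[of c 0] by simp

text \<open>By the coordinates of \<open>cis\<close>, a linear form on the circle is a combination of \<open>cis t\<close> and
  \<open>cis (- t)\<close>. So the Stone-Weierstrass theorem for polynomials on the circle
  provides approximation by trigonometric polynomials.\<close>

lemma trig_poly_real_polynomial:
  fixes P :: "complex \<Rightarrow> real"
  assumes "real_polynomial_function P"
  shows "trig_poly (\<lambda>t. of_real (P (cis (2 * pi * t))))"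
  using assms
proof induction
  case (linear f)
  have f: "f z = Re z * f 1 + Im z * f \<i>" for z
  proof -
    interpret bounded_linear f by fact
    have "z = Re z *\<^sub>R 1 + Im z *\<^sub>R \<i>" by (simp add: complex_eq_iff)
    then have "f z = f (Re z *\<^sub>R 1 + Im z *\<^sub>R \<i>)" by simp
    then show ?thesis by (simp only: add scaleR) simp
  qed
  define A B where "A = (of_real (f 1) - \<i> * of_real (f \<i>)) / 2"
    and "B = (of_real (f 1) + \<i> * of_real (f \<i>)) / 2"
  have "(\<lambda>t. of_real (f (cis (2 * pi * t)))) =
    (\<lambda>t. A * cis (2 * pi * of_int 1 * t) + B * cis (2 * pi * of_int (- 1) * t))"
    by (rule ext, subst f) (simp add: complex_eq_iff A_def B_def field_simps)
  then show ?case using trig_poly.add[OF trig_poly.harmonic[of A 1] trig_poly.harmonic[of B "- 1"]]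
    by simp
next
  case (const c)
  show ?case by (rule trig_poly_const)
next
  case (add f g)
  then show ?case using trig_poly.add by simp
next
  case (mult f g)
  then show ?case using trig_poly_mult by simp
qed

text \<open>The graph of the function on the circle is the image of a compact interval, hence closed; with
  compact range this gives continuity.\<close>

lemma continuous_on_circle_of_periodic:
  fixes f :: "real \<Rightarrow> complex"
  assumes f: "continuous_on {0..1} f" and per: "f 0 = f 1"
  obtains F where "continuous_on (sphere 0 1) F" "\<And>t. t \<in> {0..1} \<Longrightarrow> F (cis (2 * pi * t)) = f t"
proof
  define F where "F z = f (Arg2pi z / (2 * pi))" for z
  show F: "F (cis (2 * pi * t)) = f t" if "t \<in> {0..1}" for t
  proof (cases "t = 1")
    case True
    moreover have "Arg2pi 1 = 0" by (rule Arg2pi_unique[of 1]) auto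
    ultimately show ?thesis using per by (simp add: F_def)
  next
    case False
    have "Arg2pi (cis (2 * pi * t)) = 2 * pi * t"
      by (rule Arg2pi_unique[of 1]) (use that False in \<open>auto simp: cis_conv_exp mult_ac\<close>)
    then show ?thesis by (simp add: F_def)
  qed
  have circ: "sphere 0 1 = (\<lambda>t. cis (2 * pi * t)) ` {0..1}"
  proof (intro equalityI subsetI)
    fix z :: complex assume "z \<in> sphere 0 1"
    then have "z = cis (2 * pi * (Arg2pi z / (2 * pi)))"
      using Arg2pi[of z] by (auto simp: cis_conv_exp is_Arg_def)
    moreover have "Arg2pi z / (2 * pi) \<in> {0..1}" using Arg2pi[of z] by auto
    ultimately show "z \<in> (\<lambda>t. cis (2 * pi * t)) ` {0..1}" by blast
  qed auto
  have graph: "(\<lambda>x. (x, F x)) ` sphere 0 1 = (\<lambda>t. (cis (2 * pi * t), f t)) ` {0..1}"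
    unfolding circ image_image using F by (intro image_cong) auto
  have "compact ((\<lambda>t. (cis (2 * pi * t), f t)) ` {0..1})"
    by (intro compact_continuous_image continuous_intros f) auto
  then have cl: "closed ((\<lambda>x. (x, F x)) ` sphere 0 1)" unfolding graph by (rule compact_imp_closed)
  have "compact (f ` {0..1})" by (intro compact_continuous_image f) auto
  moreover have "F \<in> sphere 0 1 \<rightarrow> f ` {0..1}" unfolding circ using F by auto
  ultimately show "continuous_on (sphere 0 1) F"
    using cl by (intro continuous_from_closed_graph)
qed

text \<open>If all coefficients vanish, \<open>f\<close> is orthogonal to every trigonometric polynomial. Approximating
  \<open>f\<close> by one of them shows that \<open>f\<close> is orthogonal to itself.\<close>

lemma fourier_coefficients_zero:
  fixes f :: "real \<Rightarrow> complex"
  assumes f: "continuous_on {0..1} f" and per: "f 0 = f 1"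
    and zero: "\<And>m::int. integral {0..1} (\<lambda>t. f t * cis (2 * pi * of_int m * t)) = 0"
    and t: "t \<in> {0..1}"
  shows "f t = 0"
proof -
  obtain F where F: "continuous_on (sphere 0 1) F" "\<And>t. t \<in> {0..1} \<Longrightarrow> F (cis (2 * pi * t)) = f t"
    using continuous_on_circle_of_periodic[OF f per] by blast
  have trig: "continuous_on {0..1} h \<and> integral {0..1} (\<lambda>t. f t * h t) = 0" if "trig_poly h" for h
    using that
  proof induction
    case (harmonic c m)
    have "(\<lambda>t. f t * (c * cis (2 * pi * of_int m * t))) = (\<lambda>t. c * (f t * cis (2 * pi * of_int m * t)))"
      by (simp add: mult_ac)
    then show ?case using zero by (auto intro!: continuous_intros)
  next
    case (add h k)
    have "(\<lambda>t. f t * h t) integrable_on {0..1}" "(\<lambda>t. f t * k t) integrable_on {0..1}"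
      using add f by (auto intro!: integrable_continuous_interval continuous_intros)
    then show ?case using add by (auto simp: distrib_left integral_add intro!: continuous_intros)
  qed
  obtain C where C: "\<And>t. t \<in> {0..1} \<Longrightarrow> norm (f t) \<le> C" "C > 0"
  proof -
    have "bounded (f ` {0..1})" by (intro compact_imp_bounded compact_continuous_image f) auto
    then obtain C where "C > 0" "\<forall>x\<in>f ` {0..1}. norm x \<le> C" unfolding bounded_pos by blast
    then show ?thesis using that[of C] by blast
  qed
  have small: "norm (integral {0..1} (\<lambda>t. f t * cnj (f t))) \<le> e" if "e > 0" for e
  proof -
    have "e / C > 0" using that C by simp
    then obtain P where P: "polynomial_function P" "\<And>z. z \<in> sphere 0 1 \<Longrightarrow> norm (F z - P z) < e / C"
      using Stone_Weierstrass_polynomial_function[of "sphere 0 1" F "e / C"] F(1) by auto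
    define h where "h t = cnj (P (cis (2 * pi * t)))" for t
    have re: "real_polynomial_function (Re \<circ> P)" "real_polynomial_function (Im \<circ> P)"
      using P(1) unfolding polynomial_function_def by (auto simp: bounded_linear_Re bounded_linear_Im)
    have "trig_poly (\<lambda>t. of_real ((Re \<circ> P) (cis (2 * pi * t))) + (- \<i>) * of_real ((Im \<circ> P) (cis (2 * pi * t))))"
      by (intro trig_poly.add trig_poly_mult trig_poly_const trig_poly_real_polynomial re)
    moreover have "(\<lambda>t. of_real ((Re \<circ> P) (cis (2 * pi * t))) + (- \<i>) * of_real ((Im \<circ> P) (cis (2 * pi * t)))) = h"
      by (auto simp: h_def complex_eq_iff)
    ultimately have h: "continuous_on {0..1} h" "integral {0..1} (\<lambda>t. f t * h t) = 0"
      using trig[of h] by auto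
    have "integral {0..1} (\<lambda>t. f t * cnj (f t)) = integral {0..1} (\<lambda>t. f t * cnj (f t)) - integral {0..1} (\<lambda>t. f t * h t)"
      using h by simp
    also have "\<dots> = integral {0..1} (\<lambda>t. f t * cnj (f t) - f t * h t)"
      using f h by (intro integral_diff[symmetric] integrable_continuous_interval continuous_intros) auto
    also have "norm \<dots> \<le> e * (1 - 0)"
    proof (rule integral_bound)
      show "continuous_on {0..1} (\<lambda>t. f t * cnj (f t) - f t * h t)"
        using f h by (intro continuous_intros) auto
      fix t :: real assume t: "t \<in> {0..1}"
      have "f t * cnj (f t) - f t * h t = f t * cnj (F (cis (2 * pi * t)) - P (cis (2 * pi * t)))"
        using F(2)[OF t] by (simp add: h_def algebra_simps)
      then have "norm (f t * cnj (f t) - f t * h t) = norm (f t) * norm (F (cis (2 * pi * t)) - P (cis (2 * pi * t)))"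
        by (simp add: norm_mult del: complex_cnj_diff)
      also have "\<dots> \<le> C * (e / C)"
        using C(1)[OF t] P(2)[of "cis (2 * pi * t)"] C(2) by (intro mult_mono) auto
      finally show "norm (f t * cnj (f t) - f t * h t) \<le> e" using C by simp
    qed auto
    finally show ?thesis by simp
  qed
  then have "norm (integral {0..1} (\<lambda>t. f t * cnj (f t))) \<le> 0"
    by (rule field_le_epsilon[of _ 0, simplified])
  then have "integral {0..1} (\<lambda>t. f t * cnj (f t)) = 0" by simp
  moreover have sq: "(\<lambda>t. f t * cnj (f t)) = (\<lambda>t. of_real ((norm (f t))\<^sup>2))"
    by (simp add: complex_norm_square[symmetric] del: of_real_power)
  moreover have cont: "continuous_on {0..1} (\<lambda>t. (norm (f t))\<^sup>2)" using f by (intro continuous_intros)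
  moreover have "((\<lambda>t. of_real ((norm (f t))\<^sup>2) :: complex) has_integral of_real (integral {0..1} (\<lambda>t. (norm (f t))\<^sup>2))) {0..1}"
    by (intro has_integral_of_real integrable_integral integrable_continuous_interval cont)
  ultimately have "integral {0..1} (\<lambda>t. (norm (f t))\<^sup>2) = 0"
    by (metis (mono_tags, lifting) integral_unique of_real_eq_0_iff)
  then have "(norm (f t))\<^sup>2 = 0"
    using integral_eq_0_iff[of 0 1 "\<lambda>t. (norm (f t))\<^sup>2", OF cont] t by simp
  then show ?thesis by simp
qed

section \<open>Poisson summation\<close>

text \<open>The Fourier coefficient of the periodised Gaussian at frequency \<open>- m\<close>, up to the factor
  \<open>1 / \<surd>Y\<close>.\<close>

definition dual_weight :: "complex \<Rightarrow> real \<Rightarrow> int \<Rightarrow> complex"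
  where "dual_weight c Y m = exp (of_real pi * (c - \<i> * of_int m)\<^sup>2 / of_real Y)"

definition dual_term :: "complex \<Rightarrow> real \<Rightarrow> real \<Rightarrow> int \<Rightarrow> complex"
  where "dual_term c Y b m = dual_weight c Y m * cis (- (2 * pi * of_int m * b))"

lemma norm_dual_weight:
  "norm (dual_weight c Y m) = exp (pi * ((Re c)\<^sup>2 - (Im c - of_int m)\<^sup>2) / Y)"
  by (simp add: dual_weight_def norm_exp_eq_Re Re_power2 Re_divide_of_real)

lemma summable_exp_neg_square_int:
  fixes A h :: real
  assumes "A > 0"
  shows "summable (\<lambda>n. exp (- A * (h - of_int (int_decode n))\<^sup>2))"
proof (rule summable_comparison_test)
  show "summable (\<lambda>n. exp (A * h\<^sup>2) * exp (- (A / 8) * (real n)\<^sup>2))"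
    using assms by (intro summable_mult summable_exp_neg_square) simp
  have "norm (exp (- A * (h - of_int (int_decode n))\<^sup>2)) \<le> exp (A * h\<^sup>2) * exp (- (A / 8) * (real n)\<^sup>2)" for n
  proof -
    have "(real n / 2)\<^sup>2 \<le> \<bar>real_of_int (int_decode n)\<bar>\<^sup>2"
      by (rule power_mono[OF int_decode_lower]) simp
    then have "A * (real n / 2)\<^sup>2 \<le> A * (real_of_int (int_decode n))\<^sup>2"
      using assms by simp
    then have "exp (- (A / 2) * (real_of_int (int_decode n))\<^sup>2) \<le> exp (- (A / 8) * (real n)\<^sup>2)"
      by (simp add: power_divide)
    then have "exp (A * \<bar>h\<bar>\<^sup>2) * exp (- (A / 2) * (real_of_int (int_decode n))\<^sup>2) \<le> exp (A * \<bar>h\<bar>\<^sup>2) * exp (- (A / 8) * (real n)\<^sup>2)"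
      by (intro mult_left_mono) auto
    moreover have "exp (- A * (of_int (int_decode n) - h)\<^sup>2) \<le> exp (A * \<bar>h\<bar>\<^sup>2) * exp (- (A / 2) * (real_of_int (int_decode n))\<^sup>2)"
      by (rule shifted_square_bound[OF assms order_refl])
    ultimately have "exp (- A * (of_int (int_decode n) - h)\<^sup>2) \<le> exp (A * h\<^sup>2) * exp (- (A / 8) * (real n)\<^sup>2)"
      unfolding power2_abs by (rule order_trans[rotated])
    then show ?thesis unfolding power2_commute[of h] by simp
  qed
  then show "\<exists>N. \<forall>n\<ge>N. norm (exp (- A * (h - of_int (int_decode n))\<^sup>2)) \<le> exp (A * h\<^sup>2) * exp (- (A / 8) * (real n)\<^sup>2)"
    by blast
qed

lemma summable_dual_bound:
  assumes "Y > 0"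
  shows "summable (\<lambda>n. exp (pi * ((Re c)\<^sup>2 - (Im c - of_int (int_decode n))\<^sup>2) / Y))"
proof -
  have "exp (pi * ((Re c)\<^sup>2 - (Im c - of_int (int_decode n))\<^sup>2) / Y) =
    exp (pi * (Re c)\<^sup>2 / Y) * exp (- (pi / Y) * (Im c - of_int (int_decode n))\<^sup>2)" for n
    by (simp add: exp_add[symmetric] diff_divide_distrib right_diff_distrib)
  then show ?thesis
    using summable_mult[OF summable_exp_neg_square_int[of "pi / Y" "Im c"], of "exp (pi * (Re c)\<^sup>2 / Y)"] assms
    by simp
qed

lemma tendsto_integral_times_cis:
  fixes S :: "nat \<Rightarrow> real \<Rightarrow> complex"
  assumes u: "uniform_limit {0..1} S f sequentially" and c: "\<And>n. continuous_on {0..1} (S n)"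
  shows "(\<lambda>n. integral {0..1} (\<lambda>b. S n b * cis (2 * pi * of_int m * b))) \<longlonglongrightarrow>
    integral {0..1} (\<lambda>b. f b * cis (2 * pi * of_int m * b))"
proof -
  have "uniform_limit {0..1} (\<lambda>n b. S n b * cis (2 * pi * of_int m * b)) (\<lambda>b. f b * cis (2 * pi * of_int m * b)) sequentially"
    using u unfolding uniform_limit_iff dist_norm left_diff_distrib[symmetric] norm_mult norm_cis by simp
  moreover have "\<And>n. continuous_on {0..1} (\<lambda>b. S n b * cis (2 * pi * of_int m * b))"
    using c by (intro continuous_intros) auto
  ultimately obtain I J where
    I: "\<And>n. ((\<lambda>b. S n b * cis (2 * pi * of_int m * b)) has_integral I n) {0..1}"
    and J: "((\<lambda>b. f b * cis (2 * pi * of_int m * b)) has_integral J) {0..1}" and "I \<longlonglongrightarrow> J"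
    by (rule uniform_limit_integral) auto
  then show ?thesis by (simp add: integral_unique[OF I] integral_unique[OF J])
qed

lemma integral_cis_int:
  "integral {0..1} (\<lambda>b. cis (2 * pi * of_int m * b)) = (if m = 0 then 1 else 0)"
proof (cases "m = 0")
  case False
  define K :: complex where "K = 2 * of_real pi * \<i> * of_int m"
  have K: "K \<noteq> 0" using False by (simp add: K_def)
  have cis: "cis (2 * pi * of_int m * b) = exp (K * of_real b)" for b
    by (simp add: cis_conv_exp K_def mult_ac)
  have "((\<lambda>b. exp (K * of_real b)) has_integral exp (K * of_real 1) / K - exp (K * of_real 0) / K) {0..1}"
  proof (rule fundamental_theorem_of_calculus)
    fix x :: real
    have "((\<lambda>z. exp (K * z) / K) has_field_derivative exp (K * of_real x)) (at (of_real x))"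
      using K by (auto intro!: derivative_eq_intros)
    then show "((\<lambda>b. exp (K * of_real b) / K) has_vector_derivative exp (K * of_real x)) (at x within {0..1})"
      by (rule has_vector_derivative_real_field)
  qed auto
  moreover have "exp (K * of_real 1) = 1" unfolding cis[symmetric] by (simp add: complex_eq_iff)
  ultimately have "integral {0..1} (\<lambda>b. exp (K * of_real b)) = 0" by (simp add: integral_unique)
  then show ?thesis using False by (simp add: cis)
qed auto

lemma gauss_times_cis: "gauss c Y x * cis (2 * pi * of_int m * x) = gauss (c - \<i> * of_int m) Y x"
  by (simp add: gauss_def cis_conv_exp exp_add[symmetric] algebra_simps)

lemma continuous_on_gauss [continuous_intros]:
  "continuous_on S f \<Longrightarrow> continuous_on S (\<lambda>x. gauss c Y (f x))"
  unfolding gauss_def by (intro continuous_intros)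

lemma gauss_integral_limit:
  assumes "Y > 0"
  shows "(\<lambda>N. integral {- real N..real N} (gauss c Y)) \<longlonglongrightarrow> exp (of_real pi * c\<^sup>2 / of_real Y) / of_real (sqrt Y)"
proof -
  note G = has_bochner_integral_gauss[OF assms, of c]
  have "(\<lambda>N. \<integral>x. indicator {- real N..real N} x *\<^sub>R gauss c Y x \<partial>lborel) \<longlonglongrightarrow> (\<integral>x. gauss c Y x \<partial>lborel)"
  proof (rule integral_dominated_convergence[where w = "\<lambda>x. norm (gauss c Y x)"])
    show "gauss c Y \<in> borel_measurable lborel" using G by (auto simp: has_bochner_integral_iff)
    then show "\<And>N. (\<lambda>x. indicator {- real N..real N} x *\<^sub>R gauss c Y x) \<in> borel_measurable lborel" by measurable
    show "integrable lborel (\<lambda>x. norm (gauss c Y x))" using G by (auto simp: has_bochner_integral_iff)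
    show "AE x in lborel. (\<lambda>N. indicator {- real N..real N} x *\<^sub>R gauss c Y x) \<longlonglongrightarrow> gauss c Y x"
    proof (rule AE_I2, rule tendsto_eventually)
      fix x :: real
      obtain N0 where "\<bar>x\<bar> \<le> real N0" using real_arch_simple by blast
      then have "\<forall>N\<ge>N0. indicator {- real N..real N} x *\<^sub>R gauss c Y x = gauss c Y x"
        by (auto simp: indicator_def)
      then show "\<forall>\<^sub>F N in sequentially. indicator {- real N..real N} x *\<^sub>R gauss c Y x = gauss c Y x"
        unfolding eventually_sequentially by blast
    qed
  qed (auto simp: indicator_def)
  moreover have "(\<integral>x. indicator {- real N..real N} x *\<^sub>R gauss c Y x \<partial>lborel) = integral {- real N..real N} (gauss c Y)" for N
  proof -
    have "set_integrable lborel {- real N..real N} (gauss c Y)"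
      by (rule borel_integrable_atLeastAtMost') (intro continuous_intros)
    then show ?thesis using set_borel_integral_eq_integral(2) unfolding set_lebesgue_integral_def by blast
  qed
  ultimately show ?thesis using has_bochner_integral_integral_eq[OF G] by simp
qed

text \<open>The sum of \<open>gauss c Y\<close> over all of \<open>b + \<int>\<close>: the second summand collects the negative
  indices, reflected at the origin.\<close>

definition full_theta :: "complex \<Rightarrow> real \<Rightarrow> real \<Rightarrow> complex"
  where "full_theta c Y b = half_theta c Y b + half_theta (- c) Y (1 - b)"

lemma full_theta_periodic:
  assumes "Y > 0"
  shows "full_theta c Y (b + 1) = full_theta c Y b"
  using half_theta_rec[OF assms, of c b] half_theta_rec[OF assms, of "- c" "- b"] gauss_minus[of c Y b]
  by (simp add: full_theta_def)

lemma full_theta_periodic_int: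
  assumes "Y > 0"
  shows "full_theta c Y (b + of_int k) = full_theta c Y b"
proof (induction k rule: int_induct[of _ 0])
  case (step1 i)
  then show ?case using full_theta_periodic[OF assms, of c "b + of_int i"] by (simp add: add_ac)
next
  case (step2 i)
  then show ?case using full_theta_periodic[OF assms, of c "b + of_int i - 1"] by (simp add: algebra_simps)
qed simp

lemma full_theta_uniform:
  assumes "Y > 0"
  shows "uniform_limit {0..1} (\<lambda>N b. (\<Sum>k<N. gauss c Y (real k + b)) + (\<Sum>k<N. gauss (- c) Y (real k + (1 - b))))
     (full_theta c Y) sequentially"
proof -
  have 1: "uniform_limit {0..1} (\<lambda>N b. \<Sum>k<N. gauss c Y (real k + b)) (half_theta c Y) sequentially" for c
    unfolding half_theta_def
  proof (rule Weierstrass_m_test)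
    show "summable (\<lambda>k. exp (pi * (Re c)\<^sup>2 / Y) * exp (pi * Y * (1 + \<bar>Re c\<bar> / Y)\<^sup>2) * exp (- (pi * Y / 2) * (real k)\<^sup>2))"
      using assms by (intro summable_mult summable_exp_neg_square) simp
  qed (use gauss_bound[OF assms] in auto)
  have "uniform_limit {0..1} (\<lambda>N b. \<Sum>k<N. gauss (- c) Y (real k + (1 - b))) (\<lambda>b. half_theta (- c) Y (1 - b)) sequentially"
    using uniform_limit_compose'[OF 1[of "- c"], of "\<lambda>b. 1 - b" "{0..1}"] by auto
  from uniform_limit_add[OF 1[of c] this] show ?thesis
    by (simp add: full_theta_def[abs_def])
qed

text \<open>Cutting the line into unit intervals: the truncated series, integrated over one period against a
  Fourier mode, is the integral of a Gaussian over \<open>[-N, N]\<close>.\<close>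

lemma full_theta_partial_integral:
  "integral {0..1} (\<lambda>b. ((\<Sum>k<N. gauss c Y (real k + b)) + (\<Sum>k<N. gauss (- c) Y (real k + (1 - b)))) * cis (2 * pi * of_int m * b))
    = integral {- real N..real N} (gauss (c - \<i> * of_int m) Y)"
proof (induction N)
  case (Suc N)
  let ?g = "gauss (c - \<i> * of_int m) Y"
  let ?S = "\<lambda>N b. (\<Sum>k<N. gauss c Y (real k + b)) + (\<Sum>k<N. gauss (- c) Y (real k + (1 - b)))"
  have int: "?g integrable_on {a..b}" for a b
    by (intro integrable_continuous_interval continuous_intros)
  have shift: "gauss c Y (b + of_int k) * cis (2 * pi * of_int m * b) = ?g (b + of_int k)" for b and k :: int
  proof -
    have "cis (2 * pi * of_int m * (b + of_int k)) = cis (2 * pi * of_int m * b) * cis (2 * pi * of_int (m * k))"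
      by (simp add: cis_mult algebra_simps)
    also have "cis (2 * pi * of_int (m * k)) = 1" by (simp add: complex_eq_iff)
    finally show ?thesis using gauss_times_cis[of c Y "b + of_int k" m] by simp
  qed
  have refl: "gauss (- c) Y (real N + (1 - b)) = gauss c Y (b + of_int (- int N - 1))" for b
  proof -
    have "- (b + of_int (- int N - 1)) = real N + (1 - b)" by simp
    then show ?thesis using gauss_minus[of c Y "b + of_int (- int N - 1)"] by metis
  qed
  have "?S (Suc N) b * cis (2 * pi * of_int m * b) =
     ?S N b * cis (2 * pi * of_int m * b) + ?g (b + of_int (int N)) + ?g (b + of_int (- int N - 1))" for b
    unfolding shift[symmetric] refl[symmetric] by (simp add: algebra_simps)
  then have e1: "integral {0..1} (\<lambda>b. ?S (Suc N) b * cis (2 * pi * of_int m * b)) =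
     integral {0..1} (\<lambda>b. ?S N b * cis (2 * pi * of_int m * b) + ?g (b + of_int (int N)) + ?g (b + of_int (- int N - 1)))"
    by simp
  have i1: "(\<lambda>b. ?S N b * cis (2 * pi * of_int m * b)) integrable_on {0..1}"
    by (intro integrable_continuous_interval continuous_intros)
  have ends: "real (Suc N) = real N + 1" "- (real N + 1) = - real N - 1" by simp_all
  have i2: "(\<lambda>b. ?g (b + of_int k)) integrable_on {0..1}" for k
    by (intro integrable_continuous_interval continuous_intros)
  have "integral {0..1} (\<lambda>b. ?S N b * cis (2 * pi * of_int m * b) + ?g (b + of_int (int N)) + ?g (b + of_int (- int N - 1))) 
      = integral {0..1} (\<lambda>b. ?S N b * cis (2 * pi * of_int m * b)) + integral {0..1} (\<lambda>b. ?g (b + of_int (int N)))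
      + integral {0..1} (\<lambda>b. ?g (b + of_int (- int N - 1)))"
    by (simp only: integral_add[OF integrable_add[OF i1 i2] i2] integral_add[OF i1 i2])
  also have "\<dots> = integral {- real N..real N} ?g + integral {real N..real N + 1} ?g + integral {- real N - 1..- real N} ?g"
    using integral_shift_real_ivl[of "real N" "real N" "real N + 1" ?g]
      integral_shift_real_ivl[of "- real N - 1" "- real N - 1" "- real N" ?g] Suc.IH by simp
  also have "\<dots> = integral {- real (Suc N)..real (Suc N)} ?g"
  proof -
    have c1: "integral {- real N - 1..- real N} ?g + integral {- real N..real N} ?g = integral {- real N - 1..real N} ?g"
      by (rule Henstock_Kurzweil_Integration.integral_combine[OF _ _ int]) auto
    have c2: "integral {- real N - 1..real N} ?g + integral {real N..real N + 1} ?g = integral {- real N - 1..real N + 1} ?g"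
      by (rule Henstock_Kurzweil_Integration.integral_combine[OF _ _ int]) auto
    show ?thesis unfolding ends c2[symmetric] c1[symmetric] by (simp only: add_ac)
  qed
  finally show ?case unfolding e1 .
qed simp

lemma full_theta_coefficient:
  assumes "Y > 0"
  shows "integral {0..1} (\<lambda>b. full_theta c Y b * cis (2 * pi * of_int m * b))
    = dual_weight c Y m / of_real (sqrt Y)"
proof (rule LIMSEQ_unique)
  show "(\<lambda>N. integral {- real N..real N} (gauss (c - \<i> * of_int m) Y)) \<longlonglongrightarrow> 
    integral {0..1} (\<lambda>b. full_theta c Y b * cis (2 * pi * of_int m * b))"
    unfolding full_theta_partial_integral[symmetric]
    by (rule tendsto_integral_times_cis[OF full_theta_uniform[OF assms]]) (intro continuous_intros)
qed (unfold dual_weight_def, rule gauss_integral_limit[OF assms])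

lemma continuous_on_full_theta:
  assumes "Y > 0"
  shows "continuous_on {0..1} (full_theta c Y)"
  by (rule uniform_limit_theorem[OF _ full_theta_uniform[OF assms]]) (auto intro!: always_eventually continuous_intros)

text \<open>Both sides are continuous and periodic in \<open>b\<close> and have the same Fourier coefficients.\<close>

theorem poisson_summation:
  assumes Y: "Y > 0"
  shows "(\<lambda>n. dual_term c Y b (int_decode n)) sums (of_real (sqrt Y) * full_theta c Y b)"
proof -
  define D where "D b = suminf (\<lambda>n. dual_term c Y b (int_decode n))" for b
  have sm: "summable (\<lambda>n. dual_term c Y b (int_decode n))" for b
    by (rule summable_norm_cancel) (simp add: dual_term_def norm_mult norm_dual_weight summable_dual_bound[OF Y])
  have uD: "uniform_limit {0..1} (\<lambda>N b. \<Sum>n<N. dual_term c Y b (int_decode n)) D sequentially"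
    unfolding D_def by (rule Weierstrass_m_test[OF _ summable_dual_bound[OF Y, of c]]) (simp add: dual_term_def norm_mult norm_dual_weight)
  have cont_term: "continuous_on {0..1} (\<lambda>b. dual_term c Y b m)" for m
    unfolding dual_term_def by (intro continuous_intros)
  have cD: "continuous_on {0..1} D"
    by (rule uniform_limit_theorem[OF _ uD]) (auto intro!: always_eventually continuous_intros cont_term)
  have coeff: "integral {0..1} (\<lambda>b. D b * cis (2 * pi * of_int m * b)) = dual_weight c Y m" for m
  proof (rule LIMSEQ_unique)
    show "(\<lambda>N. integral {0..1} (\<lambda>b. (\<Sum>n<N. dual_term c Y b (int_decode n)) * cis (2 * pi * of_int m * b))) \<longlonglongrightarrow> 
      integral {0..1} (\<lambda>b. D b * cis (2 * pi * of_int m * b))"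
      by (rule tendsto_integral_times_cis[OF uD]) (intro continuous_intros cont_term)
    have one: "integral {0..1} (\<lambda>b. dual_term c Y b j * cis (2 * pi * of_int m * b)) =
      (if j = m then dual_weight c Y m else 0)" for j
    proof -
      have "(\<lambda>b. dual_term c Y b j * cis (2 * pi * of_int m * b)) =
        (\<lambda>b. dual_weight c Y j * cis (2 * pi * of_int (m - j) * b))"
      proof
        fix b
        have "cis (- (2 * pi * of_int j * b)) * cis (2 * pi * of_int m * b) = cis (2 * pi * of_int (m - j) * b)"
          by (simp add: cis_mult algebra_simps)
        then show "dual_term c Y b j * cis (2 * pi * of_int m * b) =
          dual_weight c Y j * cis (2 * pi * of_int (m - j) * b)"
          by (simp only: dual_term_def mult.assoc)
      qed
      then show ?thesis by (simp add: integral_cis_int del: of_int_diff)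
    qed
    have "integral {0..1} (\<lambda>b. (\<Sum>n<N. dual_term c Y b (int_decode n)) * cis (2 * pi * of_int m * b)) =
       (\<Sum>n<N. if int_decode n = m then dual_weight c Y m else 0)" for N
      unfolding sum_distrib_right one[symmetric]
      by (intro integral_sum integrable_continuous_interval continuous_intros cont_term) auto
    moreover have "int_decode n = m \<longleftrightarrow> n = int_encode m" for n
      by (metis int_decode_inverse int_encode_inverse)
    ultimately have "\<forall>N>int_encode m. integral {0..1} (\<lambda>b. (\<Sum>n<N. dual_term c Y b (int_decode n)) * cis (2 * pi * of_int m * b)) =
       dual_weight c Y m" by simp
    then show "(\<lambda>N. integral {0..1} (\<lambda>b. (\<Sum>n<N. dual_term c Y b (int_decode n)) * cis (2 * pi * of_int m * b))) \<longlonglongrightarrow> 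
       dual_weight c Y m"
      by (intro tendsto_eventually eventually_mono[OF eventually_gt_at_top[of "int_encode m"]]) auto
  qed
  have perD: "D (b + of_int k) = D b" for b and k :: int
  proof -
    have "cis (- (2 * pi * of_int m * (b + of_int k))) = cis (- (2 * pi * of_int m * b))" for m
    proof -
      have "cis (- (2 * pi * of_int m * (b + of_int k))) = cis (- (2 * pi * of_int m * b)) * cis (2 * pi * of_int (- m * k))"
        by (simp add: cis_mult algebra_simps)
      also have "cis (2 * pi * of_int (- m * k)) = 1" by (rule cis_multiple_2pi) auto
      finally show ?thesis by simp
    qed
    then show ?thesis by (simp add: D_def dual_term_def)
  qed
  let ?d = "\<lambda>b. of_real (sqrt Y) * full_theta c Y b - D b"
  have base: "?d b = 0" if "b \<in> {0..1}" for b
  proof (rule fourier_coefficients_zero[OF _ _ _ that])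
    show "continuous_on {0..1} ?d" by (intro continuous_intros cD continuous_on_full_theta[OF Y])
    show "?d 0 = ?d 1" using full_theta_periodic[OF Y, of c 0] perD[of 0 1] by simp
    fix m
    have "integral {0..1} (\<lambda>b. ?d b * cis (2 * pi * of_int m * b)) =
      integral {0..1} (\<lambda>b. of_real (sqrt Y) * (full_theta c Y b * cis (2 * pi * of_int m * b)) - D b * cis (2 * pi * of_int m * b))"
      by (simp add: algebra_simps)
    also have "\<dots> = of_real (sqrt Y) * integral {0..1} (\<lambda>b. full_theta c Y b * cis (2 * pi * of_int m * b)) - 
        integral {0..1} (\<lambda>b. D b * cis (2 * pi * of_int m * b))"
      by (subst integral_diff) (auto intro!: integrable_continuous_interval continuous_intros cD continuous_on_full_theta[OF Y])
    also have "\<dots> = 0" using Y by (simp add: coeff full_theta_coefficient)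
    finally show "integral {0..1} (\<lambda>b. ?d b * cis (2 * pi * of_int m * b)) = 0" .
  qed
  have "b = frac b + of_int \<lfloor>b\<rfloor>" by (simp add: frac_def)
  then have "of_real (sqrt Y) * full_theta c Y b = D b"
    using base[of "frac b"] full_theta_periodic_int[OF Y, of c "frac b" "\<lfloor>b\<rfloor>"] perD[of "frac b" "\<lfloor>b\<rfloor>"]
      frac_lt_1[of b] by (simp add: less_imp_le)
  then show ?thesis using summable_sums[OF sm, of b] by (simp add: D_def)
qed

section \<open>Half theta series in the closed right half plane\<close>

lemma tendsto_cong_pos:
  assumes "(f \<longlongrightarrow> l) (at_right (0::real))" and "\<And>Y. Y > 0 \<Longrightarrow> f Y = g Y"
  shows "(g \<longlongrightarrow> l) (at_right 0)"
  using assms(1) by (rule Lim_transform_eventually) (use assms(2) in \<open>auto intro!: eventually_at_rightI[of 0 1]\<close>)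

definition bell :: "real \<Rightarrow> real \<Rightarrow> real"
  where "bell Y x = exp (- (pi * Y * x\<^sup>2))"

lemma bell_pos: "bell Y x > 0"
  by (simp add: bell_def)

lemma bell_0 [simp]: "bell Y 0 = 1"
  by (simp add: bell_def)

lemma bell_tendsto: "((\<lambda>Y. bell Y x) \<longlongrightarrow> 1) (at_right 0)"
proof -
  have "((\<lambda>Y. bell Y x) \<longlongrightarrow> bell 0 x) (at_right 0)"
    unfolding bell_def by (intro tendsto_intros)
  then show ?thesis by (simp add: bell_def)
qed

lemma square_exp_le:
  fixes w :: real
  assumes "w \<ge> 0"
  shows "w * exp (- w) \<le> 1" "w\<^sup>2 * exp (- w) \<le> 2"
proof -
  have "w \<le> exp w" using exp_ge_add_one_self[of w] by linarith
  then show "w * exp (- w) \<le> 1" by (simp add: exp_minus divide_simps)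
  have "1 + w + w\<^sup>2 / 2 \<le> exp w" using exp_lower_Taylor_quadratic[OF assms] by simp
  then have "w\<^sup>2 \<le> 2 * exp w" using assms by linarith
  then show "w\<^sup>2 * exp (- w) \<le> 2" by (simp add: exp_minus divide_simps)
qed

text \<open>Second order Taylor expansion. Since \<open>x\<^sup>2\<close> times the second derivative of a bell curve is
  bounded by \<open>10\<close> for every width, the remainder has a bound that does not depend on \<open>Y\<close>.\<close>

lemma bell_taylor:
  assumes Y: "Y > 0" and H: "\<bar>h\<bar> \<le> H" and x: "2 * H \<le> x" "0 < x"
  shows "\<bar>bell Y (x + h) - bell Y x - h * (- (2 * pi * Y * x) * bell Y x)\<bar> \<le> 20 * H\<^sup>2 / x\<^sup>2"
proof (cases "h = 0")
  case False
  define D where "D m t = (if m = 0 then bell Y t else if m = 1 then - (2 * pi * Y * t) * bell Y t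
     else (4 * (pi * Y * t)\<^sup>2 - 2 * pi * Y) * bell Y t)" for m :: nat and t
  have deriv: "(D m has_real_derivative D (Suc m) t) (at t)" if "m < 2" for m t
  proof (cases "m = 0")
    case True
    then show ?thesis unfolding D_def bell_def by (auto intro!: derivative_eq_intros)
  next
    case False
    then have "m = 1" using that by simp
    then show ?thesis unfolding D_def bell_def
      by (auto intro!: derivative_eq_intros) (simp add: power2_eq_square left_diff_distrib right_diff_distrib mult_ac)
  qed
  have "\<exists>t. (if x + h < x then x + h < t \<and> t < x else x < t \<and> t < x + h) \<and>
      bell Y (x + h) = (\<Sum>m<2. D m x / fact m * (x + h - x) ^ m) + D 2 t / fact 2 * (x + h - x) ^ 2"
  proof (rule Taylor[of 2 D "bell Y" "x - \<bar>h\<bar>" "x + \<bar>h\<bar>"])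
    show "D 0 = bell Y" by (simp add: D_def fun_eq_iff)
    show "\<forall>m t. m < 2 \<and> x - \<bar>h\<bar> \<le> t \<and> t \<le> x + \<bar>h\<bar> \<longrightarrow> (D m has_real_derivative D (Suc m) t) (at t)"
      using deriv by blast
  qed (use False in simp_all)
  then obtain t where t: "if x + h < x then x + h < t \<and> t < x else x < t \<and> t < x + h"
    and eq: "bell Y (x + h) = (\<Sum>m<2. D m x / fact m * (x + h - x) ^ m) + D 2 t / fact 2 * (x + h - x) ^ 2"
    by blast
  have tx: "x / 2 \<le> t" using t H x by (auto split: if_splits)
  then have t0: "t > 0" using x by linarith
  \<comment> \<open>\<open>10 = 4 * 2 + 2 * 1\<close>, from the two bounds for \<open>w\<^sup>n exp (- w)\<close>\<close>
  have "t\<^sup>2 * \<bar>D 2 t\<bar> \<le> 10"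
  proof -
    define w where "w = pi * Y * t\<^sup>2"
    have w: "w \<ge> 0" using Y by (simp add: w_def)
    have "t\<^sup>2 * D 2 t = 4 * (w\<^sup>2 * exp (- w)) - 2 * (w * exp (- w))"
      by (simp add: D_def bell_def w_def power2_eq_square left_diff_distrib right_diff_distrib mult_ac)
    moreover have "0 \<le> w\<^sup>2 * exp (- w)" "0 \<le> w * exp (- w)" using w by auto
    ultimately have "\<bar>t\<^sup>2 * D 2 t\<bar> \<le> 10" using square_exp_le[OF w] by linarith
    then show ?thesis by (simp add: abs_mult)
  qed
  then have "\<bar>D 2 t\<bar> \<le> 10 / t\<^sup>2" using t0 by (simp add: field_simps)
  also have "\<dots> \<le> 10 / (x / 2)\<^sup>2" using tx x by (intro divide_left_mono power_mono) auto
  finally have D2: "\<bar>D 2 t\<bar> \<le> 40 / x\<^sup>2" by (simp add: power_divide)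
  have "bell Y (x + h) - bell Y x - h * (- (2 * pi * Y * x) * bell Y x) = D 2 t / 2 * h\<^sup>2"
    unfolding eq by (simp add: D_def numeral_2_eq_2)
  also have "\<bar>\<dots>\<bar> = \<bar>D 2 t\<bar> / 2 * h\<^sup>2" by (simp add: abs_mult)
  also have "\<dots> \<le> (40 / x\<^sup>2) / 2 * H\<^sup>2"
    using D2 H by (intro mult_mono divide_right_mono) (auto simp: abs_le_square_iff[symmetric])
  finally show ?thesis by simp
qed simp

text \<open>A combination of three translates that annihilates affine functions is a second difference; it
  is bounded by a multiple of \<open>1 / x\<^sup>2\<close> uniformly in \<open>Y\<close>.\<close>

lemma bell_difference_bound:
  assumes Y: "Y > 0" and b: "\<bar>b1\<bar> \<le> B" "\<bar>b2\<bar> \<le> B" "\<bar>b3\<bar> \<le> B" and x: "2 * B \<le> x" "0 < x"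
    and lin: "u1 + u2 + u3 = 0" "u1 * b1 + u2 * b2 + u3 * b3 = 0"
  shows "\<bar>u1 * bell Y (x + b1) + u2 * bell Y (x + b2) + u3 * bell Y (x + b3)\<bar> \<le>
     (\<bar>u1\<bar> + \<bar>u2\<bar> + \<bar>u3\<bar>) * (20 * B\<^sup>2) * (1 / x\<^sup>2)"
proof -
  define d where "d = - (2 * pi * Y * x) * bell Y x"
  define E where "E = 20 * B\<^sup>2 / x\<^sup>2"
  define e where "e h = bell Y (x + h) - bell Y x - h * d" for h
  have e: "\<bar>e h\<bar> \<le> E" if "\<bar>h\<bar> \<le> B" for h
    unfolding e_def d_def E_def by (rule bell_taylor[OF Y that x])
  have bell: "bell Y (x + h) = e h + bell Y x + h * d" for h by (simp add: e_def)
  have "u1 * bell Y (x + b1) + u2 * bell Y (x + b2) + u3 * bell Y (x + b3) = u1 * e b1 + u2 * e b2 + u3 * e b3"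
  proof -
    have "u1 * bell Y (x + b1) + u2 * bell Y (x + b2) + u3 * bell Y (x + b3) =
      u1 * e b1 + u2 * e b2 + u3 * e b3 + (u1 + u2 + u3) * bell Y x + (u1 * b1 + u2 * b2 + u3 * b3) * d"
      unfolding bell by (simp only: distrib_left distrib_right add_ac mult_ac)
    then show ?thesis unfolding lin by simp
  qed
  also have "\<bar>\<dots>\<bar> \<le> \<bar>u1 * e b1\<bar> + \<bar>u2 * e b2\<bar> + \<bar>u3 * e b3\<bar>" by linarith
  also have "\<dots> \<le> \<bar>u1\<bar> * E + \<bar>u2\<bar> * E + \<bar>u3\<bar> * E"
    unfolding abs_mult by (intro add_mono mult_left_mono e b abs_ge_zero)
  also have "\<dots> = (\<bar>u1\<bar> + \<bar>u2\<bar> + \<bar>u3\<bar>) * E" by (simp only: distrib_right)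
  finally show ?thesis by (simp add: E_def)
qed

lemma tannery_zero:
  fixes a :: "nat \<Rightarrow> real \<Rightarrow> complex"
  assumes lim: "\<And>k. ((\<lambda>Y. a k Y) \<longlongrightarrow> 0) (at_right 0)"
    and bound: "\<And>k Y. k \<ge> K \<Longrightarrow> 0 < Y \<Longrightarrow> Y \<le> 1 \<Longrightarrow> norm (a k Y) \<le> M k"
    and sm: "summable M"
  shows "((\<lambda>Y. suminf (\<lambda>k. a k Y)) \<longlongrightarrow> 0) (at_right 0)"
proof -
  have "eventually (\<lambda>(k, Y). norm (a k Y) \<le> M k) (at_top \<times>\<^sub>F at_right 0)"
    unfolding eventually_prod_filter
  proof (intro exI conjI)
    show "eventually (\<lambda>k. k \<ge> K) at_top" by (rule eventually_ge_at_top)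
    show "eventually (\<lambda>Y::real. 0 < Y \<and> Y \<le> 1) (at_right 0)"
      by (rule eventually_at_rightI[of 0 1]) auto
  qed (use bound in auto)
  from tannerys_theorem[OF lim this sm] show ?thesis by simp
qed

text \<open>Each term tends to \<open>u1 + u2 + u3 = 0\<close>, and the bound by \<open>1 / k\<^sup>2\<close> allows passing to the limit
  in the series even if \<open>w\<close> lies on the unit circle.\<close>

lemma bell_combination_limit:
  fixes w :: complex
  assumes w: "norm w \<le> 1" and lin: "u1 + u2 + u3 = 0" "u1 * b1 + u2 * b2 + u3 * b3 = 0"
  shows "((\<lambda>Y. suminf (\<lambda>k. w ^ k * of_real (u1 * bell Y (real k + b1) + u2 * bell Y (real k + b2) + u3 * bell Y (real k + b3)))) \<longlongrightarrow> 0) (at_right 0)"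
proof -
  let ?g = "\<lambda>k Y. u1 * bell Y (real k + b1) + u2 * bell Y (real k + b2) + u3 * bell Y (real k + b3)"
  define B where "B = max \<bar>b1\<bar> (max \<bar>b2\<bar> \<bar>b3\<bar>)"
  have B: "\<bar>b1\<bar> \<le> B" "\<bar>b2\<bar> \<le> B" "\<bar>b3\<bar> \<le> B" by (auto simp: B_def)
  define C where "C = (\<bar>u1\<bar> + \<bar>u2\<bar> + \<bar>u3\<bar>) * (20 * B\<^sup>2)"
  obtain K0 where K0: "2 * B \<le> real K0" using real_arch_simple by blast
  show ?thesis
  proof (rule tannery_zero)
    fix k
    have "((\<lambda>Y. w ^ k * of_real (?g k Y))
       \<longlongrightarrow> w ^ k * of_real (u1 * 1 + u2 * 1 + u3 * 1)) (at_right 0)"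
      by (intro tendsto_intros bell_tendsto)
    then show "((\<lambda>Y. w ^ k * of_real (?g k Y))
       \<longlongrightarrow> 0) (at_right 0)" using lin by simp
  next
    fix k Y assume k: "max K0 1 \<le> k" and Y: "(0::real) < Y" "Y \<le> 1"
    have "2 * B \<le> real k" "0 < real k" using K0 k by linarith+
    then have "\<bar>?g k Y\<bar> \<le> C * (1 / (real k)\<^sup>2)"
      unfolding C_def using bell_difference_bound[OF Y(1) B _ _ lin] by blast
    moreover have "norm (w ^ k) \<le> 1" using w by (simp add: norm_power power_le_one)
    ultimately have "norm (w ^ k) * \<bar>?g k Y\<bar> \<le> 1 * (C * (1 / (real k)\<^sup>2))"
      by (intro mult_mono) auto
    then show "norm (w ^ k * of_real (?g k Y)) \<le> C * (1 / (real k)\<^sup>2)"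
      by (simp only: norm_mult norm_of_real mult_1)
  next
    show "summable (\<lambda>k. C * (1 / (real k)\<^sup>2))"
      using inverse_power_summable[of 2, where 'a = real] by (intro summable_mult) (simp add: inverse_eq_divide)
  qed
qed

lemma gauss_bell: "gauss c Y (real k + b) = exp (- (2 * of_real pi * c * of_real b)) * (exp (- (2 * of_real pi * c)) ^ k * of_real (bell Y (real k + b)))"
proof -
  have "- (2 * of_real pi * c * of_real (real k + b)) - of_real (pi * Y * (real k + b)\<^sup>2) =
    - (2 * of_real pi * c * of_real b) + (of_nat k * (- (2 * of_real pi * c)) + complex_of_real (- (pi * Y * (real k + b)\<^sup>2)))"
    by (simp add: ring_distribs)
  then show ?thesis
    unfolding gauss_def bell_def exp_of_real[symmetric] exp_of_nat_mult[symmetric] exp_add[symmetric] by (rule arg_cong)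
qed
lemma summable_bell:
  assumes "Y > 0"
  shows "summable (\<lambda>k. bell Y (real k + b))"
proof -
  have "gauss 0 Y x = of_real (bell Y x)" for x
    unfolding gauss_def bell_def exp_of_real[symmetric] by simp
  then show ?thesis using summable_gauss[OF assms, of 0 b] by (simp add: summable_of_real_iff)
qed

lemma summable_power_bell:
  assumes "Y > 0" "norm w \<le> 1"
  shows "summable (\<lambda>k. (w::complex) ^ k * of_real (bell Y (real k + b)))"
proof (rule summable_norm_cancel, rule summable_comparison_test[OF _ summable_bell[OF assms(1), of b]])
  have "norm (w ^ k) * bell Y (real k + b) \<le> 1 * bell Y (real k + b)" for k
    using assms(2) by (intro mult_right_mono less_imp_le[OF bell_pos]) (auto simp: norm_power power_le_one)
  then show "\<exists>N. \<forall>k\<ge>N. norm (norm (w ^ k * of_real (bell Y (real k + b)))) \<le> bell Y (real k + b)"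
    by (simp add: norm_mult bell_pos less_imp_le)
qed

text \<open>The Gaussian factor acts as a summation method for the geometric series with ratio
  \<open>w = exp (- 2\<pi>c)\<close>. Two summations by parts multiply the series by \<open>(1 - w)\<^sup>2\<close> and turn it into
  a series of second differences, which tends to \<open>0\<close>, plus two boundary terms.\<close>

lemma half_theta_limit:
  assumes c: "Re c \<ge> 0" and w1: "exp (- (2 * of_real pi * c)) \<noteq> 1"
  shows "((\<lambda>Y. half_theta c Y b) \<longlongrightarrow> exp (- (2 * of_real pi * c * of_real b)) / (1 - exp (- (2 * of_real pi * c)))) (at_right 0)"
proof -
  let ?E = "exp (- (2 * of_real pi * c * of_real b))"
  define w where "w = exp (- (2 * of_real pi * c))"
  have w: "norm w \<le> 1" "w \<noteq> 1" using assms by (auto simp: w_def)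
  define A where "A Y b = suminf (\<lambda>k. w ^ k * of_real (bell Y (real k + b)))" for Y b
  have rec: "A Y b = of_real (bell Y b) + w * A Y (b + 1)" if "Y > 0" for Y b
    using suminf_split_head[OF summable_power_bell[OF that w(1), of b]]
      suminf_mult[OF summable_power_bell[OF that w(1), of "b + 1"], of w]
    by (simp add: A_def mult_ac add_ac diff_eq_eq)
  have comb: "suminf (\<lambda>k. w ^ k * of_real (1 * bell Y (real k + (b + 2)) + (- 2) * bell Y (real k + (b + 1)) + 1 * bell Y (real k + b)))
     = A Y (b + 2) - 2 * A Y (b + 1) + A Y b" if "Y > 0" for Y
  proof -
    note S = summable_power_bell[OF that w(1)]
    have "(\<lambda>k. w ^ k * of_real (bell Y (real k + (b + 2))) - 2 * (w ^ k * of_real (bell Y (real k + (b + 1)))) + w ^ k * of_real (bell Y (real k + b)))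
      sums (A Y (b + 2) - 2 * A Y (b + 1) + A Y b)"
      unfolding A_def by (intro sums_add sums_diff sums_mult summable_sums S)
    then show ?thesis by (intro sums_unique[symmetric]) (simp add: algebra_simps)
  qed
  have "((\<lambda>Y. w\<^sup>2 * (A Y (b + 2) - 2 * A Y (b + 1) + A Y b) + (1 - 2 * w) * of_real (bell Y b) + w * of_real (bell Y (b + 1)))
     \<longlongrightarrow> w\<^sup>2 * 0 + (1 - 2 * w) * of_real 1 + w * of_real 1) (at_right 0)"
    by (intro tendsto_intros bell_tendsto tendsto_cong_pos[OF bell_combination_limit[OF w(1)] comb]) auto
  then have "((\<lambda>Y. (1 - w)\<^sup>2 * A Y b) \<longlongrightarrow> w\<^sup>2 * 0 + (1 - 2 * w) * of_real 1 + w * of_real 1) (at_right 0)"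
  proof (rule tendsto_cong_pos)
    fix Y :: real assume Y: "Y > 0"
    show "w\<^sup>2 * (A Y (b + 2) - 2 * A Y (b + 1) + A Y b) + (1 - 2 * w) * of_real (bell Y b) + w * of_real (bell Y (b + 1))
      = (1 - w)\<^sup>2 * A Y b"
    proof -
      have "w * A Y (b + 1) = A Y b - of_real (bell Y b)" "w * A Y (b + 2) = A Y (b + 1) - of_real (bell Y (b + 1))"
        using rec[OF Y, of b] rec[OF Y, of "b + 1"] by (simp_all add: add.assoc)
      then have r: "w * A Y (b + 1) = A Y b - of_real (bell Y b)"
        "w * (w * A Y (b + 2)) = A Y b - of_real (bell Y b) - w * of_real (bell Y (b + 1))"
        by (simp_all add: right_diff_distrib)
      have "w\<^sup>2 * (A Y (b + 2) - 2 * A Y (b + 1) + A Y b) = w * (w * A Y (b + 2)) - 2 * w * (w * A Y (b + 1)) + w\<^sup>2 * A Y b"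
        by (simp add: power2_eq_square algebra_simps)
      then show ?thesis unfolding r by (simp add: power2_eq_square algebra_simps)
    qed
  qed
  then have "((\<lambda>Y. ?E / (1 - w)\<^sup>2 * ((1 - w)\<^sup>2 * A Y b)) \<longlongrightarrow>
     ?E / (1 - w)\<^sup>2 * (w\<^sup>2 * 0 + (1 - 2 * w) * of_real 1 + w * of_real 1)) (at_right 0)"
    by (intro tendsto_intros)
  also have "?E / (1 - w)\<^sup>2 * (w\<^sup>2 * 0 + (1 - 2 * w) * of_real 1 + w * of_real 1)
     = ?E / (1 - w)"
    using w(2) by (simp add: power2_eq_square)
  finally have lim: "((\<lambda>Y. ?E / (1 - w)\<^sup>2 * ((1 - w)\<^sup>2 * A Y b)) \<longlongrightarrow>
     ?E / (1 - w)) (at_right 0)" .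
  have "half_theta c Y b = ?E / (1 - w)\<^sup>2 * ((1 - w)\<^sup>2 * A Y b)" if "Y > 0" for Y
    using suminf_mult[OF summable_power_bell[OF that w(1), of b]] w(2)
    by (simp add: half_theta_def gauss_bell A_def w_def[symmetric])
  from tendsto_cong_pos[OF lim this[symmetric]] show ?thesis by (simp add: w_def)
qed

text \<open>For \<open>w = 1\<close> all terms have the same phase and the series diverges as \<open>Y\<close> tends to \<open>0\<close>.
  Two shifts of it differ by a bounded amount, and comparison with a multiple of a telescoping
  series gives the limit of the difference.\<close>

lemma half_theta_resonant:
  assumes w: "exp (- (2 * of_real pi * c)) = 1"
  obtains U where
    "\<And>Y b. Y > 0 \<Longrightarrow> half_theta c Y b = exp (- (2 * of_real pi * c * of_real b)) * of_real (U b Y)"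
    "\<And>b. filterlim (U b) at_top (at_right 0)"
    "\<And>b b'. ((\<lambda>Y. U b Y - U b' Y) \<longlongrightarrow> b' - b) (at_right 0)"
proof
  define U where "U b Y = suminf (\<lambda>k. bell Y (real k + b))" for b Y
  show "half_theta c Y b = exp (- (2 * of_real pi * c * of_real b)) * of_real (U b Y)" if "Y > 0" for Y b
    using suminf_mult[OF summable_power_bell[OF that, of 1 b]]
    by (simp add: half_theta_def gauss_bell U_def w suminf_of_real[OF summable_bell[OF that, of b]])
  have rec: "U b Y = bell Y b + U (b + 1) Y" if "Y > 0" for b Y
    using suminf_split_head[OF summable_bell[OF that, of b]] by (simp add: U_def add_ac)
  have lim0: "((\<lambda>Y. U b Y - U 0 Y) \<longlongrightarrow> - b) (at_right 0)" for b
  proof -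
    let ?g = "\<lambda>k Y. 1 * bell Y (real k + b) + (b - 1) * bell Y (real k + 0) + (- b) * bell Y (real k + 1)"
    have "((\<lambda>Y. suminf (\<lambda>k. 1 ^ k * complex_of_real (?g k Y))) \<longlongrightarrow> 0) (at_right 0)"
      by (rule bell_combination_limit) auto
    then have "((\<lambda>Y. complex_of_real (U b Y - U 0 Y + b * bell Y 0)) \<longlongrightarrow> 0) (at_right 0)"
    proof (rule tendsto_cong_pos)
      fix Y :: real assume Y: "Y > 0"
      show "suminf (\<lambda>k. 1 ^ k * complex_of_real (?g k Y))
        = complex_of_real (U b Y - U 0 Y + b * bell Y 0)"
      proof -
        have "(\<lambda>k. ?g k Y)
           sums (1 * U b Y + (b - 1) * U 0 Y + (- b) * U 1 Y)"
          unfolding U_def by (intro sums_add sums_mult summable_sums summable_bell Y)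
        moreover have "1 * U b Y + (b - 1) * U 0 Y + (- b) * U 1 Y = U b Y - U 0 Y + b * bell Y 0"
          using rec[OF Y, of 0] by (simp add: algebra_simps)
        ultimately have "(\<lambda>k. complex_of_real (?g k Y))
           sums complex_of_real (U b Y - U 0 Y + b * bell Y 0)"
          by (simp only: sums_of_real_iff)
        then show ?thesis by (simp only: power_one mult_1 sums_iff)
      qed
    qed
    then have "((\<lambda>Y. U b Y - U 0 Y + b * bell Y 0) \<longlongrightarrow> 0) (at_right 0)"
      by (simp only: tendsto_of_real_iff flip: of_real_0[where 'a = complex])
    from tendsto_diff[OF this tendsto_const[of "b * bell 1 0"]] show ?thesis by simp
  qed
  show diff: "((\<lambda>Y. U b Y - U b' Y) \<longlongrightarrow> b' - b) (at_right 0)" for b b'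
    using tendsto_diff[OF lim0[of b] lim0[of b']] by simp
  have top0: "filterlim (U 0) at_top (at_right 0)"
    unfolding filterlim_at_top
  proof
    fix Z :: real
    obtain N where N: "Z + 1 < real N" using reals_Archimedean2 by blast
    have "((\<lambda>Y. \<Sum>k<N. bell Y (real k + 0)) \<longlongrightarrow> (\<Sum>k<N. 1)) (at_right 0)"
      by (intro tendsto_sum bell_tendsto)
    then have "\<forall>\<^sub>F Y in at_right 0. Z < (\<Sum>k<N. bell Y (real k + 0))"
      by (rule order_tendstoD(1)) (use N in simp)
    moreover have "\<forall>\<^sub>F Y::real in at_right 0. Y > 0" by (rule eventually_at_right_less)
    ultimately show "\<forall>\<^sub>F Y in at_right 0. Z \<le> U 0 Y"
    proof eventually_elim
      case (elim Y)
      have "(\<Sum>k<N. bell Y (real k + 0)) \<le> U 0 Y"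
        unfolding U_def by (rule sum_le_suminf[OF summable_bell[OF elim(2)]]) (auto simp: bell_pos less_imp_le)
      then show ?case using elim by linarith
    qed
  qed
  show "filterlim (U b) at_top (at_right 0)" for b
    using filterlim_tendsto_add_at_top[OF lim0[of b] top0] by simp
qed

section \<open>The dual expansion of the characters\<close>

text \<open>Numerator of the common limit formula. It occurs twice: at \<open>z = exp (2\<pi>\<epsilon> / \<surd>(2p))\<close> as numerator
  of the geometric series, and at \<open>2p\<close>-th roots of unity as coefficient in the dual expansion.\<close>

definition weyl_numerator :: "nat \<Rightarrow> complex \<Rightarrow> int \<Rightarrow> nat \<Rightarrow> complex"
  where "weyl_numerator p z r s = z powi (int s - int p * (2 - r)) - z powi (- int s - int p * (2 - r))"

definition b_minus :: "nat \<Rightarrow> int \<Rightarrow> nat \<Rightarrow> real"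
  where "b_minus p r s = (2 - of_int r) / 2 - real s / (2 * real p)"

definition b_plus :: "nat \<Rightarrow> int \<Rightarrow> nat \<Rightarrow> real"
  where "b_plus p r s = (2 - of_int r) / 2 + real s / (2 * real p)"

lemma b_times_2p:
  assumes "p > 0"
  shows "b_minus p r s * real (2 * p) = - of_int (int s - int p * (2 - r))"
    and "b_plus p r s * real (2 * p) = - of_int (- int s - int p * (2 - r))"
  using assms by (simp_all add: b_minus_def b_plus_def field_simps)

lemma exp_weyl:
  fixes x :: complex
  assumes "p > 0"
  shows "exp (- (2 * of_real pi * (x * of_nat (2 * p)) * of_real (b_minus p r s))) = exp (2 * of_real pi * x) powi (int s - int p * (2 - r))"
    and "exp (- (2 * of_real pi * (x * of_nat (2 * p)) * of_real (b_plus p r s))) = exp (2 * of_real pi * x) powi (- int s - int p * (2 - r))"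
proof -
  have gen: "exp (- (2 * of_real pi * (x * of_nat (2 * p)) * of_real b)) = exp (2 * of_real pi * x) powi n"
    if "b * real (2 * p) = - of_int n" for b n
  proof -
    have "complex_of_real b * of_nat (2 * p) = - of_int n"
      using arg_cong[OF that, of complex_of_real] by simp
    then have "- (2 * of_real pi * (x * of_nat (2 * p)) * complex_of_real b) = of_int n * (2 * of_real pi * x)"
    proof -
      have "- (2 * of_real pi * (x * N) * complex_of_real b) = - (complex_of_real b * N) * (2 * of_real pi * x)" for N :: complex
        by (simp add: mult_ac)
      from this[of "of_nat (2 * p)"] show ?thesis unfolding \<open>complex_of_real b * of_nat (2 * p) = - of_int n\<close> by simp
    qed
    then show ?thesis by (simp only: exp_power_int)
  qed
  show "exp (- (2 * of_real pi * (x * of_nat (2 * p)) * of_real (b_minus p r s))) = exp (2 * of_real pi * x) powi (int s - int p * (2 - r))"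
    by (rule gen) (rule b_times_2p(1)[OF assms])
  show "exp (- (2 * of_real pi * (x * of_nat (2 * p)) * of_real (b_plus p r s))) = exp (2 * of_real pi * x) powi (- int s - int p * (2 - r))"
    by (rule gen) (rule b_times_2p(2)[OF assms])
qed

text \<open>The character of \<open>M\<^bsub>r,s\<^esub>\<close> times the eta function.\<close>

definition character_sum :: "nat \<Rightarrow> complex \<Rightarrow> int \<Rightarrow> nat \<Rightarrow> real \<Rightarrow> complex"
  where "character_sum p c r s Y = half_theta c Y (b_minus p r s) - half_theta c Y (b_plus p r s)"

definition unity_root :: "nat \<Rightarrow> int \<Rightarrow> complex"
  where "unity_root p m = cis (pi * of_int m / real p)"

lemma unity_root_powi: "unity_root p m powi n = cis (pi * of_int m * of_int n / real p)"
  by (simp add: unity_root_def cis_power_int mult_ac)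

lemma cis_weyl:
  assumes "p > 0"
  shows "cis (- (2 * pi * of_int m * b_minus p r s)) - cis (- (2 * pi * of_int m * b_plus p r s)) = weyl_numerator p (unity_root p m) r s"
proof -
  have 1: "- (2 * pi * of_int m * b_minus p r s) = pi * of_int m * of_int (int s - int p * (2 - r)) / real p"
    and 2: "- (2 * pi * of_int m * b_plus p r s) = pi * of_int m * of_int (- int s - int p * (2 - r)) / real p"
    using assms by (simp_all add: b_minus_def b_plus_def field_simps)
  show ?thesis unfolding weyl_numerator_def unity_root_powi 1 2 ..
qed

lemma unity_root_power_2p: 
  assumes "p > 0"
  shows "unity_root p m powi (2 * int p) = 1"
proof -
  have "pi * of_int m * of_int (2 * int p) / real p = 2 * pi * of_int m" using assms by simp
  then show ?thesis unfolding unity_root_powi by (simp add: cis_multiple_2pi)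
qed

lemma unity_root_nonzero [simp]: "unity_root p m \<noteq> 0"
  by (simp add: unity_root_def)

lemma unity_root_square:
  assumes "p > 0"
  shows "(unity_root p m)\<^sup>2 = 1 \<longleftrightarrow> int p dvd m"
proof -
  have "(unity_root p m)\<^sup>2 = cis (2 * pi * of_int m / real p)"
    by (simp add: unity_root_def Complex.DeMoivre mult_ac)
  then have "(unity_root p m)\<^sup>2 = 1 \<longleftrightarrow> (\<exists>n::int. 2 * pi * of_int m / real p = of_int (2 * n) * pi)"
    by (simp add: cis_conv_exp exp_eq_1)
  also have "\<dots> \<longleftrightarrow> (\<exists>n::int. real_of_int m = real_of_int (int p * n))"
    using assms by (intro ex_cong1) (simp add: field_simps)
  also have "\<dots> \<longleftrightarrow> int p dvd m" unfolding of_int_eq_iff dvd_def ..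
  finally show ?thesis .
qed

text \<open>This removes from the dual expansion all indices divisible by \<open>p\<close>, and is the reason why
  \<open>B_bound\<close> minimises over the other integers only.\<close>

lemma weyl_numerator_zero:
  assumes "z \<noteq> 0" "z\<^sup>2 = 1"
  shows "weyl_numerator p z r s = 0"
proof -
  have "z powi (2 * int s) = 1"
    using assms(2) by (simp only: power_int_mult) simp
  then have "z powi ((- int s - int p * (2 - r)) + 2 * int s) = z powi (- int s - int p * (2 - r))"
    using assms(1) by (subst power_int_add) auto
  moreover have "(- int s - int p * (2 - r)) + 2 * int s = int s - int p * (2 - r)" by simp
  ultimately show ?thesis by (simp only: weyl_numerator_def diff_self)
qed

lemma norm_weyl_numerator_root: "norm (weyl_numerator p (unity_root p m) r s) \<le> 2"
  unfolding weyl_numerator_def unity_root_powi by (rule order_trans[OF norm_triangle_ineq4]) simp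

definition dual_sum :: "(int \<Rightarrow> complex) \<Rightarrow> complex \<Rightarrow> real \<Rightarrow> complex"
  where "dual_sum u c Y = suminf (\<lambda>n. u (int_decode n) * dual_weight c Y (int_decode n))"

text \<open>The terms of \<open>dual_sum\<close> with index in \<open>M\<close>, for \<open>M\<close> the integers at minimal distance from
  \<open>Im c\<close>, after division by their common modulus: only their phases are left.\<close>

definition leading_sum :: "(int \<Rightarrow> complex) \<Rightarrow> int set \<Rightarrow> complex \<Rightarrow> real \<Rightarrow> complex"
  where "leading_sum u M c Y = (\<Sum>m\<in>M. u m * cis (2 * pi * Re c * (Im c - of_int m) / Y))"

text \<open>Each half series is the full one minus the half with negative indices; Poisson summation is
  applied to the full ones.\<close>

lemma character_sum_poisson:
  assumes p: "p > 0" and Y: "Y > 0"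
  shows "of_real (sqrt Y) * character_sum p c r s Y =
    dual_sum (\<lambda>m. weyl_numerator p (unity_root p m) r s) c Y - of_real (sqrt Y) * (half_theta (- c) Y (1 - b_minus p r s) - half_theta (- c) Y (1 - b_plus p r s))"
proof -
  have eq: "dual_term c Y (b_minus p r s) m - dual_term c Y (b_plus p r s) m =
     weyl_numerator p (unity_root p m) r s * dual_weight c Y m" for m
    unfolding cis_weyl[OF p, symmetric] dual_term_def by (simp add: algebra_simps)
  have "(\<lambda>n. weyl_numerator p (unity_root p (int_decode n)) r s * dual_weight c Y (int_decode n))
    sums (of_real (sqrt Y) * full_theta c Y (b_minus p r s) - of_real (sqrt Y) * full_theta c Y (b_plus p r s))"
    using sums_diff[OF poisson_summation[OF Y, of c "b_minus p r s"] poisson_summation[OF Y, of c "b_plus p r s"]]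
    unfolding eq by (simp only:)
  from sums_unique[OF this] show ?thesis
    by (simp add: character_sum_def full_theta_def dual_sum_def algebra_simps)
qed

lemma exp_neg_over_limit: "A > 0 \<Longrightarrow> ((\<lambda>Y::real. exp (- A / Y)) \<longlongrightarrow> 0) (at_right 0)"
  by real_asymp

lemma finite_ints_near:
  fixes h d :: real
  shows "finite {m::int. \<bar>h - of_int m\<bar> \<le> d}"
proof (rule finite_subset)
  show "{m::int. \<bar>h - of_int m\<bar> \<le> d} \<subseteq> {\<lfloor>h - d\<rfloor>..\<lceil>h + d\<rceil>}"
  proof
    fix m assume "m \<in> {m::int. \<bar>h - of_int m\<bar> \<le> d}"
    then have "h - d \<le> of_int m" "of_int m \<le> h + d" by auto
    then show "m \<in> {\<lfloor>h - d\<rfloor>..\<lceil>h + d\<rceil>}" by (simp add: floor_le_iff le_ceiling_iff)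
  qed
qed simp

lemma finite_ints_at_distance: "finite {m::int. \<bar>h - of_int m\<bar> = (d::real)}"
  by (rule finite_subset[OF _ finite_ints_near[of h d]]) auto

text \<open>After division by the modulus of the largest terms, a term with index at distance \<open>t > d\<close> from
  \<open>Im c\<close> has modulus at most \<open>2 exp (\<pi> (d\<^sup>2 - t\<^sup>2) / Y)\<close>. For \<open>Y \<le> 1\<close> this is summable uniformly
  in \<open>Y\<close>, and each term tends to \<open>0\<close>.\<close>

lemma dual_sum_dominant:
  fixes u :: "int \<Rightarrow> complex" and c :: complex
  assumes bound: "\<And>m. norm (u m) \<le> 2" and d: "d \<ge> 0" and far: "\<And>m. u m \<noteq> 0 \<Longrightarrow> d \<le> \<bar>Im c - of_int m\<bar>"
    and M: "M = {m. \<bar>Im c - of_int m\<bar> = d}"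
  shows "((\<lambda>Y. of_real (exp (- (pi * ((Re c)\<^sup>2 - d\<^sup>2)) / Y)) * dual_sum u c Y
       - leading_sum u M c Y) \<longlongrightarrow> 0) (at_right 0)"
proof -
  define t where "t m = Im c - of_int m" for m :: int
  have fin: "finite M" unfolding M by (rule finite_ints_at_distance)
  define f where "f m Y = (if m \<in> M then 0 else u m * (of_real (exp (- (pi * ((t m)\<^sup>2 - d\<^sup>2)) / Y)) * cis (2 * pi * Re c * t m / Y)))" for m Y
  have "((\<lambda>Y. suminf (\<lambda>n. f (int_decode n) Y)) \<longlongrightarrow> 0) (at_right 0)"
  proof (rule tannery_zero)
    fix n
    let ?m = "int_decode n"
    show "((\<lambda>Y. f ?m Y) \<longlongrightarrow> 0) (at_right 0)"
    proof (cases "?m \<in> M \<or> u ?m = 0")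
      case False
      then have "d < \<bar>t ?m\<bar>" using far[of ?m] by (auto simp: t_def M)
      then have "d\<^sup>2 < \<bar>t ?m\<bar>\<^sup>2" by (intro power_strict_mono d) auto
      then have "pi * ((t ?m)\<^sup>2 - d\<^sup>2) > 0" by simp
      from tendsto_mult_right_zero[OF exp_neg_over_limit[OF this], of "norm (u ?m)"]
      have "((\<lambda>Y. norm (f ?m Y)) \<longlongrightarrow> 0) (at_right 0)"
        using False by (simp add: f_def norm_mult)
      then show ?thesis by (rule tendsto_norm_zero_cancel)
    next
      case True
      then have "f ?m = (\<lambda>Y. 0)" by (auto simp: f_def fun_eq_iff)
      then show ?thesis by simp
    qed
  next
    fix n :: nat and Y :: real assume Y: "0 < Y" "Y \<le> 1"
    let ?m = "int_decode n"
    show "norm (f ?m Y) \<le> 2 * (exp (pi * d\<^sup>2) * exp (- pi * (Im c - of_int ?m)\<^sup>2))"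
    proof (cases "?m \<in> M \<or> u ?m = 0")
      case False
      then have "d \<le> \<bar>t ?m\<bar>" using far[of ?m] by (auto simp: t_def)
      then have "d\<^sup>2 \<le> \<bar>t ?m\<bar>\<^sup>2" by (intro power_mono d) auto
      then have nn: "0 \<le> pi * ((t ?m)\<^sup>2 - d\<^sup>2)" by simp
      have "pi * ((t ?m)\<^sup>2 - d\<^sup>2) \<le> pi * ((t ?m)\<^sup>2 - d\<^sup>2) / Y"
        using mult_right_mono[OF Y(2) nn] Y(1) by (simp add: pos_le_divide_eq mult.commute)
      then have "exp (- (pi * ((t ?m)\<^sup>2 - d\<^sup>2)) / Y) \<le> exp (- (pi * ((t ?m)\<^sup>2 - d\<^sup>2)))" by simp
      also have "\<dots> = exp (pi * d\<^sup>2) * exp (- pi * (Im c - of_int ?m)\<^sup>2)"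
        by (simp add: t_def exp_add[symmetric] right_diff_distrib)
      finally show ?thesis
        using False bound[of ?m] by (auto simp: f_def norm_mult intro!: mult_mono)
    qed (auto simp: f_def)
  next
    show "summable (\<lambda>n. 2 * (exp (pi * d\<^sup>2) * exp (- pi * (Im c - of_int (int_decode n))\<^sup>2)))"
      by (intro summable_mult summable_exp_neg_square_int) simp
  qed
  then show ?thesis
  proof (rule tendsto_cong_pos)
    fix Y :: real assume Y: "Y > 0"
    show "suminf (\<lambda>n. f (int_decode n) Y) = of_real (exp (- (pi * ((Re c)\<^sup>2 - d\<^sup>2)) / Y)) * dual_sum u c Y
       - leading_sum u M c Y"
    proof -
      let ?E = "of_real (exp (- (pi * ((Re c)\<^sup>2 - d\<^sup>2)) / Y)) :: complex"
      let ?g = "\<lambda>m. if m \<in> M then u m * cis (2 * pi * Re c * (Im c - of_int m) / Y) else 0"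
      have split: "?E * (u m * dual_weight c Y m) - ?g m = f m Y" for m
      proof -
        have e: "(c - \<i> * of_int m)\<^sup>2 = of_real ((Re c)\<^sup>2 - (t m)\<^sup>2) + \<i> * of_real (2 * Re c * t m)"
          by (simp add: complex_eq_iff t_def power2_eq_square)
        have "?E * dual_weight c Y m =
           of_real (exp (- (pi * ((t m)\<^sup>2 - d\<^sup>2)) / Y)) * cis (2 * pi * Re c * t m / Y)"
          unfolding dual_weight_def exp_of_real[symmetric] cis_conv_exp exp_add[symmetric]
          unfolding e by (rule arg_cong[of _ _ exp]) (use Y in \<open>simp add: field_simps\<close>)
        then have 1: "?E * (u m * dual_weight c Y m) = 
           u m * (of_real (exp (- (pi * ((t m)\<^sup>2 - d\<^sup>2)) / Y)) * cis (2 * pi * Re c * t m / Y))"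
          by (simp add: mult_ac)
        show ?thesis
        proof (cases "m \<in> M")
          case True
          then have "(t m)\<^sup>2 = d\<^sup>2" unfolding M t_def by (auto simp: power2_eq_iff abs_if split: if_splits)
          then show ?thesis unfolding 1 using True by (simp add: f_def t_def)
        next
          case False
          then show ?thesis unfolding 1 by (simp add: f_def)
        qed
      qed
      have "summable (\<lambda>n. u (int_decode n) * dual_weight c Y (int_decode n))"
      proof (rule summable_norm_cancel, rule summable_comparison_test)
        show "summable (\<lambda>n. 2 * exp (pi * ((Re c)\<^sup>2 - (Im c - of_int (int_decode n))\<^sup>2) / Y))"
          by (intro summable_mult summable_dual_bound Y)
        show "\<exists>N. \<forall>n\<ge>N. norm (norm (u (int_decode n) * dual_weight c Y (int_decode n)))
           \<le> 2 * exp (pi * ((Re c)\<^sup>2 - (Im c - of_int (int_decode n))\<^sup>2) / Y)"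
        proof (intro exI allI impI)
          fix n
          show "norm (norm (u (int_decode n) * dual_weight c Y (int_decode n)))
           \<le> 2 * exp (pi * ((Re c)\<^sup>2 - (Im c - of_int (int_decode n))\<^sup>2) / Y)"
            unfolding real_norm_def abs_norm_cancel norm_mult norm_dual_weight using bound[of "int_decode n"] by (simp only: abs_mult abs_exp_cancel abs_norm_cancel mult_right_mono exp_ge_zero)
        qed
      qed
      then have s1: "(\<lambda>n. ?E * (u (int_decode n) * dual_weight c Y (int_decode n))) sums
        (?E * dual_sum u c Y)"
        unfolding dual_sum_def by (intro sums_mult summable_sums)
      have mem: "int_decode n \<in> M \<longleftrightarrow> n \<in> int_encode ` M" for n
        by (metis image_iff int_decode_inverse int_encode_inverse)
      have "(\<lambda>n. ?g (int_decode n)) sums (\<Sum>n\<in>int_encode ` M. u (int_decode n) * cis (2 * pi * Re c * (Im c - of_int (int_decode n)) / Y))"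
        unfolding mem by (rule sums_If_finite_set) (use fin in simp)
      then have s2: "(\<lambda>n. ?g (int_decode n)) sums leading_sum u M c Y"
        by (simp add: leading_sum_def sum.reindex[OF inj_int_encode])
      from sums_diff[OF s1 s2] show ?thesis unfolding split by (rule sums_unique[symmetric])
    qed
  qed
qed

section \<open>Asymptotics of the characters\<close>

lemma norm_leading_sum: "norm (leading_sum u M c Y) \<le> (\<Sum>m\<in>M. norm (u m))"
  unfolding leading_sum_def by (rule order_trans[OF norm_sum]) (simp add: norm_mult)

lemma dual_character_dominant:
  fixes r :: int and s :: nat
  assumes p: "p > 0" and d: "d \<ge> 0" and far: "\<And>m. \<not> int p dvd m \<Longrightarrow> d \<le> \<bar>Im c - of_int m\<bar>"
    and M: "M = {m. \<bar>Im c - of_int m\<bar> = d}"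
  defines "u \<equiv> \<lambda>m. weyl_numerator p (unity_root p m) r s"
  shows "((\<lambda>Y. of_real (exp (- (pi * ((Re c)\<^sup>2 - d\<^sup>2)) / Y)) * dual_sum u c Y - leading_sum u M c Y) \<longlongrightarrow> 0) (at_right 0)"
proof (rule dual_sum_dominant[OF _ d _ M])
  show "norm (u m) \<le> 2" for m unfolding u_def by (rule norm_weyl_numerator_root)
  show "d \<le> \<bar>Im c - of_int m\<bar>" if "u m \<noteq> 0" for m
    using that far[of m] weyl_numerator_zero[OF unity_root_nonzero] unity_root_square[OF p] unfolding u_def by blast
qed

text \<open>Left of the imaginary axis, but closer to it than \<open>Im c\<close> is to any integer not divisible by \<open>p\<close>,
  the dual sum tends to \<open>0\<close>. What remains is the half series with negative indices, for which the
  geometric series has ratio \<open>1 / w\<close>. Its value is the analytic continuation of the value for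
  \<open>Re c > 0\<close>.\<close>

lemma character_sum_regular_limit:
  assumes p: "p > 0" and c: "c = x * of_nat (2 * p)" and z: "z = exp (2 * of_real pi * x)"
    and w1: "z powi (- 2 * int p) \<noteq> 1"
    and reg: "Re c \<ge> 0 \<or> (Re c < 0 \<and> - Re c < d \<and> (\<forall>m. \<not> int p dvd m \<longrightarrow> d \<le> \<bar>Im c - of_int m\<bar>))"
  shows "((\<lambda>Y. character_sum p c r s Y) \<longlongrightarrow> weyl_numerator p z r s / (1 - z powi (- 2 * int p))) (at_right 0)"
proof -
  let ?w = "z powi (- 2 * int p)" and ?w' = "exp (- (2 * of_real pi * - c))"
  let ?E = "\<lambda>b. exp (- (2 * of_real pi * c * of_real b))"
  let ?H = "\<lambda>Y. half_theta (- c) Y (1 - b_minus p r s) - half_theta (- c) Y (1 - b_plus p r s)"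
  have w: "exp (- (2 * of_real pi * c)) = ?w"
    unfolding z exp_power_int c by (rule arg_cong[of _ _ exp]) simp
  note E = exp_weyl[OF p, of x, folded c z]
  show ?thesis
  proof (cases "Re c \<ge> 0")
    case True
    have "((\<lambda>Y. character_sum p c r s Y) \<longlongrightarrow> 
       ?E (b_minus p r s) / (1 - exp (- (2 * of_real pi * c))) -
       ?E (b_plus p r s) / (1 - exp (- (2 * of_real pi * c)))) (at_right 0)"
      unfolding character_sum_def by (intro tendsto_diff half_theta_limit True) (use w w1 in simp_all)
    then show ?thesis unfolding E w weyl_numerator_def diff_divide_distrib .
  next
    case False
    then have neg: "Re c < 0" "- Re c < d" and far: "\<And>m. \<not> int p dvd m \<Longrightarrow> d \<le> \<bar>Im c - of_int m\<bar>" using reg by auto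
    define u where "u m = weyl_numerator p (unity_root p m) r s" for m
    define M where "M = {m. \<bar>Im c - of_int m\<bar> = d}"
    define S where "S Y = dual_sum u c Y" for Y
    define F where "F Y = leading_sum u M c Y" for Y
    define e where "e Y = exp (- (pi * ((Re c)\<^sup>2 - d\<^sup>2)) / Y)" for Y
    let ?k = "\<lambda>Y. of_real (inverse (e Y) / sqrt Y) :: complex"
    have "((\<lambda>Y. of_real (e Y) * S Y - F Y) \<longlongrightarrow> 0) (at_right 0)"
      unfolding S_def F_def e_def u_def[abs_def] using neg by (intro dual_character_dominant p far M_def) auto
    moreover have small: "((\<lambda>Y. inverse (e Y) / sqrt Y) \<longlongrightarrow> 0) (at_right 0)"
    proof -
      have "(Re c)\<^sup>2 < d\<^sup>2" using neg by (intro power2_strict_mono) auto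
      then have A: "pi * (d\<^sup>2 - (Re c)\<^sup>2) > 0" by simp
      define A where "A = pi * (d\<^sup>2 - (Re c)\<^sup>2)"
      have "((\<lambda>Y::real. exp (- A / Y) / sqrt Y) \<longlongrightarrow> 0) (at_right 0)" using A unfolding A_def[symmetric] by real_asymp
      moreover have "inverse (e Y) = exp (- A / Y)" for Y
        unfolding e_def A_def exp_minus[symmetric] minus_divide_left by (simp add: right_diff_distrib)
      ultimately show ?thesis by simp
    qed
    ultimately have l1: "((\<lambda>Y. ?k Y * (of_real (e Y) * S Y - F Y)) \<longlongrightarrow> of_real 0 * 0) (at_right 0)"
      by (intro tendsto_intros)
    have l2: "((\<lambda>Y. ?k Y * F Y) \<longlongrightarrow> 0) (at_right 0)"
    proof (rule Lim_null_comparison)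
      show "\<forall>\<^sub>F Y in at_right 0. norm (?k Y * F Y) \<le> \<bar>inverse (e Y) / sqrt Y\<bar> * (\<Sum>m\<in>M. norm (u m))"
      proof (rule always_eventually, rule allI)
        fix Y
        have "norm (F Y) \<le> (\<Sum>m\<in>M. norm (u m))"
          unfolding F_def by (rule norm_leading_sum)
        then show "norm (?k Y * F Y) \<le> \<bar>inverse (e Y) / sqrt Y\<bar> * (\<Sum>m\<in>M. norm (u m))"
          unfolding norm_mult norm_of_real by (intro mult_left_mono) auto
      qed
      show "((\<lambda>Y. \<bar>inverse (e Y) / sqrt Y\<bar> * (\<Sum>m\<in>M. norm (u m))) \<longlongrightarrow> 0) (at_right 0)"
        by (intro tendsto_mult_left_zero tendsto_rabs_zero small)
    qed
    have c': "Re (- c) \<ge> 0" using neg by simp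
    have w': "?w' = inverse (?w)" unfolding w[symmetric] exp_minus[symmetric] by simp
    have w1': "?w' \<noteq> 1" unfolding w' using w1 by (metis inverse_1 inverse_inverse_eq)
    have half: "((\<lambda>Y. half_theta (- c) Y (1 - b)) \<longlongrightarrow> - (?E b / (1 - ?w))) (at_right 0)" for b
    proof -
      have "exp (- (2 * of_real pi * - c * of_real (1 - b))) = ?w' * ?E b"
        unfolding exp_add[symmetric] by (rule arg_cong[of _ _ exp]) (simp add: algebra_simps)
      moreover have "?w \<noteq> 0" using z by simp
      ultimately have "exp (- (2 * of_real pi * - c * of_real (1 - b))) / (1 - ?w') =
        - (?E b / (1 - ?w))"
        unfolding w' using w1 by (simp add: field_simps)
      then show ?thesis using half_theta_limit[OF c' w1', of "1 - b"] by simp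
    qed
    have "((\<lambda>Y. (?k Y * (of_real (e Y) * S Y - F Y) + ?k Y * F Y)
        - (?H Y)) \<longlongrightarrow>
        (of_real 0 * 0 + 0) - (- (?E (b_minus p r s) / (1 - ?w))
          - - (?E (b_plus p r s) / (1 - ?w)))) (at_right 0)"
      by (intro tendsto_diff tendsto_add l1 l2 half)
    also have "(of_real 0 * 0 + 0) - (- (?E (b_minus p r s) / (1 - ?w))
          - - (?E (b_plus p r s) / (1 - ?w)))
       = weyl_numerator p z r s / (1 - ?w)"
      unfolding E weyl_numerator_def diff_divide_distrib by simp
    finally show ?thesis
    proof (rule tendsto_cong_pos)
      fix Y :: real assume Y: "Y > 0"
      show "(?k Y * (of_real (e Y) * S Y - F Y) + ?k Y * F Y)
        - (?H Y) = character_sum p c r s Y"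
      proof -
        have "e Y \<noteq> 0" by (simp add: e_def)
        then have "?k Y * (of_real (e Y) * S Y - F Y) + ?k Y * F Y
          = S Y / of_real (sqrt Y)"
        proof -
          have "?k Y * complex_of_real (e Y) = 1 / of_real (sqrt Y)"
            using \<open>e Y \<noteq> 0\<close> unfolding of_real_mult[symmetric] by simp
          moreover have "k * (E * S Y - F Y) + k * F Y = (k * E) * S Y" for k E
            by (simp add: algebra_simps)
          ultimately show ?thesis by (simp only: times_divide_eq_left mult_1)
        qed
        moreover have "of_real (sqrt Y) * character_sum p c r s Y = S Y
          - of_real (sqrt Y) * (?H Y)"
          unfolding S_def u_def[abs_def] by (rule character_sum_poisson[OF p Y])
        then have "S Y = of_real (sqrt Y) * (character_sum p c r s Y
          + (?H Y))"
          by (simp add: distrib_left)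
        then have "S Y / of_real (sqrt Y) = character_sum p c r s Y
          + (?H Y)"
          using Y by simp
        ultimately show ?thesis by (simp only: add_diff_cancel)
      qed
    qed
  qed
qed

text \<open>The normalising factor that makes the leading terms of the dual expansion have modulus of order
  one. It tends to \<open>0\<close> for \<open>d \<le> - Re c\<close>, so the half series with negative indices becomes negligible.\<close>

definition dominance :: "complex \<Rightarrow> real \<Rightarrow> real \<Rightarrow> complex"
  where "dominance c d Y = of_real (exp (- (pi * ((Re c)\<^sup>2 - d\<^sup>2)) / Y) * sqrt Y)"

lemma dominance_tendsto:
  assumes "d \<ge> 0" "d \<le> - Re c"
  shows "(dominance c d \<longlongrightarrow> 0) (at_right 0)"
proof (rule Lim_null_comparison)
  show "((\<lambda>Y. sqrt Y) \<longlongrightarrow> 0) (at_right 0)"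
    using tendsto_real_sqrt[OF tendsto_ident_at[of 0 "{0<..}"]] by simp
  have "d\<^sup>2 \<le> (- Re c)\<^sup>2" using assms by (intro power_mono) auto
  then have "norm (dominance c d Y) \<le> sqrt Y" if "Y > 0" for Y
    using that by (auto simp: dominance_def norm_mult intro!: mult_left_le_one_le)
  then show "\<forall>\<^sub>F Y in at_right 0. norm (dominance c d Y) \<le> sqrt Y"
    by (intro eventually_at_rightI[of 0 1]) auto
qed

lemma character_sum_dominant:
  assumes p: "p > 0" and neg: "Re c < 0" and d: "d \<ge> 0" "d \<le> - Re c"
    and far: "\<And>m. \<not> int p dvd m \<Longrightarrow> d \<le> \<bar>Im c - of_int m\<bar>"
    and M: "M = {m. \<bar>Im c - of_int m\<bar> = d}"
  shows "((\<lambda>Y. dominance c d Y * character_sum p c r s Y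
     - leading_sum (\<lambda>m. weyl_numerator p (unity_root p m) r s) M c Y) \<longlongrightarrow> 0) (at_right 0)"
proof -
  let ?H = "\<lambda>Y. half_theta (- c) Y (1 - b_minus p r s) - half_theta (- c) Y (1 - b_plus p r s)"
  define u where "u m = weyl_numerator p (unity_root p m) r s" for m
  define S where "S Y = dual_sum u c Y" for Y
  define F where "F Y = leading_sum u M c Y" for Y
  define e where "e Y = exp (- (pi * ((Re c)\<^sup>2 - d\<^sup>2)) / Y)" for Y
  have l1: "((\<lambda>Y. of_real (e Y) * S Y - F Y) \<longlongrightarrow> 0) (at_right 0)"
    unfolding S_def F_def e_def u_def[abs_def] by (intro dual_character_dominant p d far M)
  have c': "Re (- c) \<ge> 0" using neg by simp
  have w1': "exp (- (2 * of_real pi * - c)) \<noteq> 1"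
  proof
    assume "exp (- (2 * of_real pi * - c)) = 1"
    then have "norm (exp (- (2 * of_real pi * - c))) = 1" by simp
    then show False using neg by simp
  qed
  obtain L where L: "((\<lambda>Y. ?H Y) \<longlongrightarrow> L) (at_right 0)"
    using tendsto_diff[OF half_theta_limit[OF c' w1'] half_theta_limit[OF c' w1']] by blast
  have "((\<lambda>Y. (of_real (e Y) * S Y - F Y) - dominance c d Y * 
     (?H Y)) \<longlongrightarrow> 0 - 0 * L) (at_right 0)"
    by (intro tendsto_diff tendsto_mult l1 L dominance_tendsto d)
  then have "((\<lambda>Y. dominance c d Y * character_sum p c r s Y - F Y) \<longlongrightarrow> 0 - 0 * L) (at_right 0)"
  proof (rule tendsto_cong_pos)
    fix Y :: real assume Y: "Y > 0"
    show "(of_real (e Y) * S Y - F Y) - dominance c d Y *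
      (?H Y) = dominance c d Y * character_sum p c r s Y - F Y"
    proof -
      have "of_real (sqrt Y) * character_sum p c r s Y = S Y
          - of_real (sqrt Y) * (?H Y)"
        unfolding S_def u_def[abs_def] by (rule character_sum_poisson[OF p Y])
      then have "of_real (e Y) * (of_real (sqrt Y) * character_sum p c r s Y) = of_real (e Y) * (S Y
          - of_real (sqrt Y) * (?H Y))" by simp
      moreover have "dominance c d Y = of_real (e Y) * of_real (sqrt Y)" by (simp add: dominance_def e_def)
      ultimately show ?thesis by (simp add: algebra_simps)
    qed
  qed
  then show ?thesis by (simp add: F_def u_def[abs_def])
qed

text \<open>At most two integers have the same distance from \<open>Im c\<close>, and then the phases of the two terms
  have opposite frequencies. Functions \<open>exp (i\<theta> / Y)\<close> and \<open>exp (- i\<theta> / Y)\<close> with \<open>\<theta> \<noteq> 0\<close> are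
  linearly independent modulo functions that tend to \<open>0\<close>.\<close>

lemma oscillation_independent:
  assumes r: "Re c \<noteq> 0" and M: "M = {m. \<bar>Im c - of_int m\<bar> = d}" and m0: "m0 \<in> M"
    and lim: "(leading_sum a M c \<longlongrightarrow> 0) (at_right 0)"
  shows "a m0 = 0"
proof -
  have fin: "finite M" unfolding M by (rule finite_ints_at_distance)
  define t where "t = Im c - of_int m0"
  define th where "th = 2 * pi * Re c * t"
  define B where "B = (\<Sum>m\<in>M - {m0}. a m)"
  have other: "Im c - of_int m = - t \<and> t \<noteq> 0" if "m \<in> M - {m0}" for m
  proof -
    have "\<bar>Im c - of_int m\<bar> = \<bar>t\<bar>" "Im c - of_int m \<noteq> t" using m0 that by (auto simp: M t_def)
    then show ?thesis by (auto simp: abs_eq_iff)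
  qed
  have lead: "leading_sum a M c Y = a m0 * cis (th / Y) + B * cis (- (th / Y))" for Y
  proof -
    have "leading_sum a M c Y = a m0 * cis (th / Y) + (\<Sum>m\<in>M - {m0}. a m * cis (2 * pi * Re c * (Im c - of_int m) / Y))"
      using fin m0 by (simp add: leading_sum_def sum.remove th_def t_def)
    also have "(\<Sum>m\<in>M - {m0}. a m * cis (2 * pi * Re c * (Im c - of_int m) / Y)) = B * cis (- (th / Y))"
      unfolding B_def sum_distrib_right using other by (intro sum.cong) (auto simp: th_def)
    finally show ?thesis .
  qed
  have lim': "((\<lambda>Y. a m0 * cis (th / Y) + B * cis (- (th / Y))) \<longlongrightarrow> 0) (at_right 0)"
    by (rule tendsto_cong_pos[OF lim lead])
  show ?thesis
  proof (cases "t = 0")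
    case True
    then have "M - {m0} = {}" using other by blast
    then have "B = 0" unfolding B_def by (simp only: sum.empty)
    then have "((\<lambda>Y::real. a m0) \<longlongrightarrow> 0) (at_right 0)" using lim' True by (simp add: th_def)
    then show ?thesis by (simp add: tendsto_const_iff)
  next
    case False
    then have th: "\<bar>th\<bar> > 0" using r by (simp add: th_def)
    \<comment> \<open>along this sequence the square of the phase alternates between \<open>1\<close> and \<open>-1\<close>\<close>
    define y where "y n = 2 * \<bar>th\<bar> / (pi * real (Suc n))" for n
    have "y \<longlonglongrightarrow> 0" unfolding y_def
      using tendsto_mult_right_zero[OF LIMSEQ_inverse_real_of_nat, of "2 * \<bar>th\<bar> / pi"] by (simp add: field_simps)
    moreover have "y n > 0" for n using th by (simp add: y_def)
    ultimately have y: "filterlim y (at_right 0) sequentially"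
      by (intro tendsto_imp_filterlim_at_right always_eventually) auto
    define sg where "sg n = th / y n" for n
    have sq: "cis (- (2 * sg n)) = (-1) ^ Suc n" for n
    proof -
      have "2 * sg n = sgn th * (pi * real (Suc n))"
        using th by (simp add: sg_def y_def field_simps sgn_if abs_if split: if_splits)
      then show ?thesis using th by (cases "th > 0") (auto simp: sgn_if complex_eq_iff cos_npi sin_npi mult.commute simp del: of_nat_Suc)
    qed
    have "(\<lambda>n. cis (- sg n) * (a m0 * cis (sg n) + B * cis (- sg n))) \<longlonglongrightarrow> 0"
    proof (rule Lim_null_comparison[OF always_eventually])
      have "(\<lambda>n. a m0 * cis (sg n) + B * cis (- sg n)) \<longlonglongrightarrow> 0"
        unfolding sg_def using filterlim_compose[OF lim' y] by simp
      then show "(\<lambda>n. norm (a m0 * cis (sg n) + B * cis (- sg n))) \<longlonglongrightarrow> 0" by (rule tendsto_norm_zero)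
    qed (simp add: norm_mult)
    moreover have "cis (- sg n) * (a m0 * cis (sg n) + B * cis (- sg n)) = a m0 + B * (-1) ^ Suc n" for n
    proof -
      have "cis (- sg n) * cis (sg n) = 1" "cis (- sg n) * cis (- sg n) = (-1) ^ Suc n"
        using sq[of n] by (simp_all add: cis_mult del: power_Suc)
      moreover have "cis (- sg n) * (a m0 * cis (sg n) + B * cis (- sg n)) = a m0 * (cis (- sg n) * cis (sg n)) + B * (cis (- sg n) * cis (- sg n))"
        by (simp add: algebra_simps)
      ultimately show ?thesis by simp
    qed
    ultimately have u: "(\<lambda>n. a m0 + B * (-1) ^ Suc n) \<longlonglongrightarrow> 0" by simp
    \<comment> \<open>adding two consecutive members eliminates \<open>B\<close>\<close>
    from tendsto_add[OF u LIMSEQ_Suc[OF u]] have "(\<lambda>n::nat. 2 * a m0) \<longlonglongrightarrow> 0" by simp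
    then show ?thesis by (simp add: LIMSEQ_const_iff)
  qed
qed

section \<open>Quantum dimensions as limits\<close>

text \<open>The quantum integer \<open>(z\<^sup>t - z\<^sup>-\<^sup>t) / (z - z\<^sup>-\<^sup>1)\<close>, extended continuously to \<open>z = \<plusminus>1\<close>. Those two values
  occur at the points \<open>\<epsilon> = i n / \<surd>(2p)\<close> with \<open>p\<close> dividing \<open>n\<close>.\<close>

definition qnum :: "complex \<Rightarrow> int \<Rightarrow> complex"
  where "qnum z t = (if z\<^sup>2 = 1 then of_int t * z powi (t - 1) else (z powi t - z powi (- t)) / (z - inverse z))"

lemma z_minus_inverse: "z \<noteq> 0 \<Longrightarrow> (z - inverse z = 0) = (z\<^sup>2 = 1)" for z :: complex
  by (auto simp: field_simps power2_eq_square)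

text \<open>The vacuum numerator is \<open>z\<^sup>-\<^sup>p (z - z\<^sup>-\<^sup>1)\<close>; dividing by it leaves a quantum integer. The last claim
  turns the denominator of the geometric series for the vacuum into the factor \<open>[p]\<close> of the Fock
  modules.\<close>

lemma weyl_numerator_factor:
  assumes "z \<noteq> 0" "z\<^sup>2 \<noteq> 1"
  shows "weyl_numerator p z r s = z powi (int p * (r - 1)) * qnum z (int s) * weyl_numerator p z 1 1"
    and "weyl_numerator p z 1 1 \<noteq> 0"
    and "1 - z powi (- 2 * int p) = qnum z (int p) * weyl_numerator p z 1 1"
proof -
  have nz: "z - inverse z \<noteq> 0" using z_minus_inverse assms by blast
  have gen: "weyl_numerator p z r s = z powi (int p * (r - 1)) * z powi (- int p) * (z powi int s - z powi (- int s))" for r s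
  proof -
    have "int s - int p * (2 - r) = int p * (r - 1) + (- int p) + int s" "- int s - int p * (2 - r) = int p * (r - 1) + (- int p) + (- int s)"
      by (simp_all add: algebra_simps)
    then show ?thesis unfolding weyl_numerator_def using assms(1)
      by (simp only: power_int_add simp_thms) (simp only: right_diff_distrib)
  qed
  have one: "weyl_numerator p z 1 1 = z powi (- int p) * (z - inverse z)"
    unfolding gen by (simp add: power_int_minus)
  have q: "qnum z t * (z - inverse z) = z powi t - z powi (- t)" for t
    using assms nz by (simp add: qnum_def)
  show "weyl_numerator p z 1 1 \<noteq> 0" unfolding one using nz assms by simp
  show "weyl_numerator p z r s = z powi (int p * (r - 1)) * qnum z (int s) * weyl_numerator p z 1 1"
    unfolding one gen[of r s] q[symmetric] by (simp only: mult_ac)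
  have "qnum z (int p) * weyl_numerator p z 1 1 = z powi (- int p) * (qnum z (int p) * (z - inverse z))"
    unfolding one by (simp only: mult_ac)
  also have "\<dots> = z powi (- int p + int p) - z powi (- int p + - int p)"
    unfolding q using assms(1) by (simp only: power_int_add simp_thms right_diff_distrib)
  finally show "1 - z powi (- 2 * int p) = qnum z (int p) * weyl_numerator p z 1 1" by simp
qed

text \<open>No factor of the convergent product vanishes, as \<open>\<bar>q\<bar> < 1\<close>. So the eta function cancels in
  quotients of characters.\<close>

lemma dedekind_eta_nonzero:
  assumes "y > 0"
  shows "dedekind_eta (\<i> * of_real y) \<noteq> 0"
proof -
  define x where "x = complex_of_real (exp (- (2 * pi * y)))"
  have x: "norm x < 1" using assms by (simp add: x_def)
  have q: "qpow (\<i> * of_real y) (of_nat (Suc n)) = x ^ Suc n" for n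
    unfolding qpow_def x_def exp_of_real[symmetric] exp_of_nat_mult[symmetric]
    by (rule arg_cong[of _ _ exp]) (simp add: algebra_simps)
  have "summable (\<lambda>n. norm (1 - x ^ Suc n - 1))"
    using summable_mult[OF summable_geometric[of "norm x"], of "norm x"] x by (simp add: norm_mult norm_power)
  then have "convergent_prod (\<lambda>n. 1 - x ^ Suc n)"
    by (intro abs_convergent_prod_imp_convergent_prod summable_imp_abs_convergent_prod)
  moreover have "1 - x ^ Suc n \<noteq> 0" for n
  proof
    assume "1 - x ^ Suc n = 0"
    then have "norm (x ^ Suc n) = 1" by (metis eq_iff_diff_eq_0 norm_one)
    moreover have "norm (x ^ Suc n) < 1" unfolding norm_power using x by (intro power_Suc_less_one) (auto simp: x_def)
    ultimately show False by simp
  qed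
  ultimately have "prodinf (\<lambda>n. 1 - x ^ Suc n) \<noteq> 0" by (intro prodinf_nonzero) auto
  then show ?thesis unfolding dedekind_eta_def q by (simp add: qpow_def)
qed

definition scaled :: "nat \<Rightarrow> complex \<Rightarrow> complex"
  where "scaled p \<epsilon> = \<epsilon> * of_real (sqrt (2 * real p))"

lemma false_theta_term_gauss:
  "false_theta_term p \<epsilon> (\<i> * of_real y) u = gauss (scaled p \<epsilon>) (2 * real p * y) u"
proof -
  have e: "2 * of_real pi * \<i> * (\<i> * of_real y) * of_real (real p * u\<^sup>2) = - complex_of_real (pi * (2 * real p * y) * u\<^sup>2)"
    by (simp add: complex_eq_iff)
  show ?thesis
    unfolding false_theta_term_def qpow_def gauss_def scaled_def exp_add[symmetric] e
    by (rule arg_cong[of _ _ exp]) (simp add: mult.assoc)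
qed

lemma reg_character_Irr:
  assumes "p > 0" "y > 0"
  shows "reg_character p \<epsilon> (Irr r s) (\<i> * of_real y) =
    character_sum p (scaled p \<epsilon>) r s (2 * real p * y) / dedekind_eta (\<i> * of_real y)"
proof -
  have Y: "2 * real p * y > 0" using assms by simp
  have "u_minus p r s k = real k + b_minus p r s" "u_plus p r s k = real k + b_plus p r s" for k
    by (simp_all add: u_minus_def u_plus_def b_minus_def b_plus_def)
  then show ?thesis
    by (simp add: false_theta_term_gauss character_sum_def half_theta_def suminf_diff[OF summable_gauss[OF Y] summable_gauss[OF Y]])
qed

definition fock_weight :: "nat \<Rightarrow> complex \<Rightarrow> complex \<Rightarrow> complex"
  where "fock_weight p \<epsilon> \<nu> = exp (2 * of_real pi * \<epsilon> * (\<nu> - of_real (alpha0 p / 2)))"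

definition fock_numerator :: "nat \<Rightarrow> complex \<Rightarrow> complex \<Rightarrow> real \<Rightarrow> complex"
  where "fock_numerator p \<epsilon> \<nu> y = fock_weight p \<epsilon> \<nu> * qpow (\<i> * of_real y) ((\<nu> - of_real (alpha0 p / 2))\<^sup>2 / 2)"

lemma fock_numerator_tendsto: "(fock_numerator p \<epsilon> \<nu> \<longlongrightarrow> fock_weight p \<epsilon> \<nu>) (at_right 0)"
proof -
  have "(fock_numerator p \<epsilon> \<nu> \<longlongrightarrow> fock_weight p \<epsilon> \<nu> * exp (2 * of_real pi * \<i> * (\<i> * of_real 0) * ((\<nu> - of_real (alpha0 p / 2))\<^sup>2 / 2))) (at_right 0)"
    unfolding fock_numerator_def qpow_def by (intro tendsto_intros)
  then show ?thesis by simp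
qed

lemma character_quotient_eq:
  assumes "p > 0" "y > 0"
  shows "character_quotient p (Irr r s) \<epsilon> y = character_sum p (scaled p \<epsilon>) r s (2 * real p * y) / character_sum p (scaled p \<epsilon>) 1 1 (2 * real p * y)"
    and "character_quotient p (Fock \<nu>) \<epsilon> y = fock_numerator p \<epsilon> \<nu> y / character_sum p (scaled p \<epsilon>) 1 1 (2 * real p * y)"
  using dedekind_eta_nonzero[OF assms(2)] unfolding character_quotient_def reg_character_Irr[OF assms]
  by (simp_all add: fock_numerator_def fock_weight_def)

lemma filterlim_scale:
  assumes "p > 0"
  shows "filterlim (\<lambda>y. 2 * real p * y) (at_right 0) (at_right 0)"
proof (rule tendsto_imp_filterlim_at_right)
  show "((\<lambda>y. 2 * real p * y) \<longlongrightarrow> 0) (at_right 0)" by (intro tendsto_mult_right_zero tendsto_ident_at)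
  show "\<forall>\<^sub>F y in at_right 0. 2 * real p * y > 0"
    using assms by (intro eventually_at_rightI[of 0 1]) auto
qed

lemma qdim_eqI: "(character_quotient p X \<epsilon> \<longlongrightarrow> l) (at_right 0) \<Longrightarrow> qdim p X \<epsilon> = l"
  unfolding qdim_def by (rule tendsto_Lim) simp_all

text \<open>All characters are multiplied by the same factor \<open>N\<close>, chosen such that the normalised characters
  of the \<open>M\<^bsub>r,s\<^esub>\<close> converge and the vacuum does not tend to \<open>0\<close>. The normalised Fock characters then
  converge to the weight times \<open>lim N\<close>.\<close>

lemma qdim_of_normalised:
  assumes p: "p > 0"
    and A: "\<And>r s. ((\<lambda>Y. N Y * character_sum p (scaled p \<epsilon>) r s Y) \<longlongrightarrow> A r s) (at_right 0)"
    and N: "(N \<longlongrightarrow> b) (at_right 0)" and A11: "A 1 1 \<noteq> 0"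
  shows "\<epsilon> \<in> qdim_domain p" "qdim p (Irr r s) \<epsilon> = A r s / A 1 1"
    "qdim p (Fock \<nu>) \<epsilon> = fock_weight p \<epsilon> \<nu> * b / A 1 1"
proof -
  let ?c = "scaled p \<epsilon>"
  note f = filterlim_scale[OF p]
  have A': "((\<lambda>y. N (2 * real p * y) * character_sum p ?c r s (2 * real p * y)) \<longlongrightarrow> A r s) (at_right 0)" for r s
    using filterlim_compose[OF A f] .
  have N': "((\<lambda>y. N (2 * real p * y)) \<longlongrightarrow> b) (at_right 0)"
    using filterlim_compose[OF N f] .
  have ev: "\<forall>\<^sub>F y in at_right 0. y > 0 \<and> N (2 * real p * y) * character_sum p ?c 1 1 (2 * real p * y) \<noteq> 0"
    using eventually_at_right_less tendsto_imp_eventually_ne[OF A' A11] by (rule eventually_conj)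
  have irr: "(character_quotient p (Irr r s) \<epsilon> \<longlongrightarrow> A r s / A 1 1) (at_right 0)" for r s
    by (rule Lim_transform_eventually[OF tendsto_divide[OF A'[of r s] A'[of 1 1] A11]], rule eventually_mono[OF ev])
       (simp add: character_quotient_eq[OF p])
  have fock: "(character_quotient p (Fock \<nu>) \<epsilon> \<longlongrightarrow> fock_weight p \<epsilon> \<nu> * b / A 1 1) (at_right 0)" for \<nu>
    by (rule Lim_transform_eventually[OF tendsto_divide[OF tendsto_mult[OF fock_numerator_tendsto N'] A'[of 1 1] A11]], rule eventually_mono[OF ev])
       (simp add: character_quotient_eq[OF p])
  show "qdim p (Irr r s) \<epsilon> = A r s / A 1 1" "qdim p (Fock \<nu>) \<epsilon> = fock_weight p \<epsilon> \<nu> * b / A 1 1"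
    using irr fock by (auto intro: qdim_eqI)
  have "\<forall>\<^sub>F y in at_right 0. reg_character p \<epsilon> vacuum (\<i> * of_real y) \<noteq> 0"
    by (rule eventually_mono[OF ev]) (auto simp: reg_character_Irr[OF p] dedekind_eta_nonzero simp del: reg_character.simps)
  then show "\<epsilon> \<in> qdim_domain p"
    using irr fock unfolding qdim_domain_def singlet_modules_def by auto
qed

text \<open>If the minimum in \<open>B_bound\<close> is attained twice, the normalised characters oscillate and have no
  limits. But if a quotient \<open>W / V\<close> has a limit \<open>l\<close>, then \<open>W - l V\<close> tends to \<open>0\<close>, and independence
  of the oscillations gives \<open>l\<close> as the quotient of the coefficients at each minimising index.\<close>

lemma qdim_of_dominant:
  assumes p: "p > 0" and dom: "\<epsilon> \<in> qdim_domain p" and neg: "Re (scaled p \<epsilon>) < 0" and d: "d \<ge> 0" "d \<le> - Re (scaled p \<epsilon>)"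
    and far: "\<And>m. \<not> int p dvd m \<Longrightarrow> d \<le> \<bar>Im (scaled p \<epsilon>) - of_int m\<bar>"
    and m0: "\<not> int p dvd m0" "\<bar>Im (scaled p \<epsilon>) - of_int m0\<bar> = d"
  shows "1 \<le> s \<Longrightarrow> s \<le> p \<Longrightarrow> qdim p (Irr r s) \<epsilon> = weyl_numerator p (unity_root p m0) r s / weyl_numerator p (unity_root p m0) 1 1"
    and "qdim p (Fock \<nu>) \<epsilon> = 0"
proof -
  let ?c = "scaled p \<epsilon>"
  define M where "M = {m. \<bar>Im ?c - of_int m\<bar> = d}"
  define F where "F u = leading_sum u M ?c" for u
  define u1 where "u1 m = weyl_numerator p (unity_root p m) 1 1" for m
  define N where "N y = dominance ?c d (2 * real p * y)" for y
  define V where "V y = character_sum p ?c 1 1 (2 * real p * y)" for y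
  note f = filterlim_scale[OF p]
  note asy = character_sum_dominant[OF p neg d far M_def]
  have V: "((\<lambda>y. N y * V y - F u1 (2 * real p * y)) \<longlongrightarrow> 0) (at_right 0)"
    using filterlim_compose[OF asy[of 1 1] f] by (simp add: N_def V_def F_def u1_def[abs_def])
  have V0: "\<forall>\<^sub>F y in at_right 0. V y \<noteq> 0"
  proof -
    have "\<forall>\<^sub>F y::real in at_right 0. y > 0" by (rule eventually_at_right_less)
    moreover have "\<forall>\<^sub>F y in at_right 0. reg_character p \<epsilon> vacuum (\<i> * of_real y) \<noteq> 0"
      using dom by (simp add: qdim_domain_def del: reg_character.simps)
    ultimately show ?thesis
      by eventually_elim (auto simp: V_def reg_character_Irr[OF p] simp del: reg_character.simps)
  qed
  have u10: "u1 m0 \<noteq> 0"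
    unfolding u1_def using m0(1) unity_root_square[OF p] by (intro weyl_numerator_factor(2)) auto
  have key: "qdim p X \<epsilon> = u m0 / u1 m0" if X: "X \<in> singlet_modules p"
    and quot: "\<And>y. y > 0 \<Longrightarrow> character_quotient p X \<epsilon> y = W y / V y"
    and W: "((\<lambda>y. N y * W y - F u (2 * real p * y)) \<longlongrightarrow> 0) (at_right 0)" for X W u
  proof -
    obtain l where l: "(character_quotient p X \<epsilon> \<longlongrightarrow> l) (at_right 0)"
      using dom X unfolding qdim_domain_def by blast
    define Q where "Q = character_quotient p X \<epsilon>"
    have Q0: "((\<lambda>y. Q y - l) \<longlongrightarrow> 0) (at_right 0)" using l unfolding Q_def by (rule LIM_zero)
    have b: "((\<lambda>y. (Q y - l) * F u1 (2 * real p * y)) \<longlongrightarrow> 0) (at_right 0)"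
    proof (rule Lim_null_comparison[OF always_eventually])
      show "\<forall>y. norm ((Q y - l) * F u1 (2 * real p * y)) \<le> norm (Q y - l) * (\<Sum>m\<in>M. norm (u1 m))"
        unfolding norm_mult F_def by (intro allI mult_left_mono norm_leading_sum) auto
      show "((\<lambda>y. norm (Q y - l) * (\<Sum>m\<in>M. norm (u1 m))) \<longlongrightarrow> 0) (at_right 0)"
        by (intro tendsto_mult_left_zero tendsto_norm_zero Q0)
    qed
    have "((\<lambda>y. (Q y - l) * F u1 (2 * real p * y) + Q y * (N y * V y - F u1 (2 * real p * y)) - (N y * W y - F u (2 * real p * y)))
      \<longlongrightarrow> 0 + l * 0 - 0) (at_right 0)"
      by (intro tendsto_diff tendsto_add tendsto_mult b V W l[folded Q_def])
    then have "((\<lambda>y. F (\<lambda>m. u m - l * u1 m) (2 * real p * y)) \<longlongrightarrow> 0 + l * 0 - 0) (at_right 0)"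
    proof (rule Lim_transform_eventually)
      have "\<forall>\<^sub>F y::real in at_right 0. y > 0" by (rule eventually_at_right_less)
      then show "\<forall>\<^sub>F y in at_right 0. (Q y - l) * F u1 (2 * real p * y) + Q y * (N y * V y - F u1 (2 * real p * y)) - (N y * W y - F u (2 * real p * y))
         = F (\<lambda>m. u m - l * u1 m) (2 * real p * y)"
        using V0
      proof eventually_elim
        case (elim y)
        have "W y = Q y * V y" using quot[OF elim(1)] elim(2) by (simp add: Q_def)
        moreover have "F (\<lambda>m. u m - l * u1 m) (2 * real p * y) = F u (2 * real p * y) - l * F u1 (2 * real p * y)"
          by (simp add: F_def leading_sum_def left_diff_distrib sum_subtractf sum_distrib_left mult.assoc)
        ultimately show ?case by (simp add: algebra_simps)
      qed
    qed
    then have lim: "((\<lambda>y. F (\<lambda>m. u m - l * u1 m) (2 * real p * y)) \<longlongrightarrow> 0) (at_right 0)" by simp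
    \<comment> \<open>return from \<open>y\<close> to the variable \<open>Y = 2 p y\<close>\<close>
    have "filterlim (\<lambda>Y. Y / (2 * real p)) (at_right 0) (at_right 0)"
    proof (rule tendsto_imp_filterlim_at_right)
      show "((\<lambda>Y. Y / (2 * real p)) \<longlongrightarrow> 0) (at_right 0)" by (intro tendsto_divide_zero tendsto_ident_at)
      show "\<forall>\<^sub>F Y in at_right 0. Y / (2 * real p) > 0"
        using p by (intro eventually_at_rightI[of 0 1]) auto
    qed
    from filterlim_compose[OF lim this] have "((\<lambda>Y. F (\<lambda>m. u m - l * u1 m) Y) \<longlongrightarrow> 0) (at_right 0)" using p by simp
    then have "u m0 - l * u1 m0 = 0"
      unfolding F_def by (intro oscillation_independent[OF _ M_def]) (use neg m0 in \<open>auto simp: M_def\<close>)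
    then show ?thesis using u10 qdim_eqI[OF l] by (simp add: field_simps)
  qed
  show "qdim p (Irr r s) \<epsilon> = weyl_numerator p (unity_root p m0) r s / weyl_numerator p (unity_root p m0) 1 1" if "1 \<le> s" "s \<le> p"
    unfolding u1_def[symmetric]
  proof (rule key)
    show "((\<lambda>y. N y * character_sum p ?c r s (2 * real p * y) - F (\<lambda>m. weyl_numerator p (unity_root p m) r s) (2 * real p * y)) \<longlongrightarrow> 0) (at_right 0)"
      using filterlim_compose[OF asy[of r s] f] by (simp add: N_def F_def)
  qed (use that p in \<open>auto simp: V_def character_quotient_eq singlet_modules_def\<close>)
  have "qdim p (Fock \<nu>) \<epsilon> = 0 / u1 m0"
  proof (rule key[of _ "fock_numerator p \<epsilon> \<nu>" "\<lambda>_. 0"])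
    have "((\<lambda>y. N y * fock_numerator p \<epsilon> \<nu> y) \<longlongrightarrow> 0 * fock_weight p \<epsilon> \<nu>) (at_right 0)"
      unfolding N_def by (intro tendsto_mult fock_numerator_tendsto filterlim_compose[OF dominance_tendsto[OF d] f])
    then show "((\<lambda>y. N y * fock_numerator p \<epsilon> \<nu> y - F (\<lambda>_. 0) (2 * real p * y)) \<longlongrightarrow> 0) (at_right 0)"
      by (simp add: F_def leading_sum_def)
  qed (use p in \<open>auto simp: V_def character_quotient_eq singlet_modules_def\<close>)
  then show "qdim p (Fock \<nu>) \<epsilon> = 0" by simp
qed

section \<open>The value of all quantum dimensions at one point\<close>

definition irr_values :: "nat \<Rightarrow> complex \<Rightarrow> complex \<Rightarrow> bool"
  where "irr_values p \<epsilon> z \<longleftrightarrow>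
    (\<forall>r s. 1 \<le> s \<longrightarrow> s \<le> p \<longrightarrow> qdim p (Irr r s) \<epsilon> = z powi (int p * (r - 1)) * qnum z (int s))"

definition nome :: "nat \<Rightarrow> complex \<Rightarrow> complex"
  where "nome p \<epsilon> = exp (2 * of_real pi * (\<epsilon> / of_real (sqrt (2 * real p))))"

text \<open>The value of all quantum dimensions at \<open>\<epsilon>\<close> is governed by one number \<open>z\<close>. The two alternatives
  have in common what the ring structure needs: a Fock value absorbs powers of \<open>z\<close> into its
  label, either because multiplication by \<open>z\<close> is a shift of that label or because all Fock values
  vanish.\<close>

definition fusion_point :: "nat \<Rightarrow> complex \<Rightarrow> complex \<Rightarrow> bool"
  where "fusion_point p \<epsilon> z \<longleftrightarrow> z \<noteq> 0 \<and> irr_values p \<epsilon> z \<and>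
    (z = nome p \<epsilon> \<and> (\<forall>\<nu>. qdim p (Fock \<nu>) \<epsilon> = fock_weight p \<epsilon> \<nu> * qnum z (int p))
     \<or> qnum z (int p) = 0 \<and> (\<forall>\<nu>. qdim p (Fock \<nu>) \<epsilon> = 0))"

lemma scaled_eq:
  assumes "p > 0"
  shows "scaled p \<epsilon> = \<epsilon> / of_real (sqrt (2 * real p)) * of_nat (2 * p)"
proof -
  have "complex_of_real (sqrt (2 * real p)) * of_real (sqrt (2 * real p)) = of_nat (2 * p)"
    unfolding of_real_mult[symmetric] by simp
  moreover have "complex_of_real (sqrt (2 * real p)) \<noteq> 0" using assms by simp
  ultimately show ?thesis by (simp add: scaled_def field_simps)
qed

lemma qnum_p_zero:
  assumes "z \<noteq> 0" "z\<^sup>2 \<noteq> 1" "z powi (- 2 * int p) = 1"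
  shows "qnum z (int p) = 0"
  using weyl_numerator_factor(2)[OF assms(1,2), of p] weyl_numerator_factor(3)[OF assms(1,2), of p] assms(3) by simp

lemma fusion_point_of_regular:
  assumes p: "p > 0" and z: "z = nome p \<epsilon>" 
    and w1: "z powi (- 2 * int p) \<noteq> 1"
    and reg: "Re (scaled p \<epsilon>) \<ge> 0 \<or> (Re (scaled p \<epsilon>) < 0 \<and> - Re (scaled p \<epsilon>) < d \<and> (\<forall>m. \<not> int p dvd m \<longrightarrow> d \<le> \<bar>Im (scaled p \<epsilon>) - of_int m\<bar>))"
  shows "fusion_point p \<epsilon> z"
proof -
  have z0: "z \<noteq> 0" by (simp add: z nome_def)
  have z2: "z\<^sup>2 \<noteq> 1"
  proof
    assume "z\<^sup>2 = 1"
    then have "z powi 2 = 1" by simp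
    then have "(z powi 2) powi (- int p) = 1" by simp
    then have "z powi (2 * (- int p)) = 1" unfolding power_int_mult .
    then show False using w1 by simp
  qed
  note W = weyl_numerator_factor[OF z0 z2]
  define A where "A r s = weyl_numerator p z r s / (1 - z powi (- 2 * int p))" for r s
  have "((\<lambda>Y. 1 * character_sum p (scaled p \<epsilon>) r s Y) \<longlongrightarrow> A r s) (at_right 0)" for r s
    using character_sum_regular_limit[OF p scaled_eq[OF p] z[unfolded nome_def] w1 reg] by (simp add: A_def)
  moreover have "((\<lambda>Y::real. 1) \<longlongrightarrow> (1::complex)) (at_right 0)" by simp
  moreover have "A 1 1 \<noteq> 0" using W(2) w1 by (simp add: A_def)
  ultimately have Q: "qdim p (Irr r s) \<epsilon> = A r s / A 1 1" "qdim p (Fock \<nu>) \<epsilon> = fock_weight p \<epsilon> \<nu> * 1 / A 1 1" for r s \<nu>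
    by (rule qdim_of_normalised(2,3)[OF p])+
  have "A r s / A 1 1 = weyl_numerator p z r s / weyl_numerator p z 1 1" for r s
    using w1 by (simp add: A_def)
  then have "A r s / A 1 1 = z powi (int p * (r - 1)) * qnum z (int s)" for r s
    using W(1)[of p r s] W(2)[of p] by simp
  moreover have "fock_weight p \<epsilon> \<nu> * 1 / A 1 1 = fock_weight p \<epsilon> \<nu> * qnum z (int p)" for \<nu>
    unfolding A_def W(3)[of p] using W(2)[of p] by simp
  ultimately show ?thesis unfolding fusion_point_def irr_values_def Q using z z0 by metis
qed

text \<open>The points \<open>\<epsilon> = i n / \<surd>(2p)\<close>. If \<open>p\<close> does not divide \<open>n\<close>, the two half series of a character
  diverge with different phases, and the difference of the phases survives after normalisation.
  Otherwise the phases agree, the divergence cancels, and the difference of the shifts, \<open>s / p\<close>,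
  remains.\<close>

lemma fusion_point_of_resonant:
  assumes p: "p > 0" and z: "z = nome p \<epsilon>" 
    and w1: "z powi (- 2 * int p) = 1"
  shows "fusion_point p \<epsilon> z"
proof -
  have z0: "z \<noteq> 0" by (simp add: z nome_def)
  let ?c = "scaled p \<epsilon>"
  have w: "exp (- (2 * of_real pi * ?c)) = 1"
    unfolding w1[symmetric] z nome_def exp_power_int scaled_eq[OF p] by (rule arg_cong[of _ _ exp]) simp
  obtain U where U: "\<And>Y b. Y > 0 \<Longrightarrow> half_theta ?c Y b = exp (- (2 * of_real pi * ?c * of_real b)) * of_real (U b Y)"
    and top: "\<And>b. filterlim (U b) at_top (at_right 0)"
    and diff: "\<And>b b'. ((\<lambda>Y. U b Y - U b' Y) \<longlongrightarrow> b' - b) (at_right 0)"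
    using half_theta_resonant[OF w] by blast
  note E = exp_weyl[OF p, of "\<epsilon> / of_real (sqrt (2 * real p))", folded scaled_eq[OF p] nome_def z]
  define e1 where "e1 r s = z powi (int s - int p * (2 - r))" for r s
  define e2 where "e2 r s = z powi (- int s - int p * (2 - r))" for r s
  have cs: "character_sum p ?c r s Y = e1 r s * of_real (U (b_minus p r s) Y) - e2 r s * of_real (U (b_plus p r s) Y)" if "Y > 0" for Y r s
    unfolding character_sum_def U[OF that] E e1_def e2_def ..
  show ?thesis
  proof (cases "z\<^sup>2 = 1")
    case False
    note W = weyl_numerator_factor[OF z0 False]
    \<comment> \<open>normalise by one of the divergent series\<close>
    have inv: "((\<lambda>Y. inverse (U 0 Y)) \<longlongrightarrow> 0) (at_right 0)"
      by (rule filterlim_compose[OF tendsto_inverse_0_at_top top]) (rule filterlim_ident)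
    have ratio: "((\<lambda>Y. inverse (U 0 Y) * U b Y) \<longlongrightarrow> 1) (at_right 0)" for b
    proof -
      have "((\<lambda>Y. inverse (U 0 Y) * (U b Y - U 0 Y) + 1) \<longlongrightarrow> 0 * (0 - b) + 1) (at_right 0)"
        by (intro tendsto_intros inv diff)
      then have "((\<lambda>Y. inverse (U 0 Y) * U b Y) \<longlongrightarrow> 0 * (0 - b) + 1) (at_right 0)"
      proof (rule Lim_transform_eventually)
        have "\<forall>\<^sub>F Y in at_right 0. U 0 Y > 0" using top[of 0] unfolding filterlim_at_top_dense by blast
        then show "\<forall>\<^sub>F Y in at_right 0. inverse (U 0 Y) * (U b Y - U 0 Y) + 1 = inverse (U 0 Y) * U b Y"
          by eventually_elim (simp add: field_simps)
      qed
      then show ?thesis by simp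
    qed
    have A: "((\<lambda>Y. of_real (inverse (U 0 Y)) * character_sum p ?c r s Y) \<longlongrightarrow> weyl_numerator p z r s) (at_right 0)" for r s
    proof -
      have "((\<lambda>Y. e1 r s * of_real (inverse (U 0 Y) * U (b_minus p r s) Y) - e2 r s * of_real (inverse (U 0 Y) * U (b_plus p r s) Y))
        \<longlongrightarrow> e1 r s * of_real 1 - e2 r s * of_real 1) (at_right 0)"
        by (intro tendsto_intros ratio)
      then have "((\<lambda>Y. of_real (inverse (U 0 Y)) * character_sum p ?c r s Y) \<longlongrightarrow> e1 r s * of_real 1 - e2 r s * of_real 1) (at_right 0)"
        by (rule tendsto_cong_pos) (auto simp: cs algebra_simps)
      then show ?thesis by (simp add: weyl_numerator_def e1_def e2_def)
    qed
    have "((\<lambda>Y. of_real (inverse (U 0 Y))) \<longlongrightarrow> complex_of_real 0) (at_right 0)"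
      by (intro tendsto_of_real inv)
    note Q = qdim_of_normalised(2,3)[OF p A this W(2)]
    have "weyl_numerator p z r s / weyl_numerator p z 1 1 = z powi (int p * (r - 1)) * qnum z (int s)" for r s
      using W(1)[of p r s] W(2)[of p] by simp
    then show ?thesis unfolding fusion_point_def irr_values_def Q using z0 qnum_p_zero[OF z0 False w1] by simp
  next
    case True
    have e12: "e1 r s = e2 r s" for r s
      using weyl_numerator_zero[OF z0 True, of p r s] by (simp add: weyl_numerator_def e1_def e2_def)
    define A where "A r s = e2 r s * of_real (b_plus p r s - b_minus p r s)" for r s
    have A_eq: "A r s = z powi (- int s - int p * (2 - r)) * (of_nat s / of_nat p)" for r s
      using p by (simp add: A_def e2_def b_plus_def b_minus_def field_simps)
    have "((\<lambda>Y. 1 * character_sum p ?c r s Y) \<longlongrightarrow> A r s) (at_right 0)" for r s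
    proof -
      have "((\<lambda>Y. e2 r s * of_real (U (b_minus p r s) Y - U (b_plus p r s) Y)) \<longlongrightarrow> A r s) (at_right 0)"
        unfolding A_def by (intro tendsto_intros diff)
      then show ?thesis
        by (rule tendsto_cong_pos) (auto simp: cs e12 algebra_simps)
    qed
    moreover have "((\<lambda>Y::real. 1) \<longlongrightarrow> (1::complex)) (at_right 0)" by simp
    moreover have "A 1 1 \<noteq> 0" unfolding A_eq using p z0 by simp
    ultimately have Q: "qdim p (Irr r s) \<epsilon> = A r s / A 1 1" "qdim p (Fock \<nu>) \<epsilon> = fock_weight p \<epsilon> \<nu> * 1 / A 1 1" for r s \<nu>
      by (rule qdim_of_normalised(2,3)[OF p])+
    have even: "z powi (2 * n) = 1" for n using True by (simp add: power_int_mult)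
    have shift: "z powi a = z powi b" if "a = b + 2 * n" for a b n
      using even[of n] z0 by (simp add: that power_int_add)
    have "A r s / A 1 1 = z powi (int p * (r - 1)) * qnum z (int s)" for r s
    proof -
      have "z powi (- int s - int p * (2 - r)) = z powi (int p * (r - 1) + (int s - 1) + (- 1 - int p))"
        by (rule shift[of _ _ "1 - int s"]) (simp add: algebra_simps)
      also have "\<dots> = z powi (int p * (r - 1)) * z powi (int s - 1) * z powi (- 1 - int p)"
        using z0 by (simp only: power_int_add simp_thms)
      finally show ?thesis using True p z0 unfolding A_eq qnum_def by simp
    qed
    moreover have "fock_weight p \<epsilon> \<nu> * 1 / A 1 1 = fock_weight p \<epsilon> \<nu> * qnum z (int p)" for \<nu>
    proof -
      have "z powi (int p - 1) * z powi (- 1 - int p) = z powi (2 * (- 1))"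
        using z0 by (simp only: power_int_add[symmetric] simp_thms) simp
      then have "z powi (int p - 1) * z powi (- 1 - int p) = 1" unfolding even .
      then have "qnum z (int p) * A 1 1 = 1" using True p by (simp add: A_eq qnum_def mult_ac)
      then show ?thesis using \<open>A 1 1 \<noteq> 0\<close> by (simp add: field_simps)
    qed
    ultimately show ?thesis unfolding fusion_point_def irr_values_def Q using z z0 by metis
  qed
qed

lemma nearest_nonmultiple:
  fixes h :: real
  assumes "p \<ge> 2"
  obtains m0 :: int where "\<not> int p dvd m0" "\<And>m. \<not> int p dvd m \<Longrightarrow> \<bar>h - of_int m0\<bar> \<le> \<bar>h - of_int m\<bar>"
proof -
  define A where "A = {m. \<not> int p dvd m \<and> \<bar>h - of_int m\<bar> \<le> \<bar>h - 1\<bar>}"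
  have fin: "finite A"
    by (rule finite_subset[OF _ finite_ints_near[of h "\<bar>h - 1\<bar>"]]) (auto simp: A_def)
  have one: "1 \<in> A" using assms by (simp add: A_def)
  let ?D = "(\<lambda>m. \<bar>h - real_of_int m\<bar>) ` A"
  have "Min ?D \<in> ?D" using fin one by (intro Min_in) auto
  then obtain m0 where m0: "m0 \<in> A" "\<bar>h - of_int m0\<bar> = Min ?D" by auto
  show thesis
  proof (rule that)
    show "\<not> int p dvd m0" using m0(1) by (simp add: A_def)
    fix m assume m: "\<not> int p dvd m"
    show "\<bar>h - of_int m0\<bar> \<le> \<bar>h - of_int m\<bar>"
    proof (cases "m \<in> A")
      case True
      then show ?thesis unfolding m0(2) using fin by (intro Min_le) auto
    next
      case False
      then have "\<bar>h - 1\<bar> < \<bar>h - of_int m\<bar>" using m by (simp add: A_def)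
      moreover have "\<bar>h - of_int m0\<bar> \<le> \<bar>h - 1\<bar>" using m0(1) by (simp add: A_def)
      ultimately show ?thesis by linarith
    qed
  qed
qed

lemma dominant_point:
  assumes p: "p > 0" and dom: "\<epsilon> \<in> qdim_domain p" and neg: "Re (scaled p \<epsilon>) < 0" "\<bar>Im (scaled p \<epsilon>) - of_int m0\<bar> \<le> - Re (scaled p \<epsilon>)"
    and m0: "\<not> int p dvd m0" "\<And>m. \<not> int p dvd m \<Longrightarrow> \<bar>Im (scaled p \<epsilon>) - of_int m0\<bar> \<le> \<bar>Im (scaled p \<epsilon>) - of_int m\<bar>"
  shows "irr_values p \<epsilon> (unity_root p m0)"
    and "qdim p (Fock \<nu>) \<epsilon> = 0"
proof -
  note D = qdim_of_dominant[OF p dom neg(1) abs_ge_zero neg(2) m0(2) m0(1) refl]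
  have z2: "(unity_root p m0)\<^sup>2 \<noteq> 1" using unity_root_square[OF p] m0(1) by blast
  note W = weyl_numerator_factor[OF unity_root_nonzero z2]
  have "qdim p (Irr r s) \<epsilon> = unity_root p m0 powi (int p * (r - 1)) * qnum (unity_root p m0) (int s)" if "1 \<le> s" "s \<le> p" for r s
    using D(1)[OF _ that] W(1)[of p r s] W(2)[of p] by simp
  then show "irr_values p \<epsilon> (unity_root p m0)" unfolding irr_values_def by blast
  show "qdim p (Fock \<nu>) \<epsilon> = 0" using D(2) by blast
qed

lemma qnum_root_p:
  assumes "p > 0" "\<not> int p dvd m"
  shows "qnum (unity_root p m) (int p) = 0"
proof -
  have "unity_root p m powi (- 2 * int p) = inverse (unity_root p m powi (2 * int p))" by (simp flip: power_int_minus)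
  then show ?thesis using qnum_p_zero[of "unity_root p m" p] unity_root_square[OF assms(1)] unity_root_power_2p[OF assms(1)] assms(2) by simp
qed

text \<open>The three regimes: the nearest integer not divisible by \<open>p\<close> dominates; otherwise the
  geometric series has a value; or it is resonant.\<close>

theorem exists_fusion_point:
  assumes p: "p \<ge> 2" and dom: "\<epsilon> \<in> qdim_domain p"
  shows "\<exists>z. fusion_point p \<epsilon> z"
proof -
  have p0: "p > 0" using p by simp
  define z where "z = nome p \<epsilon>"
  obtain m0 where m0: "\<not> int p dvd m0" "\<And>m. \<not> int p dvd m \<Longrightarrow> \<bar>Im (scaled p \<epsilon>) - of_int m0\<bar> \<le> \<bar>Im (scaled p \<epsilon>) - of_int m\<bar>"
    using nearest_nonmultiple[OF p, of "Im (scaled p \<epsilon>)"] by blast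
  show ?thesis
  proof (cases "Re (scaled p \<epsilon>) < 0 \<and> \<bar>Im (scaled p \<epsilon>) - of_int m0\<bar> \<le> - Re (scaled p \<epsilon>)")
    case True
    then have "fusion_point p \<epsilon> (unity_root p m0)"
      unfolding fusion_point_def using dominant_point[OF p0 dom _ _ m0] qnum_root_p[OF p0 m0(1)] by auto
    then show ?thesis by blast
  next
    case False
    then show ?thesis
      using fusion_point_of_resonant[OF p0 z_def] fusion_point_of_regular[OF p0 z_def, of "\<bar>Im (scaled p \<epsilon>) - of_int m0\<bar>"] m0
      by (metis linorder_not_le)
  qed
qed

lemma B_bound_eq:
  assumes p: "p > 0" and m0: "\<not> int p dvd m0" "\<And>m. \<not> int p dvd m \<Longrightarrow> \<bar>Im (scaled p \<epsilon>) - of_int m0\<bar> \<le> \<bar>Im (scaled p \<epsilon>) - of_int m\<bar>"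
  shows "B_bound p \<epsilon> * sqrt (2 * real p) = - \<bar>Im (scaled p \<epsilon>) - of_int m0\<bar>"
proof -
  have a: "sqrt (2 * real p) > 0" using p by simp
  have dist: "\<bar>of_int m / sqrt (2 * real p) - Im \<epsilon>\<bar> = \<bar>Im (scaled p \<epsilon>) - of_int m\<bar> / sqrt (2 * real p)" for m
  proof -
    have "of_int m / sqrt (2 * real p) - Im \<epsilon> = - ((Im (scaled p \<epsilon>) - of_int m) / sqrt (2 * real p))"
      using a by (simp add: scaled_def field_simps)
    then show ?thesis using a by (simp only: abs_minus_cancel abs_divide abs_of_pos)
  qed
  have "(INF m\<in>{m::int. \<not> int p dvd m}. \<bar>of_int m / sqrt (2 * real p) - Im \<epsilon>\<bar>) = \<bar>Im (scaled p \<epsilon>) - of_int m0\<bar> / sqrt (2 * real p)"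
    unfolding dist by (rule cInf_eq_minimum) (use m0 a in \<open>auto intro!: divide_right_mono\<close>)
  then show ?thesis using a by (simp add: B_bound_def)
qed

theorem below_bound_point:
  assumes p: "p \<ge> 2" and dom: "\<epsilon> \<in> qdim_domain p" and below: "Re \<epsilon> < B_bound p \<epsilon>"
  obtains m where "\<not> int p dvd m" 
    "irr_values p \<epsilon> (unity_root p m)" "\<And>\<nu>. qdim p (Fock \<nu>) \<epsilon> = 0"
proof -
  have p0: "p > 0" using p by simp
  obtain m0 where m0: "\<not> int p dvd m0" "\<And>m. \<not> int p dvd m \<Longrightarrow> \<bar>Im (scaled p \<epsilon>) - of_int m0\<bar> \<le> \<bar>Im (scaled p \<epsilon>) - of_int m\<bar>"
    using nearest_nonmultiple[OF p, of "Im (scaled p \<epsilon>)"] by blast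
  have "Re \<epsilon> * sqrt (2 * real p) < B_bound p \<epsilon> * sqrt (2 * real p)"
    using below p0 by (intro mult_strict_right_mono) auto
  moreover have "Re (scaled p \<epsilon>) = Re \<epsilon> * sqrt (2 * real p)" by (simp add: scaled_def)
  ultimately have lt: "Re (scaled p \<epsilon>) < - \<bar>Im (scaled p \<epsilon>) - of_int m0\<bar>"
    using B_bound_eq[OF p0 m0] by linarith
  then show thesis using that[OF m0(1)] dominant_point[OF p0 dom _ _ m0] by force
qed

text \<open>With a single minimising index, dividing by its phase makes the normalised characters
  converge, which proves that the limits exist.\<close>

lemma unique_minimiser_point:
  assumes p: "p \<ge> 2" and below: "Re \<epsilon> < B_bound p \<epsilon>"
    and m1: "\<not> int p dvd m1" "\<bar>of_int m1 / sqrt (2 * real p) - Im \<epsilon>\<bar> = - B_bound p \<epsilon>"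
    and unique: "\<And>m. \<not> int p dvd m \<Longrightarrow> \<bar>of_int m / sqrt (2 * real p) - Im \<epsilon>\<bar> = - B_bound p \<epsilon> \<Longrightarrow> m = m1"
  shows "\<epsilon> \<in> qdim_domain p"
    and "irr_values p \<epsilon> (unity_root p m1)"
proof -
  let ?c = "scaled p \<epsilon>"
  have p0: "p > 0" using p by simp
  have a: "sqrt (2 * real p) > 0" using p by simp
  obtain m0 where m0: "\<not> int p dvd m0" "\<And>m. \<not> int p dvd m \<Longrightarrow> \<bar>Im ?c - of_int m0\<bar> \<le> \<bar>Im ?c - of_int m\<bar>"
    using nearest_nonmultiple[OF p, of "Im ?c"] by blast
  note B = B_bound_eq[OF p0 m0]
  have iff: "\<bar>of_int m / sqrt (2 * real p) - Im \<epsilon>\<bar> = - B_bound p \<epsilon> \<longleftrightarrow> \<bar>Im ?c - of_int m\<bar> = \<bar>Im ?c - of_int m0\<bar>" for m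
  proof -
    have "Im ?c - of_int m = - ((of_int m / sqrt (2 * real p) - Im \<epsilon>) * sqrt (2 * real p))"
      using a by (simp add: scaled_def field_simps)
    then have "\<bar>Im ?c - of_int m\<bar> = \<bar>of_int m / sqrt (2 * real p) - Im \<epsilon>\<bar> * sqrt (2 * real p)"
      using a by (simp only: abs_minus_cancel abs_mult abs_of_pos)
    moreover have "\<bar>Im ?c - of_int m0\<bar> = - B_bound p \<epsilon> * sqrt (2 * real p)" using B by simp
    moreover have "sqrt (2 * real p) \<noteq> 0" using a by simp
    ultimately show ?thesis by (metis mult_cancel_right)
  qed
  have m01: "m0 = m1" using unique[OF m0(1)] iff by blast
  define d where "d = \<bar>Im ?c - of_int m1\<bar>"
  define M where "M = {m. \<bar>Im ?c - of_int m\<bar> = d}"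
  have fin: "finite M" unfolding M_def by (rule finite_ints_at_distance)
  have far: "d \<le> \<bar>Im ?c - of_int m\<bar>" if "\<not> int p dvd m" for m
    unfolding d_def using m0(2)[OF that] m01 by simp
  have "Re \<epsilon> * sqrt (2 * real p) < B_bound p \<epsilon> * sqrt (2 * real p)"
    using below a by (intro mult_strict_right_mono) auto
  moreover have "Re ?c = Re \<epsilon> * sqrt (2 * real p)" by (simp add: scaled_def)
  ultimately have lt: "Re ?c < - d"
    using B unfolding m01 d_def by linarith
  have d0: "d \<ge> 0" by (simp add: d_def)
  define th where "th Y = 2 * pi * Re ?c * (Im ?c - of_int m1) / Y" for Y
  define N where "N Y = cis (- th Y) * dominance ?c d Y" for Y
  have A: "((\<lambda>Y. N Y * character_sum p ?c r s Y) \<longlongrightarrow> weyl_numerator p (unity_root p m1) r s) (at_right 0)" for r s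
  proof -
    let ?u = "\<lambda>m. weyl_numerator p (unity_root p m) r s"
    have only: "leading_sum ?u M ?c Y = ?u m1 * cis (th Y)" for Y
    proof -
      have "?u m = 0" if m: "m \<in> M - {m1}" for m
      proof -
        have "int p dvd m" using m unique[of m] iff[of m] by (auto simp: M_def d_def m01)
        then show ?thesis using weyl_numerator_zero[OF unity_root_nonzero] unity_root_square[OF p0] by simp
      qed
      then have "leading_sum ?u M ?c Y = leading_sum ?u {m1} ?c Y"
        unfolding leading_sum_def by (intro sum.mono_neutral_right[OF fin]) (auto simp: M_def d_def)
      then show ?thesis by (simp add: leading_sum_def th_def)
    qed
    have "((\<lambda>Y. dominance ?c d Y * character_sum p ?c r s Y - ?u m1 * cis (th Y)) \<longlongrightarrow> 0) (at_right 0)"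
      using character_sum_dominant[OF p0 _ d0 _ far M_def, of r s] lt d0 unfolding only by simp
    then have "((\<lambda>Y. norm (dominance ?c d Y * character_sum p ?c r s Y - ?u m1 * cis (th Y))) \<longlongrightarrow> 0) (at_right 0)"
      by (rule tendsto_norm_zero)
    moreover have "norm (dominance ?c d Y * character_sum p ?c r s Y - ?u m1 * cis (th Y)) =
       norm (N Y * character_sum p ?c r s Y - ?u m1)" for Y
    proof -
      have "cis (- th Y) * cis (th Y) = 1" by (simp add: cis_mult)
      then have "cis (- th Y) * (K - ?u m1 * cis (th Y)) = cis (- th Y) * K - ?u m1" for K
        by (simp add: right_diff_distrib mult.left_commute)
      then have "N Y * character_sum p ?c r s Y - ?u m1 = cis (- th Y) * (dominance ?c d Y * character_sum p ?c r s Y - ?u m1 * cis (th Y))"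
        by (simp add: N_def mult.assoc)
      then show ?thesis by (simp add: norm_mult)
    qed
    ultimately have "((\<lambda>Y. N Y * character_sum p ?c r s Y - ?u m1) \<longlongrightarrow> 0) (at_right 0)"
      using tendsto_norm_zero_cancel by force
    then show ?thesis by (rule LIM_zero_cancel)
  qed
  have N: "(N \<longlongrightarrow> 0) (at_right 0)"
  proof (rule tendsto_norm_zero_cancel)
    show "((\<lambda>Y. norm (N Y)) \<longlongrightarrow> 0) (at_right 0)"
      using tendsto_norm_zero[OF dominance_tendsto[OF d0]] lt by (simp add: N_def norm_mult)
  qed
  have z2: "(unity_root p m1)\<^sup>2 \<noteq> 1" using unity_root_square[OF p0] m1(1) by blast
  note W = weyl_numerator_factor[OF unity_root_nonzero z2]
  note Q = qdim_of_normalised[OF p0 A N W(2)]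
  show "\<epsilon> \<in> qdim_domain p" by (rule Q(1))
  have "qdim p (Irr r s) \<epsilon> = unity_root p m1 powi (int p * (r - 1)) * qnum (unity_root p m1) (int s)" for r s
    unfolding Q(2)[of r s] using W(1)[of p r s] W(2)[of p] by simp
  then show "irr_values p \<epsilon> (unity_root p m1)" unfolding irr_values_def by blast
qed

section \<open>Quantum integers\<close>

lemma qnum_nondeg:
  assumes "z \<noteq> 0" "z\<^sup>2 \<noteq> 1"
  shows "(z - inverse z) * qnum z t = z powi t - z powi (- t)"
  using assms z_minus_inverse[of z] by (simp add: qnum_def)

lemma powi_even_shift:
  fixes z :: complex
  assumes "z \<noteq> 0" "z\<^sup>2 = 1" "a - b = 2 * n"
  shows "z powi a = z powi b"
proof -
  have "z powi (2 * n) = 1" using assms(2) by (simp add: power_int_mult)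
  then have "z powi (b + 2 * n) = z powi b" using assms(1) by (simp add: power_int_add)
  moreover have "b + 2 * n = a" using assms(3) by simp
  ultimately show ?thesis by simp
qed

lemma qnum_0 [simp]: "qnum z 0 = 0"
  by (simp add: qnum_def)

lemma qnum_1: "z \<noteq> 0 \<Longrightarrow> qnum z 1 = 1"
  using z_minus_inverse[of z] by (auto simp: qnum_def power_int_minus)

lemma qnum_minus: "z \<noteq> 0 \<Longrightarrow> qnum z (- t) = - qnum z t"
  using powi_even_shift[of z "- t - 1" "t - 1" "- t"] by (auto simp: qnum_def minus_divide_left)

lemma geometric_telescope:
  fixes z :: complex
  assumes "z \<noteq> 0"
  shows "(z - inverse z) * (\<Sum>j<n. z powi (a - 2 * int j)) = z powi (a + 1) - z powi (a + 1 - 2 * int n)"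
proof (induction n)
  case (Suc n)
  have "(z - inverse z) * z powi (a - 2 * int n) = z powi (a + 1 - 2 * int n) - z powi (a + 1 - 2 * int (Suc n))"
  proof -
    have "a + 1 - 2 * int n = (a - 2 * int n) + 1" "a + 1 - 2 * int (Suc n) = (a - 2 * int n) + (- 1)" by simp_all
    then show ?thesis using assms by (simp only: power_int_add simp_thms) (simp add: algebra_simps power_int_minus)
  qed
  then show ?case using Suc.IH by (simp add: distrib_left)
qed simp

lemma qnum_sum:
  assumes "z \<noteq> 0"
  shows "qnum z (int n) = (\<Sum>j<n. z powi (int n - 1 - 2 * int j))"
proof (cases "z\<^sup>2 = 1")
  case True
  have "(\<Sum>j<n. z powi (int n - 1 - 2 * int j)) = (\<Sum>j<n. z powi (int n - 1))"
    by (intro sum.cong refl powi_even_shift[OF assms True, of _ _ "- int j" for j]) simp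
  then show ?thesis using True by (simp add: qnum_def)
next
  case False
  have "(z - inverse z) * (\<Sum>j<n. z powi (int n - 1 - 2 * int j)) = (z - inverse z) * qnum z (int n)"
    unfolding geometric_telescope[OF assms] qnum_nondeg[OF assms False] by simp
  then show ?thesis using z_minus_inverse[OF assms] False by simp
qed

text \<open>The Clebsch-Gordan rule. Here \<open>t\<close> may be any integer, and the indices on the right may be
  negative or larger than \<open>p\<close>; they are brought into range later.\<close>

lemma qnum_mult:
  assumes "z \<noteq> 0"
  shows "qnum z (int n) * qnum z t = (\<Sum>j<n. qnum z (t + int n - 1 - 2 * int j))"
proof (cases "z\<^sup>2 = 1")
  case True
  have "(\<Sum>j<n. of_int (t + int n - 1 - 2 * int j)) = (of_nat n * of_int t :: complex)"
  proof -
    have "(\<Sum>j<n. c - 2 * of_nat j) = (of_nat n * (c + 1 - of_nat n) :: complex)" for c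
      by (induction n) (simp_all add: algebra_simps)
    from this[of "of_int (t + int n - 1)"] show ?thesis by simp
  qed
  moreover have "qnum z (t + int n - 1 - 2 * int j) = of_int (t + int n - 1 - 2 * int j) * z powi (t + int n - 2)" for j
    using True powi_even_shift[OF assms True, of "t + int n - 1 - 2 * int j - 1" "t + int n - 2" "- int j"] by (simp add: qnum_def)
  ultimately have "(\<Sum>j<n. qnum z (t + int n - 1 - 2 * int j)) = of_nat n * of_int t * z powi (t + int n - 2)"
    by (simp only: sum_distrib_right[symmetric])
  moreover have "z powi (t + int n - 2) = z powi (int n - 1) * z powi (t - 1)"
  proof -
    have "t + int n - 2 = (int n - 1) + (t - 1)" by simp
    then show ?thesis using assms by (simp only: power_int_add simp_thms)
  qed
  ultimately show ?thesis using True by (simp add: qnum_def)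
next
  case False
  let ?d = "z - inverse z"
  have neg: "(\<Sum>j<n. z powi (- (t + int n - 1 - 2 * int j))) = (\<Sum>j<n. z powi (int n - 1 - t - 2 * int j))"
    by (rule sum.reindex_bij_witness[of _ "\<lambda>j. n - Suc j" "\<lambda>j. n - Suc j"])
       (auto simp: of_nat_diff intro!: arg_cong[of _ _ "power_int z"])
  have "?d * (?d * (\<Sum>j<n. qnum z (t + int n - 1 - 2 * int j))) =
     ?d * (\<Sum>j<n. z powi (t + int n - 1 - 2 * int j)) - ?d * (\<Sum>j<n. z powi (- (t + int n - 1 - 2 * int j)))"
    unfolding sum_distrib_left[of ?d "\<lambda>j. qnum z (t + int n - 1 - 2 * int j)"] qnum_nondeg[OF assms False] sum_subtractf right_diff_distrib ..
  also have "\<dots> = z powi (t + int n) - z powi (t - int n) - (z powi (int n - t) - z powi (- int n - t))"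
  proof -
    have "(t + int n - 1) + 1 = t + int n" "(t + int n - 1) + 1 - 2 * int n = t - int n"
      "(int n - 1 - t) + 1 = int n - t" "(int n - 1 - t) + 1 - 2 * int n = - int n - t" by simp_all
    then show ?thesis unfolding neg geometric_telescope[OF assms] by (simp only:)
  qed
  also have "\<dots> = (z powi int n - z powi (- int n)) * (z powi t - z powi (- t))"
  proof -
    have "t + int n = int n + t" "t - int n = - int n + t" "int n - t = int n + (- t)" "- int n - t = - int n + (- t)" by simp_all
    then show ?thesis using assms by (simp only: power_int_add simp_thms) (simp add: algebra_simps)
  qed
  also have "\<dots> = ?d * (?d * (qnum z (int n) * qnum z t))"
    unfolding qnum_nondeg[OF assms False, symmetric] by (simp add: mult_ac)
  finally show ?thesis using z_minus_inverse[OF assms] False by simp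
qed

text \<open>With \<open>k = p\<close> this expresses an index beyond \<open>p\<close> by smaller ones; the factors \<open>z\<^sup>p\<close> and \<open>z\<^sup>-\<^sup>p\<close>
  are shifts of the label \<open>r\<close> by one.\<close>

lemma qnum_recurrence:
  assumes "z \<noteq> 0"
  shows "qnum z t = (z powi k + z powi (- k)) * qnum z (t - k) - qnum z (t - 2 * k)"
proof (cases "z\<^sup>2 = 1")
  case True
  have 1: "z powi k * z powi (t - k - 1) = z powi (t - 1)" "z powi (- k) * z powi (t - k - 1) = z powi (t - 1 - 2 * k)"
    using assms by (simp_all flip: power_int_add add: algebra_simps)
  have 2: "z powi (t - 1 - 2 * k) = z powi (t - 1)" "z powi (t - 2 * k - 1) = z powi (t - 1)"
    by (rule powi_even_shift[OF assms True, of _ _ "- k"]; simp)+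
  have "(z powi k + z powi (- k)) * (of_int (t - k) * z powi (t - k - 1)) =
     of_int (t - k) * (z powi k * z powi (t - k - 1) + z powi (- k) * z powi (t - k - 1))"
    by (simp add: algebra_simps)
  also have "\<dots> = of_int (t - k) * (2 * z powi (t - 1))" unfolding 1 2 by simp
  finally have e: "(z powi k + z powi (- k)) * (of_int (t - k) * z powi (t - k - 1)) = of_int (t - k) * (2 * z powi (t - 1))" .
  show ?thesis unfolding qnum_def if_P[OF True] e 2 by (simp add: algebra_simps)
next
  case False
  let ?d = "z - inverse z"
  have "?d * ((z powi k + z powi (- k)) * qnum z (t - k) - qnum z (t - 2 * k)) =
    (z powi k + z powi (- k)) * (?d * qnum z (t - k)) - ?d * qnum z (t - 2 * k)" by (simp add: algebra_simps)
  also have "\<dots> = z powi t - z powi (- t)"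
  proof -
    have "z powi (t - k) = z powi (- k) * z powi t" "z powi (- (t - k)) = z powi k * z powi (- t)"
      "z powi (t - 2 * k) = z powi (- k) * (z powi (- k) * z powi t)" "z powi (- (t - 2 * k)) = z powi k * (z powi k * z powi (- t))"
      using assms by (simp_all flip: power_int_add)
    moreover have "z powi k * z powi (- k) = 1" using assms by (simp flip: power_int_add)
    ultimately show ?thesis unfolding qnum_nondeg[OF assms False] by (simp add: algebra_simps)
  qed
  also have "\<dots> = ?d * qnum z t" unfolding qnum_nondeg[OF assms False] ..
  finally show ?thesis using z_minus_inverse[OF assms] False by simp
qed

section \<open>The ring of quantum dimensions\<close>

text \<open>Products distribute over the sums and negatives from which the span is built, so it suffices to
  multiply generators.\<close>

lemma (in cring) cring_generate_add:
  assumes H: "H \<subseteq> carrier R"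
    and one: "\<one> \<in> generate (add_monoid R) H"
    and mult: "\<And>a b. a \<in> H \<Longrightarrow> b \<in> H \<Longrightarrow> a \<otimes> b \<in> generate (add_monoid R) H"
  shows "cring (R\<lparr>carrier := generate (add_monoid R) H\<rparr>)"
proof -
  let ?G = "generate (add_monoid R) H"
  have Gc: "?G \<subseteq> carrier R" using add.generate_incl[of H] H by simp
  have neg: "\<ominus> x \<in> ?G" if "x \<in> ?G" for x
    using add.generate_m_inv_closed[of H x] H that by (simp add: a_inv_def)
  have add: "x \<oplus> y \<in> ?G" if "x \<in> ?G" "y \<in> ?G" for x y
    using generate.eng[OF that] by simp
  have zero: "\<zero> \<in> ?G" using generate.one[of "add_monoid R" H] by simp
  have m1: "a \<otimes> y \<in> ?G" if a: "a \<in> H" and y: "y \<in> ?G" for a y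
    using y
  proof induction
    case one
    then show ?case using a H zero by auto
  next
    case (incl b)
    then show ?case by (rule mult[OF a])
  next
    case (inv b)
    have "a \<otimes> (\<ominus> b) = \<ominus> (a \<otimes> b)" using a inv H by (intro r_minus) auto
    then show ?case using neg[OF mult[OF a inv]] by (simp add: a_inv_def)
  next
    case (eng u v)
    have "a \<otimes> (u \<oplus> v) = a \<otimes> u \<oplus> a \<otimes> v" using a eng H Gc by (intro r_distr) auto
    then show ?case using add[OF eng.IH] by simp
  qed
  have m2: "x \<otimes> y \<in> ?G" if x: "x \<in> ?G" and y: "y \<in> ?G" for x y
    using x
  proof induction
    case one
    then show ?case using y Gc zero by auto
  next
    case (incl b)
    then show ?case using m1 y by blast
  next
    case (inv b)
    have "(\<ominus> b) \<otimes> y = \<ominus> (b \<otimes> y)" using y inv H Gc by (intro l_minus) auto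
    then show ?case using neg[OF m1[OF inv y]] by (simp add: a_inv_def)
  next
    case (eng u v)
    have "(u \<oplus> v) \<otimes> y = u \<otimes> y \<oplus> v \<otimes> y" using y eng H Gc by (intro l_distr) auto
    then show ?case using add[OF eng.IH] by simp
  qed
  have "subring ?G R" using Gc one neg m2 add by (intro subringI) auto
  then have "subcring ?G R" by (rule subcringI')
  then show ?thesis using subcring_iff[OF Gc] by blast
qed

lemma cring_function_ring: "cring (function_ring S)"
proof (rule cringI)
  show "abelian_group (function_ring S)"
  proof (rule abelian_groupI)
    fix f assume "f \<in> carrier (function_ring S)"
    then show "\<exists>g\<in>carrier (function_ring S). g \<oplus>\<^bsub>function_ring S\<^esub> f = \<zero>\<^bsub>function_ring S\<^esub>"
      by (intro bexI[of _ "\<lambda>x\<in>S. - f x"]) (auto simp: function_ring_def fun_eq_iff)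
  qed (auto simp: function_ring_def fun_eq_iff add_ac PiE_def extensional_def)
  show "comm_monoid (function_ring S)"
    by (rule comm_monoidI) (auto simp: function_ring_def fun_eq_iff mult_ac PiE_def extensional_def)
qed (auto simp: function_ring_def fun_eq_iff distrib_right)

lemma function_ring_minus:
  assumes "f \<in> carrier (function_ring S)"
  shows "\<ominus>\<^bsub>function_ring S\<^esub> f = (\<lambda>x\<in>S. - f x)"
proof -
  interpret cring "function_ring S" by (rule cring_function_ring)
  show ?thesis using assms by (intro minus_equality) (auto simp: function_ring_def fun_eq_iff)
qed

lemma singlet_modules_cases:
  assumes "X \<in> singlet_modules p"
  obtains (Fock) \<nu> where "X = Fock \<nu>" | (Irr) r s where "X = Irr r s" "1 \<le> s" "s \<le> p"
  using assms unfolding singlet_modules_def by blast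

lemma qdim_generators_carrier: "(\<lambda>X. restrict (qdim p X) S) ` M \<subseteq> carrier (function_ring S)"
  by (auto simp: function_ring_def)

lemma qdim_space_gen: "X \<in> singlet_modules p \<Longrightarrow> restrict (qdim p X) S \<in> qdim_space p S"
  unfolding qdim_space_def by (intro generate.incl) auto

lemma qdim_space_add:
  assumes "restrict f S \<in> qdim_space p S" "restrict g S \<in> qdim_space p S"
  shows "restrict (\<lambda>x. f x + g x) S \<in> qdim_space p S"
proof -
  have eq: "restrict (\<lambda>x. f x + g x) S = restrict f S \<otimes>\<^bsub>add_monoid (function_ring S)\<^esub> restrict g S"
    by (auto simp: function_ring_def fun_eq_iff)
  show ?thesis
    unfolding eq using assms unfolding qdim_space_def by (rule generate.eng)
qed

lemma qdim_space_minus: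
  assumes "restrict f S \<in> qdim_space p S"
  shows "restrict (\<lambda>x. - f x) S \<in> qdim_space p S"
proof -
  interpret cring "function_ring S" by (rule cring_function_ring)
  have "\<ominus>\<^bsub>function_ring S\<^esub> (restrict f S) \<in> qdim_space p S"
    using add.generate_m_inv_closed[of "(\<lambda>X. restrict (qdim p X) S) ` singlet_modules p"] qdim_generators_carrier assms
    by (simp add: a_inv_def qdim_space_def)
  moreover have "\<ominus>\<^bsub>function_ring S\<^esub> (restrict f S) = restrict (\<lambda>x. - f x) S"
    by (subst function_ring_minus) (auto simp: function_ring_def fun_eq_iff)
  ultimately show ?thesis by simp
qed

lemma qdim_space_zero: "restrict (\<lambda>x. 0) S \<in> qdim_space p S"
  using generate.one[of "add_monoid (function_ring S)"] unfolding qdim_space_def by (simp add: function_ring_def)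

lemma qdim_space_cong:
  assumes "restrict f S \<in> qdim_space p S" "\<And>x. x \<in> S \<Longrightarrow> g x = f x"
  shows "restrict g S \<in> qdim_space p S"
proof -
  have "restrict g S = restrict f S" using assms(2) by (auto simp: restrict_def)
  then show ?thesis using assms(1) by simp
qed

lemma qdim_space_diff:
  assumes "restrict f S \<in> qdim_space p S" "restrict g S \<in> qdim_space p S"
  shows "restrict (\<lambda>x. f x - g x) S \<in> qdim_space p S"
  using qdim_space_add[OF assms(1) qdim_space_minus[OF assms(2)]] by simp

lemma qdim_space_sum:
  assumes "finite J" "\<And>j. j \<in> J \<Longrightarrow> restrict (f j) S \<in> qdim_space p S"
  shows "restrict (\<lambda>x. \<Sum>j\<in>J. f j x) S \<in> qdim_space p S"
  using assms
proof (induction J rule: finite_induct)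
  case empty
  show ?case by (rule qdim_space_cong[OF qdim_space_zero]) simp
next
  case (insert i J)
  have "restrict (\<lambda>x. f i x + (\<Sum>j\<in>J. f j x)) S \<in> qdim_space p S"
  proof (rule qdim_space_add)
    show "restrict (f i) S \<in> qdim_space p S" by (rule insert.prems) simp
    show "restrict (\<lambda>x. \<Sum>j\<in>J. f j x) S \<in> qdim_space p S" by (rule insert.IH) (rule insert.prems, simp)
  qed
  then show ?case by (rule qdim_space_cong) (simp add: insert.hyps)
qed

lemma qdim_space_int_mult:
  assumes "restrict f S \<in> qdim_space p S"
  shows "restrict (\<lambda>x. of_int n * f x) S \<in> qdim_space p S"
proof (induction n rule: int_induct[of _ 0])
  case (step1 i)
  show ?case by (rule qdim_space_cong[OF qdim_space_add[OF step1(2) assms]]) (simp add: distrib_right)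
next
  case (step2 i)
  show ?case by (rule qdim_space_cong[OF qdim_space_diff[OF step2(2) assms]]) (simp add: left_diff_distrib)
next
  case base
  show ?case by (rule qdim_space_cong[OF qdim_space_zero]) simp
qed

lemma fock_weight_shift:
  "fock_weight p \<epsilon> \<nu> * nome p \<epsilon> powi n =
    fock_weight p \<epsilon> (\<nu> + of_int n / of_real (sqrt (2 * real p)))"
proof -
  have 1: "K * (v - a) + K * w = K * (v + w - a)" for K v a w :: complex
    by (simp add: algebra_simps)
  have 2: "of_int n * (2 * of_real pi * (\<epsilon> / q)) = 2 * of_real pi * \<epsilon> * (of_int n / q)" for q
    by simp
  show ?thesis unfolding fock_weight_def nome_def exp_power_int exp_add[symmetric] 2 1 ..
qed

lemma fock_weight_mult:
  "fock_weight p \<epsilon> \<nu> * fock_weight p \<epsilon> \<mu> = fock_weight p \<epsilon> (\<nu> + \<mu> - of_real (alpha0 p / 2))"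
proof -
  have "K * (v - a) + K * (w - a) = K * (v + w - a - a)" for K v w a :: complex
    by (simp add: algebra_simps)
  then show ?thesis unfolding fock_weight_def exp_add[symmetric] by (rule arg_cong)
qed

text \<open>The values \<open>w r t = z\<^sup>p\<^sup>(\<^sup>r\<^sup>-\<^sup>1\<^sup>) [t]\<close> lie in the span for every integer \<open>t\<close>: for \<open>1 \<le> t \<le> p\<close> they are the
  generators \<open>M\<^bsub>r,t\<^esub>\<close>, and the recurrence and \<open>[-t] = - [t]\<close> give the others. Products of these are
  sums of such values by Clebsch-Gordan. A product with a Fock value is a sum of Fock values, as
  \<open>[s]\<close> is a sum of powers of \<open>z\<close>.\<close>

theorem cring_qdim_ring:
  assumes p: "p > 0" and S: "\<And>\<epsilon>. \<epsilon> \<in> S \<Longrightarrow> \<exists>z. fusion_point p \<epsilon> z"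
  shows "cring (qdim_ring p S)"
proof -
  define z where "z \<epsilon> = (SOME z. fusion_point p \<epsilon> z)" for \<epsilon>
  have fp: "fusion_point p \<epsilon> (z \<epsilon>)" if "\<epsilon> \<in> S" for \<epsilon>
    unfolding z_def by (rule someI_ex[OF S[OF that]])
  have z0: "z \<epsilon> \<noteq> 0" if "\<epsilon> \<in> S" for \<epsilon>
    using fp[OF that] unfolding fusion_point_def by (elim conjE)
  have irr: "qdim p (Irr r s) \<epsilon> = z \<epsilon> powi (int p * (r - 1)) * qnum (z \<epsilon>) (int s)"
    if "\<epsilon> \<in> S" "1 \<le> s" "s \<le> p" for \<epsilon> r s
    using fp[OF that(1)] that(2,3) unfolding fusion_point_def irr_values_def by simp
  have fock: "z \<epsilon> = nome p \<epsilon> \<and> (\<forall>\<nu>. qdim p (Fock \<nu>) \<epsilon> = fock_weight p \<epsilon> \<nu> * qnum (z \<epsilon>) (int p))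
     \<or> qnum (z \<epsilon>) (int p) = 0 \<and> (\<forall>\<nu>. qdim p (Fock \<nu>) \<epsilon> = 0)" if "\<epsilon> \<in> S" for \<epsilon>
    using fp[OF that] unfolding fusion_point_def by (elim conjE)
  let ?V = "qdim_space p S"
  define w where "w r t \<epsilon> = z \<epsilon> powi (int p * (r - 1)) * qnum (z \<epsilon>) t" for r t \<epsilon>
  have w_nat: "restrict (w r (int n)) S \<in> ?V" for r n
  proof (induction n arbitrary: r rule: less_induct)
    case (less n)
    consider "n = 0" | "1 \<le> n" "n \<le> p" | "p < n" by linarith
    then show ?case
    proof cases
      case 1
      then show ?thesis by (intro qdim_space_cong[OF qdim_space_zero]) (simp add: w_def)
    next
      case 2
      have "Irr r n \<in> singlet_modules p" using 2 by (auto simp: singlet_modules_def)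
      from qdim_space_gen[OF this] show ?thesis
        by (rule qdim_space_cong) (simp only: irr[OF _ 2] w_def)
    next
      case 3
      have rec: "w r (int n) \<epsilon> = w (r + 1) (int (n - p)) \<epsilon> + w (r - 1) (int (n - p)) \<epsilon> - w r (int n - 2 * int p) \<epsilon>" if "\<epsilon> \<in> S" for \<epsilon>
      proof -
        have "int p * (r + 1 - 1) = int p * (r - 1) + int p" "int p * (r - 1 - 1) = int p * (r - 1) + - int p"
          by (simp_all add: algebra_simps)
        then have pw: "z \<epsilon> powi (int p * (r + 1 - 1)) = z \<epsilon> powi (int p * (r - 1)) * z \<epsilon> powi int p"
          "z \<epsilon> powi (int p * (r - 1 - 1)) = z \<epsilon> powi (int p * (r - 1)) * z \<epsilon> powi (- int p)"
          using z0[OF that] by (simp_all only: power_int_add simp_thms)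
        have q: "qnum (z \<epsilon>) (int n) = (z \<epsilon> powi int p + z \<epsilon> powi (- int p)) * qnum (z \<epsilon>) (int n - int p) - qnum (z \<epsilon>) (int n - 2 * int p)"
          by (rule qnum_recurrence[OF z0[OF that]])
        have "int (n - p) = int n - int p" using 3 by simp
        moreover have "K * ((A + B) * Q1 - Q2) = (K * A) * Q1 + (K * B) * Q1 - K * Q2" for K A B Q1 Q2 :: complex
          by (simp add: algebra_simps)
        ultimately show ?thesis by (simp only: w_def pw q)
      qed
      have "restrict (w r (int n - 2 * int p)) S \<in> ?V"
      proof (cases "2 * p \<le> n")
        case True
        then have e: "int n - 2 * int p = int (n - 2 * p)" by simp
        show ?thesis unfolding e by (rule less) (use 3 p in linarith)
      next
        case False
        then have e: "int n - 2 * int p = - int (2 * p - n)" by simp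
        have "restrict (w r (int (2 * p - n))) S \<in> ?V" by (rule less) (use 3 p in linarith)
        from qdim_space_minus[OF this] show ?thesis
          by (rule qdim_space_cong) (simp only: e w_def qnum_minus[OF z0] mult_minus_right)
      qed
      moreover have "restrict (w r' (int (n - p))) S \<in> ?V" for r' by (rule less) (use 3 p in linarith)
      ultimately have "restrict (\<lambda>\<epsilon>. w (r + 1) (int (n - p)) \<epsilon> + w (r - 1) (int (n - p)) \<epsilon> - w r (int n - 2 * int p) \<epsilon>) S \<in> ?V"
        by (intro qdim_space_diff qdim_space_add)
      then show ?thesis by (rule qdim_space_cong) (rule rec)
    qed
  qed
  have w_int: "restrict (w r t) S \<in> ?V" for r t
  proof (cases "t \<ge> 0")
    case True
    then have e: "t = int (nat t)" by simp
    show ?thesis by (subst e) (rule w_nat)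
  next
    case False
    then have e: "t = - int (nat (- t))" by simp
    from qdim_space_minus[OF w_nat[of r "nat (- t)"]] show ?thesis
      by (rule qdim_space_cong) (subst e, simp only: w_def qnum_minus[OF z0] mult_minus_right)
  qed
  have irr_irr: "restrict (\<lambda>\<epsilon>. qdim p (Irr r s) \<epsilon> * qdim p (Irr r' s') \<epsilon>) S \<in> ?V"
    if "1 \<le> s" "s \<le> p" "1 \<le> s'" "s' \<le> p" for r s r' s'
  proof (rule qdim_space_cong)
    show "restrict (\<lambda>\<epsilon>. \<Sum>j<s. w (r + r' - 1) (int s' + int s - 1 - 2 * int j) \<epsilon>) S \<in> ?V"
      by (intro qdim_space_sum w_int) simp
    fix \<epsilon> assume e: "\<epsilon> \<in> S"
    have "int p * (r + r' - 1 - 1) = int p * (r - 1) + int p * (r' - 1)" by (simp add: algebra_simps)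
    then have "z \<epsilon> powi (int p * (r + r' - 1 - 1)) = z \<epsilon> powi (int p * (r - 1)) * z \<epsilon> powi (int p * (r' - 1))"
      using z0[OF e] by (simp only: power_int_add simp_thms)
    then show "qdim p (Irr r s) \<epsilon> * qdim p (Irr r' s') \<epsilon> = (\<Sum>j<s. w (r + r' - 1) (int s' + int s - 1 - 2 * int j) \<epsilon>)"
      unfolding w_def sum_distrib_left[symmetric] qnum_mult[OF z0[OF e], symmetric] 
      by (simp only: irr[OF e that(1,2)] irr[OF e that(3,4)] mult_ac)
  qed
  have fock_mult: "restrict (\<lambda>\<epsilon>. qdim p (Fock \<nu>) \<epsilon> * (z \<epsilon> powi k * qnum (z \<epsilon>) (int s))) S \<in> ?V" for \<nu> k s
  proof (rule qdim_space_cong)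
    let ?\<mu> = "\<lambda>j. \<nu> + of_int (k + (int s - 1 - 2 * int j)) / of_real (sqrt (2 * real p))"
    show "restrict (\<lambda>\<epsilon>. \<Sum>j<s. qdim p (Fock (?\<mu> j)) \<epsilon>) S \<in> ?V"
      by (intro qdim_space_sum qdim_space_gen) (auto simp: singlet_modules_def)
    fix \<epsilon> assume e: "\<epsilon> \<in> S"
    show "qdim p (Fock \<nu>) \<epsilon> * (z \<epsilon> powi k * qnum (z \<epsilon>) (int s)) = (\<Sum>j<s. qdim p (Fock (?\<mu> j)) \<epsilon>)"
      using fock[OF e]
    proof (elim disjE conjE)
      assume ze: "z \<epsilon> = nome p \<epsilon>"
        and f: "\<forall>\<nu>. qdim p (Fock \<nu>) \<epsilon> = fock_weight p \<epsilon> \<nu> * qnum (z \<epsilon>) (int p)"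
      have "qdim p (Fock (?\<mu> j)) \<epsilon> = qdim p (Fock \<nu>) \<epsilon> * (z \<epsilon> powi k * z \<epsilon> powi (int s - 1 - 2 * int j))" for j
      proof -
        have "z \<epsilon> powi k * z \<epsilon> powi (int s - 1 - 2 * int j) = z \<epsilon> powi (k + (int s - 1 - 2 * int j))"
          using z0[OF e] by (simp only: power_int_add simp_thms)
        then show ?thesis
          using fock_weight_shift[of p \<epsilon> \<nu> "k + (int s - 1 - 2 * int j)"] f unfolding ze[symmetric] by (simp add: mult_ac)
      qed
      then show ?thesis unfolding qnum_sum[OF z0[OF e]] by (simp only: sum_distrib_left)
    qed simp
  qed
  have irr_fock: "restrict (\<lambda>\<epsilon>. qdim p (Fock \<nu>) \<epsilon> * qdim p (Irr r s) \<epsilon>) S \<in> ?V" if "1 \<le> s" "s \<le> p" for \<nu> r s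
    by (rule qdim_space_cong[OF fock_mult[of \<nu> "int p * (r - 1)" s]]) (simp only: irr[OF _ that])
  have fock_fock: "restrict (\<lambda>\<epsilon>. qdim p (Fock \<nu>) \<epsilon> * qdim p (Fock \<mu>) \<epsilon>) S \<in> ?V" for \<nu> \<mu>
  proof (rule qdim_space_cong[OF fock_mult[of "\<nu> + \<mu> - of_real (alpha0 p / 2)" 0 p]])
    fix \<epsilon> assume e: "\<epsilon> \<in> S"
    show "qdim p (Fock \<nu>) \<epsilon> * qdim p (Fock \<mu>) \<epsilon> = qdim p (Fock (\<nu> + \<mu> - of_real (alpha0 p / 2))) \<epsilon> * (z \<epsilon> powi 0 * qnum (z \<epsilon>) (int p))"
      using fock[OF e]
    proof (elim disjE conjE)
      assume f: "\<forall>\<nu>. qdim p (Fock \<nu>) \<epsilon> = fock_weight p \<epsilon> \<nu> * qnum (z \<epsilon>) (int p)"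
      show ?thesis by (simp only: f[rule_format] fock_weight_mult[symmetric] power_int_0_right mult_1 mult_ac)
    qed simp
  qed
  have prod: "restrict (\<lambda>\<epsilon>. qdim p X \<epsilon> * qdim p X' \<epsilon>) S \<in> ?V" if mem: "X \<in> singlet_modules p" "X' \<in> singlet_modules p" for X X'
    using mem(1)
  proof (cases rule: singlet_modules_cases)
    case X: (Irr r s)
    show ?thesis using mem(2)
    proof (cases rule: singlet_modules_cases)
      case (Irr r' s')
      then show ?thesis using X irr_irr by blast
    next
      case (Fock \<nu>)
      show ?thesis unfolding X(1) Fock by (rule qdim_space_cong[OF irr_fock[OF X(2,3), of \<nu> r]]) (rule mult.commute)
    qed
  next
    case X: (Fock \<nu>)
    show ?thesis using mem(2) X irr_fock fock_fock by (cases rule: singlet_modules_cases) blast+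
  qed
  interpret cring "function_ring S" by (rule cring_function_ring)
  have "cring (function_ring S\<lparr>carrier := generate (add_monoid (function_ring S)) ((\<lambda>X. restrict (qdim p X) S) ` singlet_modules p)\<rparr>)"
  proof (rule cring_generate_add[OF qdim_generators_carrier])
    have "vacuum \<in> singlet_modules p" using p by (auto simp: singlet_modules_def)
    moreover have "\<one>\<^bsub>function_ring S\<^esub> = restrict (qdim p vacuum) S"
      using irr[of _ 1 1] p z0 by (auto simp: function_ring_def fun_eq_iff qnum_1)
    ultimately show "\<one>\<^bsub>function_ring S\<^esub> \<in> generate (add_monoid (function_ring S)) ((\<lambda>X. restrict (qdim p X) S) ` singlet_modules p)"
      using qdim_space_gen unfolding qdim_space_def by metis
    fix a b assume "a \<in> (\<lambda>X. restrict (qdim p X) S) ` singlet_modules p" "b \<in> (\<lambda>X. restrict (qdim p X) S) ` singlet_modules p"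
    then obtain X X' where X: "X \<in> singlet_modules p" "X' \<in> singlet_modules p" and ab: "a = restrict (qdim p X) S" "b = restrict (qdim p X') S" by blast
    have "a \<otimes>\<^bsub>function_ring S\<^esub> b = restrict (\<lambda>\<epsilon>. qdim p X \<epsilon> * qdim p X' \<epsilon>) S"
      by (auto simp: ab function_ring_def fun_eq_iff)
    then show "a \<otimes>\<^bsub>function_ring S\<^esub> b \<in> generate (add_monoid (function_ring S)) ((\<lambda>X. restrict (qdim p X) S) ` singlet_modules p)"
      using prod[OF X] unfolding qdim_space_def by simp
  qed
  then show ?thesis by (simp add: qdim_ring_def qdim_space_def)
qed

section \<open>Truncated fusion\<close>

lemma unity_root_p_facts:
  assumes "p > 0" "\<not> int p dvd m"
  shows "unity_root p m \<noteq> 0" "(unity_root p m)\<^sup>2 \<noteq> 1" "unity_root p m powi (2 * int p) = 1"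
  using unity_root_square[OF assms(1)] unity_root_power_2p[OF assms(1)] assms(2) by auto

text \<open>At a root of unity, indices beyond \<open>p\<close> cancel against smaller ones; this is the truncation
  in the fusion rules.\<close>

lemma qnum_reflect:
  assumes z: "z \<noteq> 0" "z\<^sup>2 \<noteq> 1" "z powi (2 * k) = 1"
  shows "qnum z (2 * k - t) = - qnum z t"
proof -
  have "(z - inverse z) * qnum z (2 * k - t) = (z - inverse z) * (- qnum z t)"
  proof -
    have "z powi (- (2 * k)) = 1" using z by (simp add: power_int_minus)
    moreover have "2 * k - t = 2 * k + - t" "- (2 * k - t) = - (2 * k) + t" by simp_all
    ultimately have "z powi (2 * k - t) = z powi (- t)" "z powi (- (2 * k - t)) = z powi t"
      using z by (simp_all only: power_int_add simp_thms mult_1)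
    then show ?thesis unfolding mult_minus_right qnum_nondeg[OF z(1,2)] by simp
  qed
  moreover have "z - inverse z \<noteq> 0" using z_minus_inverse[OF z(1)] z(2) by blast
  ultimately show ?thesis by (metis mult_left_cancel)
qed

lemma qnum_translate:
  assumes z: "z \<noteq> 0" "z\<^sup>2 \<noteq> 1" "z powi (2 * k) = 1"
  shows "z powi k * qnum z t = qnum z (t + k)"
proof -
  have "z powi (- k) = z powi k"
  proof -
    have "k = - k + 2 * k" by simp
    then have "z powi k = z powi (- k) * z powi (2 * k)" using z(1) by (metis power_int_add)
    then show ?thesis using z(3) by simp
  qed
  moreover have "- (t + k) = - t + - k" by simp
  ultimately have "z powi (t + k) = z powi t * z powi k" "z powi (- (t + k)) = z powi (- t) * z powi k"
    using z(1) by (simp_all only: power_int_add simp_thms)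
  then have "(z - inverse z) * qnum z (t + k) = z powi k * ((z - inverse z) * qnum z t)"
    unfolding qnum_nondeg[OF z(1,2)] by (simp add: algebra_simps)
  then have "(z - inverse z) * (z powi k * qnum z t) = (z - inverse z) * qnum z (t + k)"
    by (simp only: mult_ac)
  moreover have "z - inverse z \<noteq> 0" using z_minus_inverse[OF z(1)] z(2) by blast
  ultimately show ?thesis by (metis mult_left_cancel)
qed

lemma fusion_set_commute: "fusion_set l a b = fusion_set l b a"
proof -
  have "\<bar>int a - int b\<bar> = \<bar>int b - int a\<bar>" "a + b = b + a" "2 * l - a - b = 2 * l - b - a" by auto
  then show ?thesis unfolding fusion_set_def by metis
qed

lemma fusion_set_subset: "a \<le> l \<Longrightarrow> b \<le> l \<Longrightarrow> fusion_set l a b \<subseteq> {..l}"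
  unfolding fusion_set_def by auto

lemma finite_fusion_set [simp]: "finite (fusion_set l a b)"
  unfolding fusion_set_def by simp

text \<open>In the Clebsch-Gordan sum, the indices larger than allowed by the truncation form an interval
  that is symmetric about \<open>p\<close>. The reflection changes the sign of the terms, so that their sum
  vanishes.\<close>

lemma qnum_fusion_le:
  assumes z: "z \<noteq> 0" "z\<^sup>2 \<noteq> 1" "z powi (2 * int p) = 1" and ab: "a \<le> b" "b \<le> p - 2" "p \<ge> 2"
  shows "qnum z (int (Suc a)) * qnum z (int (Suc b)) = (\<Sum>c\<in>fusion_set (p - 2) a b. qnum z (int (Suc c)))"
proof -
  define f where "f j = qnum z (int (Suc b) + int (Suc a) - 1 - 2 * int j)" for j
  \<comment> \<open>the first \<open>k\<close> indices of the Clebsch-Gordan sum are beyond the truncation; \<open>k\<close> is \<open>0\<close> if there are none\<close>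
  define k where "k = a + b + 2 - p"
  have k: "k \<le> Suc a" using ab by (simp add: k_def)
  have "qnum z (int (Suc a)) * qnum z (int (Suc b)) = (\<Sum>j<Suc a. f j)"
    unfolding f_def by (rule qnum_mult[OF z(1)])
  also have "\<dots> = (\<Sum>j<k. f j) + (\<Sum>j\<in>{k..<Suc a}. f j)"
    using sum.atLeastLessThan_concat[of 0 k "Suc a" f] k by (simp add: lessThan_atLeast0)
  also have "(\<Sum>j<k. f j) = 0"
  proof -
    have anti: "f (k - Suc j) = - f j" if "j < k" for j
    proof -
      have "int (Suc b) + int (Suc a) - 1 - 2 * int (k - Suc j) = 2 * int p - (int (Suc b) + int (Suc a) - 1 - 2 * int j)"
        using that by (simp add: k_def of_nat_diff)
      then show ?thesis unfolding f_def by (simp only: qnum_reflect[OF z])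
    qed
    have "(\<Sum>j<k. f j) = (\<Sum>j<k. f (k - Suc j))" by (rule sum.nat_diff_reindex[symmetric])
    also have "\<dots> = (\<Sum>j<k. - f j)" by (intro sum.cong refl anti) simp
    finally show ?thesis by (simp add: sum_negf)
  qed
  also have "(\<Sum>j\<in>{k..<Suc a}. f j) = (\<Sum>c\<in>fusion_set (p - 2) a b. qnum z (int (Suc c)))"
  proof (rule sum.reindex_bij_witness[of _ "\<lambda>c. (a + b - c) div 2" "\<lambda>j. a + b - 2 * j"])
    fix j assume j: "j \<in> {k..<Suc a}"
    show "(a + b - (a + b - 2 * j)) div 2 = j" using j ab by simp
    have "int (a + b - 2 * j) = \<bar>int a - int b\<bar> + 2 * int (a - j)" using j ab by (simp add: of_nat_diff)
    moreover have "a + b - 2 * j \<le> min (a + b) (2 * (p - 2) - a - b)" using j ab by (auto simp: k_def)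
    ultimately show "a + b - 2 * j \<in> fusion_set (p - 2) a b" unfolding fusion_set_def by blast
    have "int (Suc (a + b - 2 * j)) = int (Suc b) + int (Suc a) - 1 - 2 * int j" using j ab by (simp add: of_nat_diff)
    then show "qnum z (int (Suc (a + b - 2 * j))) = f j" unfolding f_def by (rule arg_cong)
  next
    fix c assume "c \<in> fusion_set (p - 2) a b"
    then obtain i where i: "int c = \<bar>int a - int b\<bar> + 2 * int i" and c: "c \<le> a + b" "c \<le> 2 * (p - 2) - a - b"
      unfolding fusion_set_def by auto
    have ci: "c + a = b + 2 * i" using i ab by linarith
    then have e: "(a + b - c) div 2 = a - i" "i \<le> a" using c by linarith+
    show "a + b - 2 * ((a + b - c) div 2) = c" using e ci by linarith
    show "(a + b - c) div 2 \<in> {k..<Suc a}" using e ci c ab by (auto simp: k_def)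
  qed
  finally show ?thesis by simp
qed

lemma qnum_fusion:
  assumes z: "z \<noteq> 0" "z\<^sup>2 \<noteq> 1" "z powi (2 * int p) = 1" and ab: "a \<le> p - 2" "b \<le> p - 2" "p \<ge> 2"
  shows "qnum z (int (Suc a)) * qnum z (int (Suc b)) = (\<Sum>c\<in>fusion_set (p - 2) a b. qnum z (int (Suc c)))"
proof (cases "a \<le> b")
  case True
  then show ?thesis using qnum_fusion_le[OF z] ab by blast
next
  case False
  then show ?thesis using qnum_fusion_le[OF z, of b a] ab fusion_set_commute[of "p - 2" a b] by (simp add: mult.commute)
qed

lemma unity_root_surj:
  assumes "p > 0" "z ^ (2 * p) = 1"
  shows "\<exists>m. z = unity_root p m"
proof -
  have "(\<lambda>k. cis (2 * pi * real k / real (2 * p))) ` {..<2 * p} = {z. z ^ (2 * p) = 1}"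
    by (rule bij_betw_imp_surj_on[OF Complex.bij_betw_roots_unity]) (use assms in simp)
  then have "z \<in> (\<lambda>k. cis (2 * pi * real k / real (2 * p))) ` {..<2 * p}"
    using assms(2) by blast
  then obtain k where "z = cis (2 * pi * real k / real (2 * p))" by blast
  then have "z = unity_root p (int k)" by (simp add: unity_root_def)
  then show ?thesis by blast
qed

text \<open>Up to a power of \<open>z\<close> and the factor \<open>z - z\<^sup>-\<^sup>1\<close>, the combination is a polynomial in \<open>z\<close> of degree at
  most \<open>2p - 2\<close>. It vanishes at all \<open>2p\<close> roots of unity of order \<open>2p\<close>: at \<open>\<plusminus>1\<close> by antisymmetry, and
  elsewhere by assumption.\<close>

lemma qnum_independent:
  fixes x :: "nat \<Rightarrow> complex"
  assumes p: "p \<ge> 2"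
    and zero: "\<And>m. \<not> int p dvd m \<Longrightarrow> (\<Sum>a\<le>p - 2. x a * qnum (unity_root p m) (int (Suc a))) = 0"
    and a: "a \<le> p - 2"
  shows "x a = 0"
proof -
  define Q where "Q = (\<Sum>a\<le>p - 2. Polynomial.monom (x a) (p + a) - Polynomial.monom (x a) (p - 2 - a))"
  have root: "poly Q z = 0" if z: "z ^ (2 * p) = 1" for z
  proof -
    have z0: "z \<noteq> 0" using z p by (auto simp: power_0_left)
    obtain m where m: "z = unity_root p m" using unity_root_surj[of p z] z p by auto
    have "poly Q z = (\<Sum>a\<le>p - 2. z powi (int p - 1) * (x a * (z powi int (Suc a) - z powi (- int (Suc a)))))"
    proof -
      have "z ^ (p + a) = z powi (int p - 1) * z powi int (Suc a)" for a
        using z0 by (simp flip: power_int_add power_int_of_nat)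
      moreover have "z ^ (p - 2 - a) = z powi (int p - 1) * z powi (- int (Suc a))" if "a \<le> p - 2" for a
      proof -
        have "int p - 1 + - int (Suc a) = int (p - 2 - a)" using that p by (simp add: of_nat_diff)
        then have "z powi (int p - 1) * z powi (- int (Suc a)) = z powi int (p - 2 - a)"
          using z0 by (simp only: power_int_add[symmetric] simp_thms)
        then show ?thesis by simp
      qed
      ultimately show ?thesis
        unfolding Q_def poly_sum by (intro sum.cong refl) (simp add: poly_monom right_diff_distrib mult_ac)
    qed
    also have "\<dots> = 0"
    proof (cases "int p dvd m")
      case True
      then have z2: "z\<^sup>2 = 1" using unity_root_square[of p m] p m by simp
      have "z powi int (Suc a) = z powi (- int (Suc a))" for a
        by (rule powi_even_shift[OF z0 z2, of _ _ "int (Suc a)"]) simp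
      then show ?thesis by simp
    next
      case False
      then have z2: "z\<^sup>2 \<noteq> 1" using unity_root_square[of p m] p m by simp
      have "(\<Sum>a\<le>p - 2. z powi (int p - 1) * (x a * (z powi int (Suc a) - z powi (- int (Suc a)))))
        = z powi (int p - 1) * ((z - inverse z) * (\<Sum>a\<le>p - 2. x a * qnum z (int (Suc a))))"
        unfolding qnum_nondeg[OF z0 z2, symmetric] sum_distrib_left by (intro sum.cong refl) (simp only: mult_ac)
      then show ?thesis using zero[OF False] m by simp
    qed
    finally show ?thesis .
  qed
  have "Q = 0"
  proof (rule ccontr)
    assume Q: "Q \<noteq> 0"
    have "Polynomial.degree Q \<le> 2 * p - 2"
      unfolding Q_def
    proof (intro degree_sum_le degree_diff_le)
      fix a assume "a \<in> {..p - 2}"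
      then show "Polynomial.degree (Polynomial.monom (x a) (p + a)) \<le> 2 * p - 2" "Polynomial.degree (Polynomial.monom (x a) (p - 2 - a)) \<le> 2 * p - 2"
        using p by (auto intro: order_trans[OF degree_monom_le])
    qed simp
    moreover have "2 * p = card {z::complex. z ^ (2 * p) = 1}" using p by (simp add: card_roots_unity_eq)
    moreover have "card {z::complex. z ^ (2 * p) = 1} \<le> card {z. poly Q z = 0}"
      using root poly_roots_finite[OF Q] by (intro card_mono) auto
    moreover have "card {z. poly Q z = 0} \<le> Polynomial.degree Q" by (rule card_poly_roots_bound[OF Q])
    ultimately show False using p by linarith
  qed
  moreover have "Polynomial.coeff Q (p + a) = x a"
  proof -
    have "Polynomial.coeff Q (p + a) = (\<Sum>b\<le>p - 2. if b = a then x b else 0)"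
      unfolding Q_def Polynomial.coeff_sum using p by (intro sum.cong refl) auto
    then show ?thesis using a by simp
  qed
  ultimately show ?thesis by simp
qed

section \<open>The isomorphism with the fusion ring\<close>

text \<open>The additive map from the fusion ring to the complex numbers that sends \<open>\<phi>\<^sub>a\<close> to \<open>U a\<close>.\<close>

definition fusion_eval :: "nat \<Rightarrow> (nat \<Rightarrow> complex) \<Rightarrow> (nat \<Rightarrow>\<^sub>0 int) \<Rightarrow> complex"
  where "fusion_eval l U x = (\<Sum>a\<le>l. of_int (Poly_Mapping.lookup x a) * U a)"

lemma fusion_eval_add: "fusion_eval l U (x + y) = fusion_eval l U x + fusion_eval l U y"
  by (simp add: fusion_eval_def lookup_add distrib_right sum.distrib)

lemma fusion_eval_cmul: "fusion_eval l U (frag_cmul n x) = of_int n * fusion_eval l U x"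
  by (simp add: fusion_eval_def sum_distrib_left mult.assoc)

lemma fusion_eval_0: "fusion_eval l U 0 = 0"
  by (simp add: fusion_eval_def)

lemma fusion_eval_uminus: "fusion_eval l U (- x) = - fusion_eval l U x"
  by (simp add: fusion_eval_def sum_negf)

lemma fusion_eval_sum: "fusion_eval l U (\<Sum>i\<in>I. f i) = (\<Sum>i\<in>I. fusion_eval l U (f i))"
  by (induction I rule: infinite_finite_induct) (simp_all add: fusion_eval_0 fusion_eval_add)

lemma fusion_eval_of:
  assumes "a \<le> l"
  shows "fusion_eval l U (frag_of a) = U a"
proof -
  have "fusion_eval l U (frag_of a) = (\<Sum>b\<le>l. if b = a then U b else 0)"
    unfolding fusion_eval_def by (intro sum.cong) auto
  then show ?thesis using assms by simp
qed

lemma fusion_eval_extend: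
  assumes "Poly_Mapping.keys x \<subseteq> {..l}" "\<And>a. a \<le> l \<Longrightarrow> fusion_eval l U (f a) = U a * C"
  shows "fusion_eval l U (frag_extend f x) = fusion_eval l U x * C"
proof -
  have "fusion_eval l U (frag_extend f x) = (\<Sum>i\<in>Poly_Mapping.keys x. of_int (Poly_Mapping.lookup x i) * fusion_eval l U (f i))"
    by (simp add: frag_extend_def fusion_eval_sum fusion_eval_cmul)
  also have "\<dots> = (\<Sum>i\<in>Poly_Mapping.keys x. of_int (Poly_Mapping.lookup x i) * U i * C)"
    using assms by (intro sum.cong refl) (auto simp: mult.assoc)
  also have "\<dots> = (\<Sum>i\<le>l. of_int (Poly_Mapping.lookup x i) * U i * C)"
    using assms(1) by (intro sum.mono_neutral_left) (auto simp: in_keys_iff)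
  finally show ?thesis by (simp add: fusion_eval_def sum_distrib_right)
qed

lemma fusion_eval_mult:
  assumes U: "\<And>a b. a \<le> l \<Longrightarrow> b \<le> l \<Longrightarrow> U a * U b = (\<Sum>c\<in>fusion_set l a b. U c)"
    and x: "Poly_Mapping.keys x \<subseteq> {..l}" and y: "Poly_Mapping.keys y \<subseteq> {..l}"
  shows "fusion_eval l U (x \<otimes>\<^bsub>sl2_fusion_ring l\<^esub> y) = fusion_eval l U x * fusion_eval l U y"
  unfolding sl2_fusion_ring_def ring.simps monoid.simps
proof (rule fusion_eval_extend[OF x])
  fix a assume a: "a \<le> l"
  have "fusion_eval l U (frag_extend (\<lambda>b. \<Sum>c\<in>fusion_set l a b. frag_of c) y) = fusion_eval l U y * U a"
  proof (rule fusion_eval_extend[OF y])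
    fix b assume b: "b \<le> l"
    have "fusion_eval l U (\<Sum>c\<in>fusion_set l a b. frag_of c) = (\<Sum>c\<in>fusion_set l a b. U c)"
      unfolding fusion_eval_sum using fusion_set_subset[OF a b] by (intro sum.cong refl fusion_eval_of) auto
    then show "fusion_eval l U (\<Sum>c\<in>fusion_set l a b. frag_of c) = U b * U a"
      using U[OF a b] by (simp add: mult.commute)
  qed
  then show "fusion_eval l U (frag_extend (\<lambda>b. \<Sum>c\<in>fusion_set l a b. frag_of c) y) = U a * fusion_eval l U y"
    by (simp add: mult.commute)
qed

lemma keys_frag_extend_subset:
  assumes "\<And>i. i \<in> Poly_Mapping.keys x \<Longrightarrow> Poly_Mapping.keys (f i) \<subseteq> A"
  shows "Poly_Mapping.keys (frag_extend f x) \<subseteq> A"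
  using keys_frag_extend[of f x] assms by blast

lemma fusion_ring_mult_closed:
  assumes x: "Poly_Mapping.keys x \<subseteq> {..l}" and y: "Poly_Mapping.keys y \<subseteq> {..l}"
  shows "Poly_Mapping.keys (x \<otimes>\<^bsub>sl2_fusion_ring l\<^esub> y) \<subseteq> {..l}"
  unfolding sl2_fusion_ring_def ring.simps monoid.simps
proof (intro keys_frag_extend_subset)
  fix a b assume "a \<in> Poly_Mapping.keys x" "b \<in> Poly_Mapping.keys y"
  then have "fusion_set l a b \<subseteq> {..l}" using x y by (intro fusion_set_subset) auto
  then have "(\<Union>c\<in>fusion_set l a b. Poly_Mapping.keys (frag_of c)) \<subseteq> {..l}" by (auto simp: keys_frag_of)
  then show "Poly_Mapping.keys (\<Sum>c\<in>fusion_set l a b. frag_of c) \<subseteq> {..l}"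
    using Poly_Mapping.keys_sum[of frag_of "fusion_set l a b"] by blast
qed

text \<open>Points at which \<open>Im c\<close> is an integer not divisible by \<open>p\<close>: \<open>B_bound\<close> is \<open>0\<close> there and the minimum is
  attained once. They separate the basis elements of the fusion ring.\<close>

lemma generating_point:
  assumes p: "p \<ge> 2" and m: "\<not> int p dvd m"
  defines "\<epsilon> \<equiv> Complex (- 1) (of_int m / sqrt (2 * real p))"
  shows "\<epsilon> \<in> qdim_domain p" "Re \<epsilon> < B_bound p \<epsilon>"
    "irr_values p \<epsilon> (unity_root p m)"
proof -
  have p0: "p > 0" and a: "sqrt (2 * real p) > 0" using p by auto
  have im: "Im (scaled p \<epsilon>) = of_int m" using a by (simp add: scaled_def \<epsilon>_def)
  have B: "B_bound p \<epsilon> = 0" using B_bound_eq[OF p0 m, of \<epsilon>] a by (simp add: im)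
  show below: "Re \<epsilon> < B_bound p \<epsilon>" unfolding B by (simp add: \<epsilon>_def)
  have "\<bar>of_int m / sqrt (2 * real p) - Im \<epsilon>\<bar> = - B_bound p \<epsilon>" unfolding B by (simp add: \<epsilon>_def)
  moreover have "m' = m" if "\<bar>of_int m' / sqrt (2 * real p) - Im \<epsilon>\<bar> = - B_bound p \<epsilon>" for m'
    using that a unfolding B by (simp add: \<epsilon>_def)
  ultimately show "\<epsilon> \<in> qdim_domain p" 
    "irr_values p \<epsilon> (unity_root p m)"
    using unique_minimiser_point[OF p below m] by blast+
qed

text \<open>In the region \<open>z\<close> is a root of unity of order \<open>2p\<close> with \<open>z\<^sup>2 \<noteq> 1\<close>, so \<open>[p] = 0\<close> and \<open>z\<^sup>p = \<plusminus>1\<close>. The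
  generator \<open>M\<^bsub>r,s\<^esub>\<close> is \<open>[s]\<close> for odd \<open>r\<close> and \<open>z\<^sup>p [s] = - [p - s]\<close> for even \<open>r\<close>, hence the span is
  generated by the \<open>[a + 1]\<close> with \<open>a \<le> p - 2\<close>, the images of the \<open>\<phi>\<^sub>a\<close>.\<close>

theorem qdim_ring_iso_fusion:
  assumes p: "p \<ge> 2"
  shows "qdim_ring p (qdim_domain p \<inter> {\<epsilon>. Re \<epsilon> < B_bound p \<epsilon>}) \<simeq> sl2_fusion_ring (p - 2)"
proof -
  define S where "S = qdim_domain p \<inter> {\<epsilon>. Re \<epsilon> < B_bound p \<epsilon>}"
  define l where "l = p - 2"
  define U where "U \<epsilon> a = qdim p (Irr 1 (Suc a)) \<epsilon>" for \<epsilon> a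
  define psi where "psi x = restrict (\<lambda>\<epsilon>. fusion_eval l (U \<epsilon>) x) S" for x
  let ?C = "{x :: nat \<Rightarrow>\<^sub>0 int. Poly_Mapping.keys x \<subseteq> {..l}}"
  let ?F = "sl2_fusion_ring l"
  let ?V = "qdim_space p S"
  have p0: "p > 0" using p by simp
  have C: "carrier ?F = ?C" by (simp add: sl2_fusion_ring_def)
  have point: "\<exists>m. \<not> int p dvd m \<and> irr_values p \<epsilon> (unity_root p m) \<and> (\<forall>\<nu>. qdim p (Fock \<nu>) \<epsilon> = 0)" if "\<epsilon> \<in> S" for \<epsilon>
  proof -
    have "\<epsilon> \<in> qdim_domain p" "Re \<epsilon> < B_bound p \<epsilon>" using that by (auto simp: S_def)
    from below_bound_point[OF p this] show ?thesis by metis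
  qed
  have U_root: "U \<epsilon> a = qnum (unity_root p m) (int (Suc a))"
    if "irr_values p \<epsilon> (unity_root p m)" "a \<le> l" for \<epsilon> m a
    using that(1)[unfolded irr_values_def, rule_format, of "Suc a" 1] that(2) p by (simp add: U_def l_def)
  have U_mult: "U \<epsilon> a * U \<epsilon> b = (\<Sum>c\<in>fusion_set l a b. U \<epsilon> c)" if e: "\<epsilon> \<in> S" and ab: "a \<le> l" "b \<le> l" for \<epsilon> a b
  proof -
    obtain m where m: "\<not> int p dvd m" and Um: "\<And>a. a \<le> l \<Longrightarrow> U \<epsilon> a = qnum (unity_root p m) (int (Suc a))"
      using point[OF e] U_root by blast
    have "(\<Sum>c\<in>fusion_set l a b. U \<epsilon> c) = (\<Sum>c\<in>fusion_set l a b. qnum (unity_root p m) (int (Suc c)))"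
      using fusion_set_subset[OF ab] by (intro sum.cong refl Um) auto
    then show ?thesis using qnum_fusion[OF unity_root_p_facts[OF p0 m], of a b] ab p Um by (simp add: l_def)
  qed
  have U_zero: "U \<epsilon> 0 = 1" if "\<epsilon> \<in> S" for \<epsilon>
    using point[OF that] U_root[of \<epsilon> _ 0] qnum_1[OF unity_root_nonzero] by auto
  have psi_in: "psi x \<in> ?V" for x
    unfolding psi_def fusion_eval_def U_def
  proof (intro qdim_space_sum qdim_space_int_mult qdim_space_gen)
    fix a assume "a \<in> {..l}"
    then show "Irr 1 (Suc a) \<in> singlet_modules p" using p by (auto simp: singlet_modules_def l_def)
  qed simp
  have psi_add: "psi x \<oplus>\<^bsub>function_ring S\<^esub> psi y = psi (x + y)" for x y
    by (auto simp: psi_def function_ring_def fusion_eval_add fun_eq_iff)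
  have psi_minus: "\<ominus>\<^bsub>function_ring S\<^esub> psi x = psi (- x)" for x
    by (subst function_ring_minus) (auto simp: psi_def function_ring_def fusion_eval_uminus fun_eq_iff)
  have psi_mult: "psi x \<otimes>\<^bsub>function_ring S\<^esub> psi y = psi (x \<otimes>\<^bsub>?F\<^esub> y)" if "x \<in> ?C" "y \<in> ?C" for x y
    using that U_mult by (auto simp: psi_def function_ring_def fusion_eval_mult fun_eq_iff)
  have gen_in: "\<exists>x\<in>?C. restrict (qdim p X) S = psi x" if "X \<in> singlet_modules p" for X
  proof -
    consider (fock) \<nu> where "X = Fock \<nu>" | (top) r where "X = Irr r p"
      | (odd) r s where "X = Irr r s" "1 \<le> s" "s < p" "odd r" | (even) r s where "X = Irr r s" "1 \<le> s" "s < p" "even r"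
      using \<open>X \<in> singlet_modules p\<close> unfolding singlet_modules_def by fastforce
    then show ?thesis
    proof cases
      case (fock \<nu>)
      have "restrict (qdim p X) S = psi 0"
        unfolding psi_def fock using point by (intro restrict_ext) (auto simp: fusion_eval_0)
      then show ?thesis by (intro bexI[of _ 0]) auto
    next
      \<comment> \<open>the value is a multiple of \<open>[p] = 0\<close>\<close>
      case (top r)
      have "restrict (qdim p X) S = psi 0"
        unfolding psi_def top
      proof (rule restrict_ext)
        fix \<epsilon> assume "\<epsilon> \<in> S"
        from point[OF this] show "qdim p (Irr r p) \<epsilon> = fusion_eval l (U \<epsilon>) 0"
          using p0 qnum_root_p[OF p0] by (auto simp: irr_values_def fusion_eval_0)
      qed
      then show ?thesis by (intro bexI[of _ 0]) auto
    next
      case (odd r s)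
      have sl: "s - 1 \<le> l" "Suc (s - 1) = s" using odd by (auto simp: l_def)
      have "restrict (qdim p X) S = psi (frag_of (s - 1))"
        unfolding psi_def odd(1) fusion_eval_of[OF sl(1)]
      proof (rule restrict_ext)
        fix \<epsilon> assume "\<epsilon> \<in> S"
        from point[OF this] obtain m where m: "\<not> int p dvd m"
          and q: "irr_values p \<epsilon> (unity_root p m)" by blast
        obtain k where k: "r - 1 = 2 * k" using odd(4) by (metis odd_two_times_div_two_succ add_diff_cancel_right' diff_add_cancel)
        have "unity_root p m powi (int p * (r - 1)) = (unity_root p m powi (2 * int p)) powi k"
          unfolding k power_int_mult[symmetric] by (simp add: mult_ac)
        then have "unity_root p m powi (int p * (r - 1)) = 1" using unity_root_power_2p[OF p0] by simp
        then show "qdim p (Irr r s) \<epsilon> = U \<epsilon> (s - 1)"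
          using q[unfolded irr_values_def, rule_format, of s r] odd U_root[OF q sl(1)] sl(2) by simp
      qed
      moreover have "frag_of (s - 1) \<in> ?C" using sl by (simp add: keys_frag_of)
      ultimately show ?thesis by blast
    next
      case (even r s)
      have sl: "p - 1 - s \<le> l" "Suc (p - 1 - s) = p - s" using even by (auto simp: l_def)
      have "restrict (qdim p X) S = psi (- frag_of (p - 1 - s))"
        unfolding psi_def even(1) fusion_eval_uminus fusion_eval_of[OF sl(1)]
      proof (rule restrict_ext)
        fix \<epsilon> assume "\<epsilon> \<in> S"
        from point[OF this] obtain m where m: "\<not> int p dvd m"
          and q: "irr_values p \<epsilon> (unity_root p m)" by blast
        obtain k where k: "r = 2 * k" using even(4) by blast
        let ?z = "unity_root p m"
        note R = unity_root_p_facts[OF p0 m]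
        have "int p * (r - 1) = 2 * int p * (k - 1) + int p" by (simp add: k algebra_simps)
        then have "?z powi (int p * (r - 1)) = (?z powi (2 * int p)) powi (k - 1) * ?z powi int p"
          using R(1) by (simp only: power_int_add power_int_mult[symmetric] simp_thms)
        then have zp: "?z powi (int p * (r - 1)) = ?z powi int p" using R(3) by simp
        have "int s + int p = 2 * int p - int (p - s)" using even by (simp add: of_nat_diff)
        then have "?z powi int p * qnum ?z (int s) = - qnum ?z (int (p - s))"
          unfolding qnum_translate[OF R] by (simp only: qnum_reflect[OF R])
        then show "qdim p (Irr r s) \<epsilon> = - U \<epsilon> (p - 1 - s)"
          using q[unfolded irr_values_def, rule_format, of s r] even U_root[OF q sl(1)] sl(2) zp by simp
      qed
      moreover have "- frag_of (p - 1 - s) \<in> ?C" using sl by (simp add: keys_frag_of)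
      ultimately show ?thesis by blast
    qed
  qed
  have onto: "\<exists>x\<in>?C. f = psi x" if "f \<in> ?V" for f
    using that unfolding qdim_space_def
  proof induction
    case one
    have "\<one>\<^bsub>add_monoid (function_ring S)\<^esub> = psi 0"
      by (auto simp: psi_def function_ring_def fusion_eval_0 fun_eq_iff)
    then show ?case by (intro bexI[of _ 0]) auto
  next
    case (incl h)
    then show ?case using gen_in by blast
  next
    case (inv h)
    then obtain x where x: "x \<in> ?C" "h = psi x" using gen_in by blast
    have "inv\<^bsub>add_monoid (function_ring S)\<^esub> h = psi (- x)"
      unfolding x(2) using psi_minus[of x] by (simp add: a_inv_def)
    then show ?case using x(1) by (intro bexI[of _ "- x"]) auto
  next
    case (eng h1 h2)
    then obtain x y where xy: "x \<in> ?C" "h1 = psi x" "y \<in> ?C" "h2 = psi y" by blast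
    have "h1 \<otimes>\<^bsub>add_monoid (function_ring S)\<^esub> h2 = psi (x + y)" using psi_add[of x y] xy by simp
    moreover have "x + y \<in> ?C" using xy keys_add[of x y] by blast
    ultimately show ?case by blast
  qed
  have inj: "inj_on psi ?C"
  proof (rule inj_onI)
    fix x y assume xy: "x \<in> ?C" "y \<in> ?C" and eq: "psi x = psi y"
    have "Poly_Mapping.lookup x a = Poly_Mapping.lookup y a" if a: "a \<le> l" for a
    proof -
      have "complex_of_int (Poly_Mapping.lookup x a - Poly_Mapping.lookup y a) = 0"
      proof (rule qnum_independent[OF p])
        fix m assume m: "\<not> int p dvd m"
        define e where "e = Complex (- 1) (of_int m / sqrt (2 * real p))"
        note gp = generating_point[OF p m, folded e_def]
        have "e \<in> S" using gp(1,2) by (simp add: S_def)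
        then have "fusion_eval l (U e) x = fusion_eval l (U e) y"
          using fun_cong[OF eq, of e] by (simp add: psi_def)
        moreover have "U e a = qnum (unity_root p m) (int (Suc a))" if "a \<le> l" for a
          using U_root[OF gp(3) that] .
        ultimately show "(\<Sum>a\<le>p - 2. complex_of_int (Poly_Mapping.lookup x a - Poly_Mapping.lookup y a) * qnum (unity_root p m) (int (Suc a))) = 0"
          by (simp add: fusion_eval_def l_def left_diff_distrib sum_subtractf)
      qed (use a in \<open>simp add: l_def\<close>)
      then show ?thesis by simp
    qed
    moreover have "Poly_Mapping.lookup x a = 0 \<and> Poly_Mapping.lookup y a = 0" if "\<not> a \<le> l" for a
      using that xy by (auto simp: in_keys_iff subset_iff)
    ultimately show "x = y" by (intro poly_mapping_eqI) metis
  qed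
  have bij: "bij_betw psi ?C ?V"
    unfolding bij_betw_def using inj psi_in onto by blast
  define h where "h = inv_into ?C psi"
  have h_psi: "h (psi x) = x" if "x \<in> ?C" for x
    unfolding h_def using inj that by (rule inv_into_f_f)
  have carrier: "carrier (qdim_ring p S) = ?V" by (simp add: qdim_ring_def)
  have preimage: thesis
    if f: "f \<in> carrier (qdim_ring p S)" and ex: "\<And>x. Poly_Mapping.keys x \<subseteq> {..l} \<Longrightarrow> f = psi x \<Longrightarrow> thesis" for f thesis
  proof -
    have "f \<in> ?V" using f unfolding carrier .
    from onto[OF this] obtain x where "x \<in> ?C" "f = psi x" by (rule bexE)
    then show thesis using ex by simp
  qed
  have "h \<in> ring_hom (qdim_ring p S) ?F"
  proof (rule ring_hom_memI)
    fix f assume "f \<in> carrier (qdim_ring p S)"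
    then obtain x where x: "Poly_Mapping.keys x \<subseteq> {..l}" "f = psi x" by (rule preimage)
    then have x': "x \<in> ?C" by simp
    show "h f \<in> carrier ?F" unfolding C x(2) h_psi[OF x'] by (rule x')
  next
    fix f g assume fg: "f \<in> carrier (qdim_ring p S)" "g \<in> carrier (qdim_ring p S)"
    obtain x where x: "Poly_Mapping.keys x \<subseteq> {..l}" "f = psi x" using fg(1) by (rule preimage)
    obtain y where y: "Poly_Mapping.keys y \<subseteq> {..l}" "g = psi y" using fg(2) by (rule preimage)
    have xy: "x \<in> ?C" "y \<in> ?C" using x y by simp_all
    have hx: "h f = x" "h g = y" unfolding x(2) y(2) by (rule h_psi, rule xy)+
    have m: "x \<otimes>\<^bsub>?F\<^esub> y \<in> ?C" using fusion_ring_mult_closed[OF x(1) y(1)] by simp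
    have "f \<otimes>\<^bsub>qdim_ring p S\<^esub> g = psi (x \<otimes>\<^bsub>?F\<^esub> y)"
      unfolding x(2) y(2) psi_mult[OF xy, symmetric] by (simp add: qdim_ring_def)
    then show "h (f \<otimes>\<^bsub>qdim_ring p S\<^esub> g) = h f \<otimes>\<^bsub>?F\<^esub> h g"
      using h_psi[OF m] unfolding hx by (simp only:)
    have a: "x + y \<in> ?C" using x y keys_add[of x y] by blast
    have "f \<oplus>\<^bsub>qdim_ring p S\<^esub> g = psi (x + y)"
      unfolding x(2) y(2) psi_add[symmetric] by (simp add: qdim_ring_def)
    then have "h (f \<oplus>\<^bsub>qdim_ring p S\<^esub> g) = x + y" using h_psi[OF a] by (simp only:)
    then show "h (f \<oplus>\<^bsub>qdim_ring p S\<^esub> g) = h f \<oplus>\<^bsub>?F\<^esub> h g"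
      unfolding hx by (simp add: sl2_fusion_ring_def)
  next
    have psi_1: "psi (frag_of 0) = (\<lambda>\<epsilon>\<in>S. 1)"
      unfolding psi_def fusion_eval_of[OF le0] using U_zero by (rule restrict_ext)
    have one: "\<one>\<^bsub>qdim_ring p S\<^esub> = psi (frag_of 0)"
      unfolding psi_1 by (simp add: qdim_ring_def function_ring_def)
    have "frag_of 0 \<in> ?C" unfolding mem_Collect_eq keys_frag_of by simp
    then have "h (psi (frag_of 0)) = frag_of 0" by (rule h_psi)
    then show "h \<one>\<^bsub>qdim_ring p S\<^esub> = \<one>\<^bsub>?F\<^esub>"
      unfolding one sl2_fusion_ring_def monoid.select_convs .
  qed
  moreover have "bij_betw h (carrier (qdim_ring p S)) (carrier ?F)"
    unfolding h_def carrier C by (rule bij_betw_inv_into[OF bij])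
  ultimately show ?thesis unfolding is_ring_iso_def ring_iso_def S_def l_def by blast
qed

theorem proposition14:
  fixes p :: nat
  assumes "p \<ge> 2"
  shows "cring (qdim_ring p (qdim_domain p))
    \<and> {\<epsilon>. Re \<epsilon> < B_bound p \<epsilon> \<and>
          (\<exists>!m::int. \<not> int p dvd m \<and> \<bar>of_int m / sqrt (2 * real p) - Im \<epsilon>\<bar> = - B_bound p \<epsilon>)}
        \<subseteq> qdim_domain p
    \<and> cring (qdim_ring p (qdim_domain p \<inter> {\<epsilon>. Re \<epsilon> < B_bound p \<epsilon>}))
    \<and> qdim_ring p (qdim_domain p \<inter> {\<epsilon>. Re \<epsilon> < B_bound p \<epsilon>}) \<simeq> sl2_fusion_ring (p - 2)"
proof (intro conjI)
  have p0: "p > 0" using assms by simp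
  show "cring (qdim_ring p (qdim_domain p))"
    by (rule cring_qdim_ring[OF p0]) (rule exists_fusion_point[OF assms])
  show "cring (qdim_ring p (qdim_domain p \<inter> {\<epsilon>. Re \<epsilon> < B_bound p \<epsilon>}))"
    by (rule cring_qdim_ring[OF p0]) (use exists_fusion_point[OF assms] in blast)
  show "qdim_ring p (qdim_domain p \<inter> {\<epsilon>. Re \<epsilon> < B_bound p \<epsilon>}) \<simeq> sl2_fusion_ring (p - 2)"
    by (rule qdim_ring_iso_fusion[OF assms])
  show "{\<epsilon>. Re \<epsilon> < B_bound p \<epsilon> \<and>
          (\<exists>!m::int. \<not> int p dvd m \<and> \<bar>of_int m / sqrt (2 * real p) - Im \<epsilon>\<bar> = - B_bound p \<epsilon>)}
        \<subseteq> qdim_domain p"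
  proof
    fix \<epsilon> assume "\<epsilon> \<in> {\<epsilon>. Re \<epsilon> < B_bound p \<epsilon> \<and>
          (\<exists>!m::int. \<not> int p dvd m \<and> \<bar>of_int m / sqrt (2 * real p) - Im \<epsilon>\<bar> = - B_bound p \<epsilon>)}"
    then have below: "Re \<epsilon> < B_bound p \<epsilon>"
      and ex1: "\<exists>!m::int. \<not> int p dvd m \<and> \<bar>of_int m / sqrt (2 * real p) - Im \<epsilon>\<bar> = - B_bound p \<epsilon>" by auto
    obtain m1 where m1: "\<not> int p dvd m1" "\<bar>of_int m1 / sqrt (2 * real p) - Im \<epsilon>\<bar> = - B_bound p \<epsilon>" using ex1 by blast
    show "\<epsilon> \<in> qdim_domain p"
      by (rule unique_minimiser_point(1)[OF assms below m1]) (use ex1 m1 in blast)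
  qed
qed

end
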